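(* When parameterized by the vertex cover number $k$ of the input graph, Enum Minimal MC admits a fully-polynomial enumeration kernel, and Enum MC and Enum Maximal MC admit polynomial-delay enumeration kernels, where in all three cases the kernel is a graph with $\mathcal O(k^2)$ vertices.
   Context: A matching cut of a graph $G$ is a (possibly empty) edge set $M$ that is a matching and equals $E(A,B)$ (edges between $A$ and $B$) for some partition $\{A,B\}$ of $V(G)$; minimal/maximal are with respect to inclusion among matching cuts. Enum MC / Enum Minimal MC / Enum Maximal MC: given $G$, list all / all minimal / all maximal matching cuts of $G$ without repetition. The vertex cover number $\tau(G)$ is the minimum size of a set $X\subseteq V(G)$ meeting every edge; the parameter $k=\tau(G)$ is given with the input. For a parameterized enumeration problem with instance $x$, solution set $\mathsf{Sol}(x)$, parameter $\kappa(x)$: a fully-polynomial enumeration kernel is a pair of algorithms $\mathcal A,\mathcal A'$ where $\mathcal A$ computes from $x$, in time polynomial in $|x|+\kappa(x)$, an instance $y$ with $|y|+\kappa(y)\le f(\kappa(x))$ ($f$ computable), and for each $s\in\mathsf{Sol}(y)$, $\mathcal A'$ computes in time polynomial in $|x|+|y|+\kappa(x)+\kappa(y)$ a nonempty set $S_s\subseteq\mathsf{Sol}(x)$ such that $\{S_s:s\in\mathsf{Sol}(y)\}$ partitions $\mathsf{Sol}(x)$. A polynomial-delay enumeration kernel is the same except that $\mathcal A'$ enumerates $S_s$ with delay polynomial in $|x|+|y|+\kappa(x)+\kappa(y)$ (delay = time before the first output, between consecutive outputs, and after the last output). *)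

theory Defs
  imports
    Complex_Main
    "HOL-Computational_Algebra.Polynomial"
    "HOL-Library.Disjoint_Sets"
    "HOL-Library.Landau_Symbols"
    "HOL-Library.Product_Lexorder"
begin

section \<open>Graphs and matching cuts\<close>

definition simple_graph :: "'a set \<Rightarrow> 'a set set \<Rightarrow> bool" where
  "simple_graph V E \<longleftrightarrow> finite V \<and> (\<forall>e\<in>E. e \<subseteq> V \<and> card e = 2)"

definition edges_between :: "'a set set \<Rightarrow> 'a set \<Rightarrow> 'a set \<Rightarrow> 'a set set" where
  "edges_between E A B = {e \<in> E. \<exists>a\<in>A. \<exists>b\<in>B. e = {a, b}}"

text \<open>A set of edges is a matching iff its members are pairwise disjoint. Both sides of the cut
  are nonempty (this is part of \<^const>\<open>partition_on\<close>), so the empty set is a matching cut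
  precisely for disconnected graphs.\<close>

definition matching_cut :: "'a set \<Rightarrow> 'a set set \<Rightarrow> 'a set set \<Rightarrow> bool" where
  "matching_cut V E M \<longleftrightarrow> disjoint M \<and>
     (\<exists>A B. A \<noteq> B \<and> partition_on V {A, B} \<and> M = edges_between E A B)"

definition minimal_matching_cut :: "'a set \<Rightarrow> 'a set set \<Rightarrow> 'a set set \<Rightarrow> bool" where
  "minimal_matching_cut V E M \<longleftrightarrow> matching_cut V E M \<and>
     (\<forall>M'. matching_cut V E M' \<and> M' \<subseteq> M \<longrightarrow> M' = M)"

definition maximal_matching_cut :: "'a set \<Rightarrow> 'a set set \<Rightarrow> 'a set set \<Rightarrow> bool" where
  "maximal_matching_cut V E M \<longleftrightarrow> matching_cut V E M \<and>
     (\<forall>M'. matching_cut V E M' \<and> M \<subseteq> M' \<longrightarrow> M' = M)"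

definition vertex_cover :: "'a set \<Rightarrow> 'a set set \<Rightarrow> 'a set \<Rightarrow> bool" where
  "vertex_cover V E X \<longleftrightarrow> X \<subseteq> V \<and> (\<forall>e\<in>E. e \<inter> X \<noteq> {})"

definition vertex_cover_number :: "'a set \<Rightarrow> 'a set set \<Rightarrow> nat" where
  "vertex_cover_number V E = (LEAST k. \<exists>X. vertex_cover V E X \<and> card X = k)"


section \<open>A model of computation with running times and delays\<close>

text \<open>Data are binary trees with numbers at the leaves. Numbers are measured in unary, which is
  polynomially equivalent to the usual size for the encodings of graphs used below.\<close>

datatype val = N nat | P val val

fun vsize :: "val \<Rightarrow> nat" where
  "vsize (N n) = Suc n"
| "vsize (P a b) = Suc (vsize a + vsize b)"

definition enc_list :: "val list \<Rightarrow> val" where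
  "enc_list vs = foldr P vs (N 0)"

text \<open>While programs over such trees. The primitive operations are those of a pure LISP machine
  with number atoms (pairing, projections, successor, predecessor, and tests on atoms). No primitive
  increases the magnitude of numbers by more than one, and trees can be represented by shared
  pointers, so unit cost per executed command is polynomially equivalent to Turing machine time.
  Operations applied to arguments of the wrong shape return \<open>N 0\<close>, which also plays the role of the
  empty list and of falsity.\<close>

datatype expr =
    Var nat | Num nat | Pair expr expr | Fst expr | Snd expr | Succ expr | Pred expr
  | IsPair expr | Equal expr expr | Less expr expr

type_synonym state = "nat \<Rightarrow> val"

fun eval :: "expr \<Rightarrow> state \<Rightarrow> val" where
  "eval (Var x) s = s x"
| "eval (Num n) s = N n"
| "eval (Pair a b) s = P (eval a s) (eval b s)"
| "eval (Fst a) s = (case eval a s of P u v \<Rightarrow> u | N n \<Rightarrow> N 0)"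
| "eval (Snd a) s = (case eval a s of P u v \<Rightarrow> v | N n \<Rightarrow> N 0)"
| "eval (Succ a) s = (case eval a s of P u v \<Rightarrow> N 0 | N n \<Rightarrow> N (Suc n))"
| "eval (Pred a) s = (case eval a s of P u v \<Rightarrow> N 0 | N n \<Rightarrow> N (n - 1))"
| "eval (IsPair a) s = (case eval a s of P u v \<Rightarrow> N 1 | N n \<Rightarrow> N 0)"
| "eval (Equal a b) s = (case (eval a s, eval b s) of
      (N m, N n) \<Rightarrow> N (if m = n then 1 else 0) | _ \<Rightarrow> N 0)"
| "eval (Less a b) s = (case (eval a s, eval b s) of
      (N m, N n) \<Rightarrow> N (if m < n then 1 else 0) | _ \<Rightarrow> N 0)"

text \<open>\<open>Call x c e\<close> runs \<open>c\<close> as a non-recursive block with its own local variables: variable \<open>0\<close> of the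
  block initially holds the value of \<open>e\<close>, and its final content is returned in \<open>x\<close>.\<close>

datatype com =
    Skip | Assign nat expr | Seq com com | If expr com com | While expr com
  | Output expr | Call nat com expr

text \<open>The trace of a run records one \<open>Tick\<close> per time unit, interleaved with the outputs.
  Outputting a value takes time proportional to its size, so values cannot profit from sharing
  when they are written.\<close>

datatype event = Tick | Out val

definition init :: "val \<Rightarrow> state" where
  "init v = (\<lambda>_. N 0)(0 := v)"

inductive exec :: "com \<Rightarrow> state \<Rightarrow> event list \<Rightarrow> state \<Rightarrow> bool" where
  Skip: "exec Skip s [Tick] s"
| Assign: "exec (Assign x e) s [Tick] (s(x := eval e s))"
| Seq: "exec c s tr s' \<Longrightarrow> exec d s' tr' s'' \<Longrightarrow> exec (Seq c d) s (tr @ tr') s''"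
| IfTrue: "eval e s \<noteq> N 0 \<Longrightarrow> exec c s tr s' \<Longrightarrow> exec (If e c d) s (Tick # tr) s'"
| IfFalse: "eval e s = N 0 \<Longrightarrow> exec d s tr s' \<Longrightarrow> exec (If e c d) s (Tick # tr) s'"
| WhileFalse: "eval e s = N 0 \<Longrightarrow> exec (While e c) s [Tick] s"
| WhileTrue: "eval e s \<noteq> N 0 \<Longrightarrow> exec c s tr s' \<Longrightarrow> exec (While e c) s' tr' s'' \<Longrightarrow>
    exec (While e c) s (Tick # tr @ tr') s''"
| Output: "exec (Output e) s (replicate (vsize (eval e s)) Tick @ [Out (eval e s)]) s"
| Call: "exec c (init (eval e s)) tr s' \<Longrightarrow> exec (Call x c e) s (Tick # tr) (s(x := s' 0))"

text \<open>On input \<open>v\<close>, the program \<open>c\<close> halts with trace \<open>tr\<close> (which is unique).\<close>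

definition runs :: "com \<Rightarrow> val \<Rightarrow> event list \<Rightarrow> bool" where
  "runs c v tr \<longleftrightarrow> (\<exists>s. exec c (init v) tr s)"

inductive_cases exec_elims:
  "exec Skip s tr s'"
  "exec (Assign x e) s tr s'"
  "exec (Seq c d) s tr s'"
  "exec (If e c d) s tr s'"
  "exec (While e c) s tr s'"
  "exec (Output e) s tr s'"
  "exec (Call x c e) s tr s'"

lemma exec_deterministic: "exec c s tr s' \<Longrightarrow> exec c s tr' s'' \<Longrightarrow> tr' = tr \<and> s'' = s'"
proof (induction arbitrary: tr' s'' rule: exec.induct)
  case (Skip s)
  then show ?case by (elim exec_elims) simp
next
  case (Assign x e s)
  then show ?case by (elim exec_elims) simp
next
  case (Seq c s tr s' d tr2 s2)
  from Seq.prems show ?case by (elim exec_elims) (metis Seq.IH)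
next
  case (IfTrue e s c tr s' d)
  from IfTrue.prems show ?case by (elim exec_elims) (metis IfTrue.hyps(1) IfTrue.IH)+
next
  case (IfFalse e s d tr s' c)
  from IfFalse.prems show ?case by (elim exec_elims) (metis IfFalse.hyps(1) IfFalse.IH)+
next
  case (WhileFalse e s c)
  from WhileFalse.prems show ?case by (rule exec_elims(5)) (metis WhileFalse.hyps)+
next
  case (WhileTrue e s c tr s' tr2 s2)
  from WhileTrue.prems show ?case
    by (rule exec_elims(5)) (metis WhileTrue.hyps(1) WhileTrue.IH)+
next
  case (Output e s)
  then show ?case by (elim exec_elims) simp
next
  case (Call c e s tr s' x)
  from Call.prems show ?case by (elim exec_elims) (metis Call.IH)
qed

fun outputs :: "event list \<Rightarrow> val list" where
  "outputs [] = []"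
| "outputs (Tick # tr) = outputs tr"
| "outputs (Out v # tr) = v # outputs tr"

definition total_time_le :: "nat \<Rightarrow> event list \<Rightarrow> bool" where
  "total_time_le d tr \<longleftrightarrow> length tr \<le> d"

text \<open>Every output-free stretch is bounded, including those before the first and after the last
  output.\<close>

definition delay_le :: "nat \<Rightarrow> event list \<Rightarrow> bool" where
  "delay_le d tr \<longleftrightarrow> (\<forall>us m ws. tr = us @ replicate m Tick @ ws \<longrightarrow> m \<le> d)"

definition computable_nat_fun :: "(nat \<Rightarrow> nat) \<Rightarrow> bool" where
  "computable_nat_fun f \<longleftrightarrow> (\<exists>c. \<forall>n. \<exists>tr. runs c (N n) tr \<and> outputs tr = [N (f n)])"


section \<open>Parameterized enumeration problems and enumeration kernels\<close>

record ('i, 's) enum_problem =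
  instances :: "'i set"
  solutions :: "'i \<Rightarrow> 's set"
  param :: "'i \<Rightarrow> nat"
  enc_inst :: "'i \<Rightarrow> val"
  enc_sol :: "'s \<Rightarrow> val"

definition inst_size :: "('i, 's) enum_problem \<Rightarrow> 'i \<Rightarrow> nat" where
  "inst_size Q x = vsize (enc_inst Q x)"

text \<open>\<open>K\<close> is the function on instances computed by the kernelization program \<open>A\<close>. The program \<open>A'\<close>
  lists \<open>S x s\<close> when given \<open>x\<close>, \<open>K x\<close> and a solution \<open>s\<close> of \<open>K x\<close>. The parameter \<open>time_le\<close> says how the
  running time of \<open>A'\<close> is bounded.\<close>

definition enum_kernel ::
  "(nat \<Rightarrow> event list \<Rightarrow> bool) \<Rightarrow> ('i, 's) enum_problem \<Rightarrow> ('i \<Rightarrow> 'i) \<Rightarrow> com \<Rightarrow> com \<Rightarrow> bool" where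
  "enum_kernel time_le Q K A A' \<longleftrightarrow>
     (\<exists>p :: nat poly. \<forall>x \<in> instances Q. K x \<in> instances Q \<and>
        (\<exists>tr. runs A (enc_inst Q x) tr \<and> outputs tr = [enc_inst Q (K x)] \<and>
              total_time_le (poly p (inst_size Q x + param Q x)) tr)) \<and>
     (\<exists>f. computable_nat_fun f \<and>
        (\<forall>x \<in> instances Q. inst_size Q (K x) + param Q (K x) \<le> f (param Q x))) \<and>
     (\<exists>(q :: nat poly) S. \<forall>x \<in> instances Q.
        (\<forall>s \<in> solutions Q (K x). \<exists>tr.
           runs A' (P (enc_inst Q x) (P (enc_inst Q (K x)) (enc_sol Q s))) tr \<and>
           distinct (outputs tr) \<and> set (outputs tr) = enc_sol Q ` S x s \<and>
           time_le (poly q (inst_size Q x + inst_size Q (K x) + param Q x + param Q (K x))) tr) \<and>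
        inj_on (S x) (solutions Q (K x)) \<and>
        partition_on (solutions Q x) (S x ` solutions Q (K x)))"

definition fully_polynomial_enum_kernel ::
  "('i, 's) enum_problem \<Rightarrow> ('i \<Rightarrow> 'i) \<Rightarrow> com \<Rightarrow> com \<Rightarrow> bool" where
  "fully_polynomial_enum_kernel = enum_kernel total_time_le"

definition polynomial_delay_enum_kernel ::
  "('i, 's) enum_problem \<Rightarrow> ('i \<Rightarrow> 'i) \<Rightarrow> com \<Rightarrow> com \<Rightarrow> bool" where
  "polynomial_delay_enum_kernel = enum_kernel delay_le"


section \<open>Enumeration of matching cuts parameterized by the vertex cover number\<close>

text \<open>An instance \<open>(n, E, k)\<close> consists of a graph with vertex set \<open>{..<n}\<close> and edge set \<open>E\<close>, together
  with its vertex cover number \<open>k\<close>. Fixing the vertex names makes the size of an instance bounded in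
  terms of \<open>n\<close>. Edge sets are encoded canonically, by the lexicographically sorted list of their
  edges, so every edge set has exactly one code.\<close>

type_synonym vc_graph = "nat \<times> nat set set \<times> nat"

abbreviation num_vertices :: "vc_graph \<Rightarrow> nat" where
  "num_vertices x \<equiv> fst x"

definition enc_edges :: "nat set set \<Rightarrow> val" where
  "enc_edges M = enc_list (map (\<lambda>(u, v). P (N u) (N v))
     (sorted_list_of_set {(u, v). u < v \<and> {u, v} \<in> M}))"

definition cut_enum_problem ::
  "(nat set \<Rightarrow> nat set set \<Rightarrow> nat set set \<Rightarrow> bool) \<Rightarrow> (vc_graph, nat set set) enum_problem" where
  "cut_enum_problem is_sol =
     \<lparr> instances = {(n, E, k). simple_graph {..<n} E \<and> k = vertex_cover_number {..<n} E},
       solutions = (\<lambda>(n, E, k). {M. is_sol {..<n} E M}),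
       param = (\<lambda>(n, E, k). k),
       enc_inst = (\<lambda>(n, E, k). P (N n) (P (enc_edges E) (N k))),
       enc_sol = enc_edges \<rparr>"

definition enum_MC :: "(vc_graph, nat set set) enum_problem" where
  "enum_MC = cut_enum_problem matching_cut"

definition enum_minimal_MC :: "(vc_graph, nat set set) enum_problem" where
  "enum_minimal_MC = cut_enum_problem minimal_matching_cut"

definition enum_maximal_MC :: "(vc_graph, nat set set) enum_problem" where
  "enum_maximal_MC = cut_enum_problem maximal_matching_cut"

definition quadratic_vertices ::
  "(vc_graph, nat set set) enum_problem \<Rightarrow> (vc_graph \<Rightarrow> vc_graph) \<Rightarrow> bool" where
  "quadratic_vertices Q K \<longleftrightarrow>
     (\<exists>g :: nat \<Rightarrow> real. g \<in> O(\<lambda>k. real k ^ 2) \<and>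
        (\<forall>x \<in> instances Q. real (num_vertices (K x)) \<le> g (param Q x)))"

end

theory Submission
  imports Defs
begin

text \<open>Call a vertex high if its degree exceeds \<open>k = \<tau>(G)\<close>. High vertices lie in every vertex cover of
  size \<open>k\<close>, so there are at most \<open>k\<close> of them, and all but \<open>O(k\<^sup>2)\<close> vertices are low: not high, with
  only high neighbours. For a low vertex of degree at least two whose neighbours pairwise have three
  common neighbours, the whole neighbourhood lies on the vertex's side of every matching cut, so its
  edges never occur in one; low vertices of degree one matter only up to exchanging them at their
  common neighbour. Deleting low vertices while keeping, in vertex order, three common neighbours per
  pair of high vertices, two members of each twin class of low vertices of degree at most one, and
  \<open>k + 1\<close> neighbours per high vertex leaves \<open>O(k\<^sup>2)\<close> vertices and does not change the vertex cover number.

  The matching cuts of \<open>G\<close> are then exactly the transversals of the matching cuts of the kernel along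
  the map \<open>\<rho>\<close> sending each edge that may occur to its representative. Hence the same correspondence
  works for minimal and maximal matching cuts, and the cuts over a kernel cut form a product of lists
  of edges, which an odometer enumerates with polynomial delay. A minimal kernel cut with more than
  one preimage is a single pendant edge, so in that case the total time is polynomial as well.\<close>

section \<open>Polynomial-time functions on values\<close>

text \<open>Cuts are handled through two-colourings of the vertices, so cuts of the graph and of the
  kernel are compared by transporting colourings. Only for the empty cut does the nonemptiness of
  both sides need an argument of its own; it comes from the two isolated vertices that are kept
  whenever an isolated vertex is removed. The parameter is part of an instance and has to be the
  vertex cover number itself, so the kernel must preserve this number exactly and not merely bound
  it. Comparing plain matching cuts suffices for the minimal and maximal ones, because inclusions
  between kernel cuts lift to inclusions between cuts. On the program side the obstacle is that
  unit-cost assignments can build exponentially large shared trees, so size bounds have to travel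
  with time bounds. Apart from a few combinators no program is verified by hand: everything the
  kernel needs is phrased with bounded quantifiers, counting, maps and filters, for which polynomial
  time follows from closure rules.\<close>

lemma poly_nat_mono: "a \<le> b \<Longrightarrow> poly p a \<le> poly p b" for p :: "nat poly"
  by (induction p) (auto intro: add_mono mult_mono)

text \<open>An output-free run has a trace determined by its length, so running times simply add up
  under sequencing.\<close>

definition steps :: "com \<Rightarrow> state \<Rightarrow> nat \<Rightarrow> state \<Rightarrow> bool" where
  "steps c s t s' \<longleftrightarrow> exec c s (replicate t Tick) s'"

lemma steps_Assign: "steps (Assign x e) s 1 (s(x := eval e s))"
  unfolding steps_def using exec.Assign by simp

lemma steps_Seq: "steps c s t s' \<Longrightarrow> steps d s' t' s'' \<Longrightarrow> steps (Seq c d) s (t + t') s''"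
  unfolding steps_def replicate_add by (rule exec.Seq)

lemma steps_IfTrue: "eval e s \<noteq> N 0 \<Longrightarrow> steps c s t s' \<Longrightarrow> steps (If e c d) s (Suc t) s'"
  unfolding steps_def replicate_Suc by (rule exec.IfTrue)

lemma steps_IfFalse: "eval e s = N 0 \<Longrightarrow> steps d s t s' \<Longrightarrow> steps (If e c d) s (Suc t) s'"
  unfolding steps_def replicate_Suc by (rule exec.IfFalse)

lemma steps_WhileFalse: "eval e s = N 0 \<Longrightarrow> steps (While e c) s 1 s"
  unfolding steps_def by (simp add: exec.WhileFalse)

lemma steps_WhileTrue:
  "eval e s \<noteq> N 0 \<Longrightarrow> steps c s t s' \<Longrightarrow> steps (While e c) s' t' s'' \<Longrightarrow>
    steps (While e c) s (Suc (t + t')) s''"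
  unfolding steps_def replicate_Suc replicate_add by (rule exec.WhileTrue)

lemma steps_Call: "steps c (init (eval e s)) t s' \<Longrightarrow> steps (Call x c e) s (Suc t) (s(x := s' 0))"
  unfolding steps_def replicate_Suc by (rule exec.Call)

text \<open>A time bound alone would not compose: repeating
  \<open>Assign 0 (Pair (Var 0) (Var 0))\<close> doubles a tree at unit cost. The polynomial
  therefore bounds the time together with the size of the result.\<close>

definition computes :: "com \<Rightarrow> (val \<Rightarrow> val) \<Rightarrow> nat poly \<Rightarrow> bool" where
  "computes c f p \<longleftrightarrow>
     (\<forall>v. \<exists>t s. steps c (init v) t s \<and> s 0 = f v \<and> t + vsize (f v) \<le> poly p (vsize v))"

definition ptime :: "(val \<Rightarrow> val) \<Rightarrow> bool" where
  "ptime f \<longleftrightarrow> (\<exists>c p. computes c f p)"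

lemma computes_Call:
  assumes "computes c f p"
  obtains t where "steps (Call x c e) s t (s(x := f (eval e s)))"
    "t \<le> Suc (poly p (vsize (eval e s)))"
proof -
  obtain t s' where "steps c (init (eval e s)) t s'" "s' 0 = f (eval e s)"
    "t + vsize (f (eval e s)) \<le> poly p (vsize (eval e s))"
    using assms unfolding computes_def by blast
  then show thesis using steps_Call[of c e s t s' x] that[of "Suc t"] by auto
qed

lemma computes_size: "computes c f p \<Longrightarrow> vsize (f v) \<le> poly p (vsize v)"
  unfolding computes_def by (meson add_leD2)

lemma ptime_size: "ptime f \<Longrightarrow> \<exists>p. \<forall>v. vsize (f v) \<le> poly p (vsize v)"
  unfolding ptime_def using computes_size by blast

lemma ptimeI:
  assumes "\<And>v. \<exists>t s. steps c (init v) t s \<and> s 0 = f v \<and> t + vsize (f v) \<le> poly p (vsize v)"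
  shows "ptime f"
  using assms unfolding ptime_def computes_def by blast

lemma steps_witness:
  "steps c s t s' \<Longrightarrow> s' 0 = w \<Longrightarrow> t + z \<le> b \<Longrightarrow> \<exists>t s'. steps c s t s' \<and> s' 0 = w \<and> t + z \<le> b"
  by blast

lemma ptime_expr:
  assumes "\<And>v. eval e (init v) = f v" "\<And>v. vsize (f v) \<le> vsize v + k"
  shows "ptime f"
proof (rule ptimeI[where c = "Assign 0 e" and p = "[:Suc k, 1:]"])
  fix v show "\<exists>t s. steps (Assign 0 e) (init v) t s \<and> s 0 = f v \<and>
      t + vsize (f v) \<le> poly [:Suc k, 1:] (vsize v)"
    by (rule steps_witness[OF steps_Assign]) (use assms(1) assms(2)[of v] in auto)
qed

definition vfst :: "val \<Rightarrow> val" where "vfst v = (case v of P a b \<Rightarrow> a | N n \<Rightarrow> N 0)"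
definition vsnd :: "val \<Rightarrow> val" where "vsnd v = (case v of P a b \<Rightarrow> b | N n \<Rightarrow> N 0)"
definition vsuc :: "val \<Rightarrow> val" where "vsuc v = (case v of P a b \<Rightarrow> N 0 | N n \<Rightarrow> N (Suc n))"
definition vnat :: "val \<Rightarrow> nat" where "vnat v = (case v of P a b \<Rightarrow> 0 | N n \<Rightarrow> n)"

lemma val_sel_simps [simp]:
  "vfst (P a b) = a" "vsnd (P a b) = b" "vsuc (N n) = N (Suc n)" "vnat (N n) = n"
  by (simp_all add: vfst_def vsnd_def vsuc_def vnat_def)

lemma ptime_id: "ptime (\<lambda>v. v)"
  by (rule ptime_expr[where e = "Var 0" and k = 0]) (auto simp: init_def)

lemma ptime_const: "ptime (\<lambda>v. N n)"
  by (rule ptime_expr[where e = "Num n" and k = "Suc n"]) auto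

lemma ptime_compose:
  assumes "ptime f" "ptime g"
  shows "ptime (\<lambda>v. f (g v))"
proof -
  obtain c p where c: "computes c f p" using assms(1) unfolding ptime_def by blast
  obtain d q where d: "computes d g q" using assms(2) unfolding ptime_def by blast
  show ?thesis
  \<comment> \<open>The constant pays for the two calls; one copy of
    \<open>p \<circ>\<^sub>p q\<close> pays for the time of \<open>c\<close> on the intermediate
    value, the other for the size of the result.\<close>
  proof (rule ptimeI[where c = "Seq (Call 0 d (Var 0)) (Call 0 c (Var 0))"
        and p = "[:2:] + q + p \<circ>\<^sub>p q + p \<circ>\<^sub>p q"])
    fix v
    let ?s = "(init v)(0 := g v)"
    obtain t where t: "steps (Call 0 d (Var 0)) (init v) t ?s" "t \<le> Suc (poly q (vsize v))"
      using computes_Call[OF d, of 0 "Var 0" "init v"] by (auto simp: init_def)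
    obtain t' where t': "steps (Call 0 c (Var 0)) ?s t' (?s(0 := f (g v)))"
      "t' \<le> Suc (poly p (vsize (g v)))"
      using computes_Call[OF c, of 0 "Var 0" ?s] by auto
    have "poly p (vsize (g v)) \<le> poly p (poly q (vsize v))"
      by (rule poly_nat_mono) (rule computes_size[OF d])
    then show "\<exists>t s. steps (Seq (Call 0 d (Var 0)) (Call 0 c (Var 0))) (init v) t s \<and>
        s 0 = f (g v) \<and>
        t + vsize (f (g v)) \<le> poly ([:2:] + q + p \<circ>\<^sub>p q + p \<circ>\<^sub>p q) (vsize v)"
      using t(2) t'(2) computes_size[OF c, of "g v"]
      by (intro steps_witness[OF steps_Seq[OF t(1) t'(1)]]) (auto simp: poly_pcompose)
  qed
qed

lemma ptime_Pair:
  assumes "ptime f" "ptime g"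
  shows "ptime (\<lambda>v. P (f v) (g v))"
proof -
  obtain c p where c: "computes c f p" using assms(1) unfolding ptime_def by blast
  obtain d q where d: "computes d g q" using assms(2) unfolding ptime_def by blast
  let ?c = "Seq (Call 1 c (Var 0)) (Seq (Call 2 d (Var 0)) (Assign 0 (Pair (Var 1) (Var 2))))"
  show ?thesis
  proof (rule ptimeI[where c = ?c and p = "[:4:] + p + p + q + q"])
    fix v
    let ?s = "(init v)(1 := f v)" let ?s' = "?s(2 := g v)"
    obtain t where t: "steps (Call 1 c (Var 0)) (init v) t ?s" "t \<le> Suc (poly p (vsize v))"
      using computes_Call[OF c, of 1 "Var 0" "init v"] by (auto simp: init_def)
    obtain t' where t': "steps (Call 2 d (Var 0)) ?s t' ?s'" "t' \<le> Suc (poly q (vsize v))"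
      using computes_Call[OF d, of 2 "Var 0" ?s] by (auto simp: init_def)
    show "\<exists>t s. steps ?c (init v) t s \<and> s 0 = P (f v) (g v) \<and>
        t + vsize (P (f v) (g v)) \<le> poly ([:4:] + p + p + q + q) (vsize v)"
      using t(2) t'(2) computes_size[OF c, of v] computes_size[OF d, of v]
      by (intro steps_witness[OF steps_Seq[OF t(1) steps_Seq[OF t'(1) steps_Assign]]]) auto
  qed
qed

lemma ptime_If:
  assumes "ptime b" "ptime f" "ptime g"
  shows "ptime (\<lambda>v. if b v = N 0 then g v else f v)"
proof -
  obtain e r where e: "computes e b r" using assms(1) unfolding ptime_def by blast
  obtain c p where c: "computes c f p" using assms(2) unfolding ptime_def by blast
  obtain d q where d: "computes d g q" using assms(3) unfolding ptime_def by blast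
  let ?c = "Seq (Call 1 e (Var 0)) (If (Var 1) (Call 0 c (Var 0)) (Call 0 d (Var 0)))"
  show ?thesis
  proof (rule ptimeI[where c = ?c and p = "[:3:] + r + p + p + q + q"])
    fix v
    let ?s = "(init v)(1 := b v)" let ?s' = "?s(0 := if b v = N 0 then g v else f v)"
    obtain t where t: "steps (Call 1 e (Var 0)) (init v) t ?s" "t \<le> Suc (poly r (vsize v))"
      using computes_Call[OF e, of 1 "Var 0" "init v"] by (auto simp: init_def)
    obtain t1 where t1: "steps (Call 0 c (Var 0)) ?s t1 (?s(0 := f v))"
      "t1 \<le> Suc (poly p (vsize v))"
      using computes_Call[OF c, of 0 "Var 0" ?s] by (auto simp: init_def)
    obtain t2 where t2: "steps (Call 0 d (Var 0)) ?s t2 (?s(0 := g v))"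
      "t2 \<le> Suc (poly q (vsize v))"
      using computes_Call[OF d, of 0 "Var 0" ?s] by (auto simp: init_def)
    obtain t' where t': "steps (If (Var 1) (Call 0 c (Var 0)) (Call 0 d (Var 0))) ?s t' ?s'"
      "t' \<le> Suc (Suc (poly p (vsize v) + poly q (vsize v)))"
    proof (cases "b v = N 0")
      case True
      then show thesis using steps_IfFalse[OF _ t2(1)] t2(2) that[of "Suc t2"] by auto
    next
      case False
      then show thesis using steps_IfTrue[OF _ t1(1)] t1(2) that[of "Suc t1"] by auto
    qed
    have "vsize (if b v = N 0 then g v else f v) \<le> poly p (vsize v) + poly q (vsize v)"
      using computes_size[OF c, of v] computes_size[OF d, of v] by auto
    then show "\<exists>t s. steps ?c (init v) t s \<and> s 0 = (if b v = N 0 then g v else f v) \<and>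
        t + vsize (if b v = N 0 then g v else f v) \<le> poly ([:3:] + r + p + p + q + q) (vsize v)"
      using t(2) t'(2) by (intro steps_witness[OF steps_Seq[OF t(1) t'(1)]]) auto
  qed
qed

text \<open>Reading a number as the list of all smaller numbers lets one fold serve both for lists
  and for loops over \<open>{..<n}\<close>. The value \<open>N 0\<close> is the empty list in either
  reading.\<close>

function vlist :: "val \<Rightarrow> val list" where
  "vlist (N 0) = []"
| "vlist (N (Suc n)) = N n # vlist (N n)"
| "vlist (P a b) = a # vlist b"
  by pat_completeness auto
termination by (relation "measure vsize") auto

lemma vlist_enc_list [simp]: "vlist (enc_list vs) = vs"
  by (induction vs) (auto simp: enc_list_def)

lemma length_vlist: "length (vlist l) \<le> vsize l"
  by (induction l rule: vlist.induct) auto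

lemma vsize_vlist: "a \<in> set (vlist l) \<Longrightarrow> vsize a \<le> vsize l"
  by (induction l rule: vlist.induct) auto

lemma set_vlist_N: "set (vlist (N n)) = N ` {..<n}"
  by (induction n) (auto simp: lessThan_Suc)

lemma distinct_vlist_N: "distinct (vlist (N n))"
  by (induction n) (auto simp: set_vlist_N)

text \<open>Variable 0 holds a parameter that stays fixed, 1 the remaining list, 2 the accumulator
  and 3 the current element. For a number, the predecessor is both the element and the remaining
  list.\<close>

definition fold_body :: "com \<Rightarrow> com" where
  "fold_body c = Seq (If (IsPair (Var 1)) (Seq (Assign 3 (Fst (Var 1))) (Assign 1 (Snd (Var 1))))
      (Seq (Assign 1 (Pred (Var 1))) (Assign 3 (Var 1))))
    (Call 2 c (Pair (Var 0) (Pair (Var 3) (Var 2))))"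

lemma fold_body_steps:
  assumes c: "computes c g p" and s: "s 0 = e" "s 1 = l" "s 2 = acc" and l: "vlist l = a # as"
  obtains t s' where "steps (fold_body c) s t s'" "s' 0 = e" "vlist (s' 1) = as"
    "s' 2 = g (P e (P a acc))" "t \<le> 4 + poly p (vsize e + vsize a + vsize acc + 2)"
proof -
  let ?i = "If (IsPair (Var 1)) (Seq (Assign 3 (Fst (Var 1))) (Assign 1 (Snd (Var 1))))
      (Seq (Assign 1 (Pred (Var 1))) (Assign 3 (Var 1)))"
  obtain s1 where s1: "steps ?i s 3 s1" "s1 0 = e" "vlist (s1 1) = as" "s1 2 = acc" "s1 3 = a"
  proof (cases l rule: vlist.cases)
    case 1
    then show thesis using l by simp
  next
    case (2 n)
    have "steps ?i s (Suc (1 + 1)) (s(1 := N n, 3 := N n))"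
      using 2 s steps_Seq[OF steps_Assign[of 1 "Pred (Var 1)" s] steps_Assign[of 3 "Var 1"]]
      by (intro steps_IfFalse) auto
    then show thesis
      using 2 l s that[of "s(1 := N n, 3 := N n)"] by (auto simp: numeral_3_eq_3)
  next
    case (3 x y)
    have "steps ?i s (Suc (1 + 1)) (s(3 := x, 1 := y))"
      using 3 s steps_Seq[OF steps_Assign[of 3 "Fst (Var 1)" s] steps_Assign[of 1 "Snd (Var 1)"]]
      by (intro steps_IfTrue) auto
    then show thesis
      using 3 l s that[of "s(3 := x, 1 := y)"] by (auto simp: numeral_3_eq_3)
  qed
  let ?e = "Pair (Var 0) (Pair (Var 3) (Var 2))"
  obtain t where t: "steps (Call 2 c ?e) s1 t (s1(2 := g (P e (P a acc))))"
    "t \<le> Suc (poly p (vsize (P e (P a acc))))"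
    using computes_Call[OF c, of 2 ?e s1] s1 by auto
  have "vsize (P e (P a acc)) = vsize e + vsize a + vsize acc + 2" by simp
  with t(2) have t2: "t \<le> Suc (poly p (vsize e + vsize a + vsize acc + 2))" by metis
  show thesis
    using steps_Seq[OF s1(1) t(1)] t2 s1 that[of "3 + t" "s1(2 := g (P e (P a acc))) "]
    by (auto simp: fold_body_def)
qed

text \<open>The sum \<open>vsize (s 2) + length as * Q\<close> acts as a budget: each round consumes
  at most one \<open>Q\<close>, so \<open>S\<close> bounds the accumulator, and with it the cost of
  every call, during the whole loop.\<close>

lemma fold_loop:
  assumes c: "computes c g p"
    and bound: "\<And>a acc. vsize a \<le> M \<Longrightarrow> vsize (g (P e (P a acc))) \<le> vsize acc + Q"
  shows "vlist (s 1) = as \<Longrightarrow> \<forall>a\<in>set as. vsize a \<le> M \<Longrightarrow> s 0 = e \<Longrightarrow>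
    vsize (s 2) + length as * Q \<le> S \<Longrightarrow>
    \<exists>t s'. steps (While (Var 1) (fold_body c)) s t s' \<and>
      s' 2 = fold (\<lambda>a b. g (P e (P a b))) as (s 2) \<and> vsize (s' 2) \<le> S \<and>
      t \<le> length as * (5 + poly p (vsize e + M + S + 2)) + 1"
proof (induction as arbitrary: s)
  case Nil
  then have "s 1 = N 0" by (cases "s 1" rule: vlist.cases) auto
  then show ?case using Nil steps_WhileFalse[of "Var 1" s] by fastforce
next
  case (Cons a as)
  obtain t s' where s': "steps (fold_body c) s t s'" "s' 0 = e" "vlist (s' 1) = as"
    "s' 2 = g (P e (P a (s 2)))" and t: "t \<le> 4 + poly p (vsize e + vsize a + vsize (s 2) + 2)"
    using fold_body_steps[OF c Cons.prems(3) refl refl Cons.prems(1)] by metis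
  have "vsize (s' 2) \<le> vsize (s 2) + Q"
    using bound[of a "s 2"] Cons.prems(2) s'(4) by simp
  then have "vsize (s' 2) + length as * Q \<le> S" using Cons.prems(4) by simp
  with Cons.IH[of s', OF s'(3)] Cons.prems(2) s'(2) obtain t' s'' where s'':
    "steps (While (Var 1) (fold_body c)) s' t' s''"
    "s'' 2 = fold (\<lambda>a b. g (P e (P a b))) as (s' 2)" "vsize (s'' 2) \<le> S"
    "t' \<le> length as * (5 + poly p (vsize e + M + S + 2)) + 1" by auto
  have "poly p (vsize e + vsize a + vsize (s 2) + 2) \<le> poly p (vsize e + M + S + 2)"
    using Cons.prems(2,4) by (intro poly_nat_mono) auto
  moreover have "s 1 \<noteq> N 0" using Cons.prems(1) by auto
  ultimately show ?case
    using steps_WhileTrue[of "Var 1" s, OF _ s'(1) s''(1)] s'' s'(4) t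
    by (intro exI[of _ "Suc (t + t')"] exI[of _ s'']) auto
qed

text \<open>The accumulator may grow only additively, by an amount depending on the parameter and
  the element; a constant factor per round would compound to exponential size.\<close>

lemma ptime_fold_canonical:
  assumes "ptime g"
    and bound: "\<And>e a acc. vsize (g (P e (P a acc))) \<le> vsize acc + poly q (vsize e + vsize a)"
  shows "ptime (\<lambda>v. fold (\<lambda>a b. g (P (vfst v) (P a b))) (vlist (vfst (vsnd v))) (vsnd (vsnd v)))"
    (is "ptime ?f")
proof -
  obtain c p where c: "computes c g p" using assms(1) unfolding ptime_def by blast
  let ?w = "While (Var 1) (fold_body c)"
  let ?c = "Seq (Assign 1 (Fst (Snd (Var 0)))) (Seq (Assign 2 (Snd (Snd (Var 0))))
      (Seq (Assign 0 (Fst (Var 0))) (Seq ?w (Assign 0 (Var 2)))))"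
  define X :: "nat poly" where "X = [:0, 1:]"
  define S where "S = X + X * (q \<circ>\<^sub>p (X + X)) + 1"
  have X: "poly X n = n" for n by (simp add: X_def)
  show ?thesis
  proof (rule ptimeI[where c = ?c and
        p = "5 + X * (5 + p \<circ>\<^sub>p (X + X + S + 2)) + S"])
    fix v
    define e l acc where "e = vfst v" and "l = vfst (vsnd v)" and "acc = vsnd (vsnd v)"
    have le: "vsize e \<le> vsize v" "vsize l \<le> vsize v" "vsize acc \<le> Suc (vsize v)"
      unfolding e_def l_def acc_def vfst_def vsnd_def by (auto split: val.splits)
    let ?s = "(init v)(1 := l, 2 := acc, 0 := e)"
    have sel: "eval (Fst (Snd (Var 0))) (init v) = l" "eval (Snd (Snd (Var 0))) ((init v)(1 := l)) = acc"
      "eval (Fst (Var 0)) ((init v)(1 := l, 2 := acc)) = e"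
      by (auto simp: init_def e_def l_def acc_def vfst_def vsnd_def split: val.splits)
    note a1 = steps_Assign[of 1 "Fst (Snd (Var 0))" "init v", unfolded sel]
      and a2 = steps_Assign[of 2 "Snd (Snd (Var 0))" "(init v)(1 := l)", unfolded sel]
      and a3 = steps_Assign[of 0 "Fst (Var 0)" "(init v)(1 := l, 2 := acc)", unfolded sel]
    let ?Q = "poly q (vsize v + vsize v)"
    have "vsize (g (P e (P a b))) \<le> vsize b + ?Q" if "vsize a \<le> vsize v" for a b
      using bound[of e a b] poly_nat_mono[of "vsize e + vsize a" "vsize v + vsize v" q] that le
      by linarith
    moreover have "\<forall>a\<in>set (vlist l). vsize a \<le> vsize v"
      using vsize_vlist le(2) le_trans by blast
    moreover have "poly S (vsize v) = vsize v + vsize v * ?Q + 1"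
      by (simp add: S_def X poly_pcompose)
    moreover have "length (vlist l) * ?Q \<le> vsize v * ?Q"
      using length_vlist[of l] le(2) by (intro mult_right_mono) auto
    then have "vsize acc + length (vlist l) * ?Q \<le> poly S (vsize v)"
      using le \<open>poly S (vsize v) = vsize v + vsize v * ?Q + 1\<close> by linarith
    ultimately obtain t s' where s': "steps ?w ?s t s'"
      "s' 2 = fold (\<lambda>a b. g (P e (P a b))) (vlist l) acc" "vsize (s' 2) \<le> poly S (vsize v)"
      and t: "t \<le> length (vlist l) * (5 + poly p (vsize e + vsize v + poly S (vsize v) + 2)) + 1"
      using fold_loop[OF c, of "vsize v" e ?Q ?s "vlist l" "poly S (vsize v)"] by auto
    have "poly p (vsize e + vsize v + poly S (vsize v) + 2)
        \<le> poly p (vsize v + vsize v + poly S (vsize v) + 2)"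
      using le by (intro poly_nat_mono) auto
    then have "length (vlist l) * (5 + poly p (vsize e + vsize v + poly S (vsize v) + 2))
        \<le> vsize v * (5 + poly p (vsize v + vsize v + poly S (vsize v) + 2))"
      using length_vlist[of l] le(2) by (intro mult_mono) auto
    with t have t: "t \<le> vsize v * (5 + poly p (vsize v + vsize v + poly S (vsize v) + 2)) + 1"
      by linarith
    have st: "steps ?c (init v) (1 + (1 + (1 + (t + 1)))) (s'(0 := eval (Var 2) s'))"
      by (rule steps_Seq[OF a1 steps_Seq[OF a2 steps_Seq[OF a3 steps_Seq[OF s'(1) steps_Assign]]]])
    then show "\<exists>t s. steps ?c (init v) t s \<and> s 0 = ?f v \<and>
        t + vsize (?f v) \<le> poly (5 + X * (5 + p \<circ>\<^sub>p (X + X + S + 2)) + S) (vsize v)"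
      using s'(2,3) t unfolding e_def[symmetric] l_def[symmetric] acc_def[symmetric]
      by (intro steps_witness[OF st]) (auto simp: poly_pcompose X)
  qed
qed

lemma ptime_vfst: "ptime f \<Longrightarrow> ptime (\<lambda>v. vfst (f v))"
  by (rule ptime_compose[of vfst], rule ptime_expr[where e = "Fst (Var 0)" and k = 0])
    (auto simp: init_def vfst_def split: val.splits)

lemma ptime_vsnd: "ptime f \<Longrightarrow> ptime (\<lambda>v. vsnd (f v))"
  by (rule ptime_compose[of vsnd], rule ptime_expr[where e = "Snd (Var 0)" and k = 1])
    (auto simp: init_def vsnd_def split: val.splits)

lemma ptime_vsuc: "ptime f \<Longrightarrow> ptime (\<lambda>v. vsuc (f v))"
  by (rule ptime_compose[of vsuc], rule ptime_expr[where e = "Succ (Var 0)" and k = 1])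
    (auto simp: init_def vsuc_def split: val.splits)

lemma ptime_fold:
  assumes g: "ptime (\<lambda>p. g (vfst p) (vfst (vsnd p)) (vsnd (vsnd p)))"
    and q: "\<And>v a b. vsize (g v a b) \<le> vsize b + poly q (vsize v + vsize a)"
    and l: "ptime l" and a: "ptime a"
  shows "ptime (\<lambda>v. fold (g v) (vlist (l v)) (a v))"
  using ptime_compose[OF ptime_fold_canonical[OF g, of q]
      ptime_Pair[OF ptime_id ptime_Pair[OF l a]]] q by simp

section \<open>Arithmetic, truth values and bounded quantifiers\<close>

definition ptime_nat :: "(val \<Rightarrow> nat) \<Rightarrow> bool" where
  "ptime_nat f \<longleftrightarrow> ptime (\<lambda>v. N (f v))"

definition ptime_bool :: "(val \<Rightarrow> bool) \<Rightarrow> bool" where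
  "ptime_bool b \<longleftrightarrow> ptime (\<lambda>v. N (of_bool (b v)))"

definition is_P :: "val \<Rightarrow> bool" where "is_P v = (case v of P a b \<Rightarrow> True | N n \<Rightarrow> False)"

lemma is_P_simps [simp]: "is_P (P a b)" "\<not> is_P (N n)"
  by (simp_all add: is_P_def)

lemma ptime_nat_N: "ptime_nat f \<Longrightarrow> ptime (\<lambda>v. N (f v))"
  by (simp add: ptime_nat_def)

lemma ptime_nat_const: "ptime_nat (\<lambda>v. n)"
  unfolding ptime_nat_def by (rule ptime_const)

lemma ptime_nat_comp: "ptime_nat f \<Longrightarrow> ptime g \<Longrightarrow> ptime_nat (\<lambda>v. f (g v))"
  unfolding ptime_nat_def by (rule ptime_compose)

lemma ptime_bool_comp: "ptime_bool f \<Longrightarrow> ptime g \<Longrightarrow> ptime_bool (\<lambda>v. f (g v))"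
  unfolding ptime_bool_def by (rule ptime_compose[where f = "\<lambda>v. N (of_bool (f v))"])

lemma ptime_cong: "ptime f \<Longrightarrow> (\<And>v. f v = g v) \<Longrightarrow> ptime g"
  by (metis ext)

lemma ptime_if:
  assumes "ptime_bool b" "ptime f" "ptime g" shows "ptime (\<lambda>v. if b v then f v else g v)"
  using ptime_If[OF assms[unfolded ptime_bool_def]]
  by (rule ptime_cong) auto

lemma ptime_nat_if:
  assumes "ptime_bool b" "ptime_nat f" "ptime_nat g"
  shows "ptime_nat (\<lambda>v. if b v then f v else g v)"
  using ptime_if[OF assms[unfolded ptime_nat_def]] unfolding ptime_nat_def
  by (rule ptime_cong) auto

lemma ptime_bool_is_P: "ptime f \<Longrightarrow> ptime_bool (\<lambda>v. is_P (f v))"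
  unfolding ptime_bool_def
  by (rule ptime_compose[of "\<lambda>v. N (of_bool (is_P v))"],
      rule ptime_expr[where e = "IsPair (Var 0)" and k = 2])
    (auto simp: init_def is_P_def split: val.splits)

lemma ptime_nat_vnat: "ptime f \<Longrightarrow> ptime_nat (\<lambda>v. vnat (f v))"
proof -
  have "ptime (\<lambda>v. if is_P v then N 0 else v)"
    by (intro ptime_if ptime_bool_is_P ptime_id ptime_const)
  moreover have "(if is_P v then N 0 else v) = N (vnat v)" for v
    by (cases v) (auto simp: vnat_def)
  ultimately show "ptime f \<Longrightarrow> ptime_nat (\<lambda>v. vnat (f v))"
    using ptime_compose[of "\<lambda>v. N (vnat v)" f] by (simp add: ptime_nat_def)
qed

lemma ptime_bool_less:
  assumes "ptime_nat f" "ptime_nat g" shows "ptime_bool (\<lambda>v. f v < g v)"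
proof -
  let ?e = "Less (Fst (Var 0)) (Snd (Var 0))"
  have "ptime (\<lambda>v. eval ?e (init v))"
    by (rule ptime_expr[OF refl, where k = 2]) (auto split: val.splits)
  from ptime_compose[OF this ptime_Pair[OF assms[unfolded ptime_nat_def]]]
  show ?thesis unfolding ptime_bool_def
    by (rule ptime_cong) (auto simp: init_def)
qed

lemma ptime_bool_not: "ptime_bool b \<Longrightarrow> ptime_bool (\<lambda>v. \<not> b v)"
  using ptime_bool_less[of "\<lambda>v. of_bool (b v)" "\<lambda>v. 1"] ptime_const[of 1]
  by (simp add: ptime_bool_def ptime_nat_def)

lemma ptime_bool_const: "ptime_bool (\<lambda>v. c)"
  unfolding ptime_bool_def by (rule ptime_const)

lemma ptime_bool_conj:
  assumes "ptime_bool b" "ptime_bool c" shows "ptime_bool (\<lambda>v. b v \<and> c v)"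
  using ptime_if[OF assms(1) assms(2)[unfolded ptime_bool_def] ptime_const[of 0]]
  unfolding ptime_bool_def by (rule ptime_cong) auto

lemma ptime_bool_disj:
  assumes "ptime_bool b" "ptime_bool c" shows "ptime_bool (\<lambda>v. b v \<or> c v)"
  using ptime_bool_not[OF ptime_bool_conj[OF assms[THEN ptime_bool_not]]] by simp

lemma ptime_bool_imp:
  assumes "ptime_bool b" "ptime_bool c" shows "ptime_bool (\<lambda>v. b v \<longrightarrow> c v)"
  using ptime_bool_disj[OF assms(1)[THEN ptime_bool_not] assms(2)] by simp

lemma ptime_bool_iff:
  assumes "ptime_bool b" "ptime_bool c" shows "ptime_bool (\<lambda>v. b v \<longleftrightarrow> c v)"
  proof -
  have "ptime_bool (\<lambda>v. (b v \<longrightarrow> c v) \<and> (c v \<longrightarrow> b v))"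
    by (intro ptime_bool_conj ptime_bool_imp assms)
  then show ?thesis unfolding iff_conv_conj_imp .
qed

lemma ptime_bool_le:
  assumes "ptime_nat f" "ptime_nat g" shows "ptime_bool (\<lambda>v. f v \<le> g v)"
  using ptime_bool_not[OF ptime_bool_less[OF assms(2,1)]] by (simp add: not_less)

lemma ptime_bool_eq:
  assumes "ptime_nat f" "ptime_nat g" shows "ptime_bool (\<lambda>v. f v = g v)"
  using ptime_bool_conj[OF ptime_bool_le[OF assms] ptime_bool_le[OF assms(2,1)]]
  by (simp add: order.eq_iff)

lemma vsize_sel: "vsize (vfst v) \<le> vsize v" "vsize (vsnd v) \<le> vsize v" "vsize (vsuc v) \<le> Suc (vsize v)"
  by (auto simp: vfst_def vsnd_def vsuc_def split: val.splits)

text \<open>Counting is the basic loop: cardinalities and bounded quantifiers are obtained from it,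
  the latter by comparing a count with 0.\<close>

lemma ptime_nat_length_filter:
  assumes b: "ptime_bool (\<lambda>p. b (vfst p) (vsnd p))" and l: "ptime l"
  shows "ptime_nat (\<lambda>v. length (filter (b v) (vlist (l v))))"
proof -
  have "ptime_bool (\<lambda>p. b (vfst p) (vfst (vsnd p)))"
    using ptime_bool_comp[OF b, of "\<lambda>p. P (vfst p) (vfst (vsnd p))"]
    by (simp add: ptime_Pair ptime_vfst ptime_vsnd ptime_id)
  then have "ptime (\<lambda>v. fold (\<lambda>a r. if b v a then vsuc r else r) (vlist (l v)) (N 0))"
    by (intro ptime_fold[where q = 1] ptime_if ptime_vsuc ptime_vsnd ptime_id l ptime_const)
      (auto simp: vsize_sel)
  moreover have "fold (\<lambda>a r. if c a then vsuc r else r) as (N m) = N (m + length (filter c as))"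
    for c and as :: "val list" and m by (induction as arbitrary: m) auto
  ultimately show ?thesis by (simp add: ptime_nat_def)
qed

lemma ptime_nat_card:
  assumes b: "ptime_bool (\<lambda>p. b (vfst p) (vnat (vsnd p)))" and f: "ptime_nat f"
  shows "ptime_nat (\<lambda>v. card {u. u < f v \<and> b v u})"
proof -
  have "length (filter (\<lambda>a. b v (vnat a)) (vlist (N (f v)))) = card {u. u < f v \<and> b v u}" for v
  proof -
    have "set (filter (\<lambda>a. b v (vnat a)) (vlist (N (f v)))) = N ` {u. u < f v \<and> b v u}"
      by (auto simp: set_vlist_N)
    then show ?thesis
      using distinct_card[of "filter (\<lambda>a. b v (vnat a)) (vlist (N (f v)))"] distinct_vlist_N
      by (simp add: card_image inj_on_def)
  qed
  then show ?thesis
    using ptime_nat_length_filter[OF b f[unfolded ptime_nat_def]] by simp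
qed

lemma ptime_bool_Bex:
  assumes "ptime_bool (\<lambda>p. b (vfst p) (vsnd p))" and "ptime l"
  shows "ptime_bool (\<lambda>v. \<exists>a\<in>set (vlist (l v)). b v a)"
  using ptime_bool_less[OF ptime_nat_const ptime_nat_length_filter[OF assms], of 0]
  by (simp add: filter_empty_conv)

lemma ptime_bool_ex_less:
  assumes "ptime_bool (\<lambda>p. b (vfst p) (vnat (vsnd p)))" and "ptime_nat f"
  shows "ptime_bool (\<lambda>v. \<exists>u<f v. b v u)"
  using ptime_bool_less[OF ptime_nat_const ptime_nat_card[OF assms], of 0]
  by (simp add: card_gt_0_iff)

lemma ptime_bool_all_less:
  assumes "ptime_bool (\<lambda>p. b (vfst p) (vnat (vsnd p)))" and "ptime_nat f"
  shows "ptime_bool (\<lambda>v. \<forall>u<f v. b v u)"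
  using ptime_bool_not[OF ptime_bool_ex_less[OF ptime_bool_not[OF assms(1)] assms(2)]] by simp

section \<open>Maps and filters of lists; sums and products of numbers\<close>

lemma enc_list_simps [simp]: "enc_list [] = N 0" "enc_list (a # as) = P a (enc_list as)"
  by (simp_all add: enc_list_def)

lemma fold_P: "fold P as (enc_list bs) = enc_list (rev as @ bs)"
  by (induction as arbitrary: bs) (auto simp flip: enc_list_simps(2))

lemma ptime_rev: "ptime l \<Longrightarrow> ptime (\<lambda>v. enc_list (rev (vlist (l v))))"
  using ptime_fold[where g = "\<lambda>v. P" and q = "[:1, 1:]" and l = l and a = "\<lambda>v. N 0"]
    fold_P[of _ "[]"]
  by (simp add: ptime_Pair ptime_vfst ptime_vsnd ptime_id ptime_const)

lemma ptime_map_filter: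
  assumes b: "ptime_bool (\<lambda>p. b (vfst p) (vsnd p))" and h: "ptime (\<lambda>p. h (vfst p) (vsnd p))"
    and l: "ptime l"
  shows "ptime (\<lambda>v. enc_list (map (h v) (filter (b v) (vlist (l v)))))"
proof -
  have b': "ptime_bool (\<lambda>p. b (vfst p) (vfst (vsnd p)))"
    using ptime_bool_comp[OF b, of "\<lambda>p. P (vfst p) (vfst (vsnd p))"]
    by (simp add: ptime_Pair ptime_vfst ptime_vsnd ptime_id)
  have h': "ptime (\<lambda>p. h (vfst p) (vfst (vsnd p)))"
    using ptime_compose[OF h, of "\<lambda>p. P (vfst p) (vfst (vsnd p))"]
    by (simp add: ptime_Pair ptime_vfst ptime_vsnd ptime_id)
  obtain q where q: "\<And>v. vsize (h (vfst v) (vsnd v)) \<le> poly q (vsize v)"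
    using ptime_size[OF h] by blast
  have "vsize (h v a) \<le> poly (q \<circ>\<^sub>p [:1, 1:]) (vsize v + vsize a)" for v a
    using q[of "P v a"] by (simp add: poly_pcompose)
  then have "ptime (\<lambda>v. fold (\<lambda>a r. if b v a then P (h v a) r else r) (vlist (l v)) (N 0))"
    by (intro ptime_fold[where q = "q \<circ>\<^sub>p [:1, 1:] + 1"] ptime_if ptime_Pair b' h' ptime_vsnd
        ptime_id l ptime_const) auto
  \<comment> \<open>The fold conses its results and so reverses them. The order has to be restored,
    since codes of edge sets are sorted lists.\<close>
  then have "ptime (\<lambda>v. enc_list (rev (vlist
      (fold (\<lambda>a r. if b v a then P (h v a) r else r) (vlist (l v)) (N 0)))))"
    by (rule ptime_rev)
  moreover have "fold (\<lambda>a r. if c a then P (g a) r else r) as (enc_list bs)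
      = enc_list (rev (map g (filter c as)) @ bs)" for c g as bs
    by (induction as arbitrary: bs) (auto simp flip: enc_list_simps(2))
  note this[of "b v" "h v" "vlist (l v)" "[]" for v]
  ultimately show ?thesis by simp
qed

lemma ptime_filter:
  assumes "ptime_bool (\<lambda>p. b (vfst p) (vsnd p))" "ptime l"
  shows "ptime (\<lambda>v. enc_list (filter (b v) (vlist (l v))))"
  using ptime_map_filter[OF assms(1) ptime_vsnd[OF ptime_id] assms(2)] by simp

lemma ptime_map:
  assumes "ptime (\<lambda>p. h (vfst p) (vsnd p))" "ptime l"
  shows "ptime (\<lambda>v. enc_list (map (h v) (vlist (l v))))"
  using ptime_map_filter[OF ptime_bool_const[of True] assms] by simp

lemma length_vlist_N [simp]: "length (vlist (N n)) = n"
  by (induction n) auto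

lemma ptime_nat_add:
  assumes "ptime_nat f" "ptime_nat g" shows "ptime_nat (\<lambda>v. f v + g v)"
proof -
  have "ptime (\<lambda>v. fold (\<lambda>a. vsuc) (vlist (N (g v))) (N (f v)))"
    using assms
    by (intro ptime_fold[where q = 1] ptime_vsuc ptime_vsnd ptime_id) (auto simp: vsize_sel ptime_nat_def)
  moreover have "fold (\<lambda>a. vsuc) as (N m) = N (m + length as)" for as :: "val list" and m
    by (induction as arbitrary: m) auto
  ultimately show ?thesis by (simp add: ptime_nat_def)
qed

text \<open>Repeated addition of the fixed amount \<open>f v\<close>, whose unary size is
  polynomial, is a fold with additive growth.\<close>

lemma ptime_nat_mult:
  assumes f: "ptime_nat f" and g: "ptime_nat g" shows "ptime_nat (\<lambda>v. f v * g v)"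
proof -
  obtain q where "\<And>v. vsize (N (f v)) \<le> poly q (vsize v)"
    using ptime_size f unfolding ptime_nat_def by blast
  then have q: "Suc (f v) \<le> poly q (vsize v + vsize a)" for v a
    using poly_nat_mono[of "vsize v" "vsize v + vsize a" q] by (fastforce intro: le_trans)
  have "vsize (N (vnat r + f v)) \<le> vsize r + poly q (vsize v + vsize a)" for v a r
    using q[of v a] by (cases r) (auto simp: vnat_def)
  then have "ptime (\<lambda>v. fold (\<lambda>a r. N (vnat r + f v)) (vlist (N (g v))) (N 0))"
    by (intro ptime_fold[where q = q] ptime_nat_N ptime_nat_add ptime_nat_vnat ptime_vsnd ptime_id
        ptime_nat_comp[OF f] g ptime_vfst ptime_nat_const)
  moreover have "fold (\<lambda>a r. N (vnat r + k)) as (N m) = N (m + k * length as)"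
    for as :: "val list" and m k
    by (induction as arbitrary: m) (auto simp: algebra_simps)
  ultimately show ?thesis by (simp add: ptime_nat_def)
qed

lemma ptime_nat_poly: "ptime_nat f \<Longrightarrow> ptime_nat (\<lambda>v. poly p (f v))"
  by (induction p) (auto intro: ptime_nat_const ptime_nat_add ptime_nat_mult)

text \<open>With these rules polynomial time is read off from the shape of a definition, as long as
  it quantifies and counts over bounded ranges and treats lists by maps and filters.\<close>

lemmas ptime_intros = ptime_Pair ptime_vfst ptime_vsnd ptime_nat_N ptime_if ptime_nat_if
  ptime_bool_is_P ptime_nat_vnat ptime_bool_less ptime_bool_le ptime_bool_eq ptime_bool_not
  ptime_bool_conj ptime_bool_disj ptime_bool_imp ptime_bool_iff ptime_nat_add
  ptime_nat_card ptime_bool_Bex ptime_bool_ex_less ptime_bool_all_less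
  ptime_map_filter ptime_filter ptime_map ptime_rev ptime_nat_const ptime_bool_const ptime_const
  ptime_id

section \<open>Enumeration programs\<close>

text \<open>\<open>F\<close> bounds the ticks of the first output-free stretch, \<open>D\<close>
  those of all later ones. With a separate first bound, further ticks can be prepended while the
  later stretches stay untouched.\<close>

inductive segmented :: "nat \<Rightarrow> nat \<Rightarrow> event list \<Rightarrow> val list \<Rightarrow> bool" for D where
  last: "t \<le> F \<Longrightarrow> segmented D F (replicate t Tick) []"
| emit: "t \<le> F \<Longrightarrow> segmented D D tr vs \<Longrightarrow>
    segmented D F (replicate t Tick @ Out v # tr) (v # vs)"

lemma outputs_append [simp]: "outputs (xs @ ys) = outputs xs @ outputs ys"
  by (induction xs rule: outputs.induct) auto

lemma outputs_Ticks [simp]: "outputs (replicate t Tick) = []"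
  by (induction t) auto

lemma segmented_outputs: "segmented D F tr vs \<Longrightarrow> outputs tr = vs"
  by (induction rule: segmented.induct) auto

lemma segmented_length:
  "segmented D F tr vs \<Longrightarrow> F \<le> D \<Longrightarrow> length tr \<le> Suc (length vs) * Suc D"
  by (induction rule: segmented.induct) auto

lemma segmented_Ticks:
  assumes "segmented D F tr vs" "F + k \<le> F'" shows "segmented D F' (replicate k Tick @ tr) vs"
  using assms(1)
proof cases
  case (last t)
  then show ?thesis using segmented.last[of "k + t" F' D] assms(2) by (simp add: replicate_add)
next
  case (emit t tr' vs' v)
  then show ?thesis
    using segmented.emit[of "k + t" F' D tr' vs' v] assms(2) by (simp add: replicate_add)
qed

lemma segmented_delay: "segmented D F tr vs \<Longrightarrow> F \<le> D \<Longrightarrow> delay_le D tr"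
proof (induction rule: segmented.induct)
  case (last t F)
  show ?case unfolding delay_le_def
  proof (intro allI impI)
    fix us m ws assume "replicate t Tick = us @ replicate m Tick @ ws"
    from arg_cong[OF this, of length] show "m \<le> D" using last by simp
  qed
next
  case (emit t F tr vs v)
  show ?case unfolding delay_le_def
  proof (intro allI impI)
    fix us m ws
    assume eq: "replicate t Tick @ Out v # tr = us @ replicate m Tick @ ws"
    then consider zs where "replicate t Tick = us @ zs" "zs @ Out v # tr = replicate m Tick @ ws"
      | zs where "us = replicate t Tick @ zs" "Out v # tr = zs @ replicate m Tick @ ws"
      by (auto simp: append_eq_append_conv2)
    then show "m \<le> D"
    proof cases
      case 1
      \<comment> \<open>At position \<open>length zs\<close> the trace has an output, so a block of
        ticks starting inside the first stretch cannot reach beyond it.\<close>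
      have "m \<le> length zs"
      proof (rule ccontr)
        assume "\<not> m \<le> length zs"
        then have "(replicate m Tick @ ws) ! length zs = Tick" by (simp add: nth_append)
        moreover have "(zs @ Out v # tr) ! length zs = Out v" by simp
        ultimately show False using 1(2) by simp
      qed
      moreover have "length zs \<le> t" using arg_cong[OF 1(1), of length] by simp
      ultimately show ?thesis using emit by simp
    next
      case 2
      show ?thesis
      proof (cases zs)
        case Nil
        then show ?thesis using 2(2) by (cases m) auto
      next
        case (Cons z zs')
        then show ?thesis using 2(2) emit unfolding delay_le_def by auto
      qed
    qed
  qed
qed

text \<open>Variable 0 keeps the input, 1 the current state and 2 the value to be written. The
  surrounding loop runs as long as the state is a pair.\<close>

definition enum_body :: "com \<Rightarrow> com \<Rightarrow> com" where
  "enum_body cn co = Seq (Call 2 co (Pair (Var 0) (Var 1)))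
     (Seq (Output (Var 2)) (Call 1 cn (Var 1)))"

fun state_chain :: "(val \<Rightarrow> val) \<Rightarrow> val \<Rightarrow> val list \<Rightarrow> bool" where
  "state_chain nx st [] \<longleftrightarrow> \<not> is_P st"
| "state_chain nx st (x # xs) \<longleftrightarrow> x = st \<and> is_P st \<and> state_chain nx (nx st) xs"

text \<open>Between two outputs the program advances the state, then computes and writes the next
  value, and writing takes time up to \<open>po\<close> again. The bound on the first stretch falls
  short of \<open>D\<close> by at least the cost of one advance, so that this cost can be put in
  front of it.\<close>

lemma enum_loop:
  assumes cn: "computes cn nx pn" and co: "computes co ou po"
    and D: "D \<ge> 5 + 2 * poly po (vsize v + B + 1) + poly pn B"
  shows "s 0 = v \<Longrightarrow> state_chain nx (s 1) sts \<Longrightarrow> \<forall>x\<in>set sts. vsize x \<le> B \<Longrightarrow>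
    \<exists>tr s'. exec (While (IsPair (Var 1)) (enum_body cn co)) s tr s' \<and>
      segmented D (3 + 2 * poly po (vsize v + B + 1)) tr (map (\<lambda>st. ou (P v st)) sts)"
proof (induction sts arbitrary: s)
  case Nil
  then have "eval (IsPair (Var 1)) s = N 0" by (auto simp: is_P_def split: val.splits)
  then have "exec (While (IsPair (Var 1)) (enum_body cn co)) s (replicate 1 Tick) s"
    by (simp add: exec.WhileFalse)
  then show ?case
    using segmented.last[of 1 "3 + 2 * poly po (vsize v + B + 1)" D] by auto
next
  case (Cons st sts)
  let ?F = "3 + 2 * poly po (vsize v + B + 1)" and ?o = "ou (P v st)"
  have st: "s 1 = st" "is_P st" "state_chain nx (nx st) sts" and B: "vsize st \<le> B"
    using Cons.prems by auto
  let ?s1 = "s(2 := ?o)" let ?s2 = "?s1(1 := nx st)"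
  obtain t1 where t1: "steps (Call 2 co (Pair (Var 0) (Var 1))) s t1 ?s1"
    "t1 \<le> Suc (poly po (vsize (P v st)))"
    using computes_Call[OF co, of 2 "Pair (Var 0) (Var 1)" s] Cons.prems(1) st(1) by auto
  obtain t2 where t2: "steps (Call 1 cn (Var 1)) ?s1 t2 ?s2" "t2 \<le> Suc (poly pn (vsize st))"
    using computes_Call[OF cn, of 1 "Var 1" ?s1] st(1) by auto
  have po: "poly po (vsize (P v st)) \<le> poly po (vsize v + B + 1)"
    using B by (intro poly_nat_mono) auto
  have pn: "poly pn (vsize st) \<le> poly pn B" using B by (intro poly_nat_mono)
  have "?s2 0 = v" "state_chain nx (?s2 1) sts" "\<forall>x\<in>set sts. vsize x \<le> B"
    using Cons.prems st by auto
  from Cons.IH[OF this] obtain tr s' where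
    tr: "exec (While (IsPair (Var 1)) (enum_body cn co)) ?s2 tr s'"
    "segmented D ?F tr (map (\<lambda>st. ou (P v st)) sts)" by blast
  have "exec (enum_body cn co) s (replicate t1 Tick @ (replicate (vsize ?o) Tick @ [Out ?o])
      @ replicate t2 Tick) ?s2"
    unfolding enum_body_def
    using exec.Seq[OF t1(1)[unfolded steps_def] exec.Seq[OF exec.Output[of "Var 2" ?s1] t2(1)[unfolded steps_def]]]
    by simp
  moreover have "eval (IsPair (Var 1)) s \<noteq> N 0"
    using st by (auto simp: is_P_def split: val.splits)
  ultimately have "exec (While (IsPair (Var 1)) (enum_body cn co)) s
      (Tick # (replicate t1 Tick @ (replicate (vsize ?o) Tick @ [Out ?o]) @ replicate t2 Tick) @ tr) s'"
    using exec.WhileTrue tr(1) by blast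
  \<comment> \<open>The trace is regrouped at its output: the ticks for advancing the state are
    charged to the stretch that follows.\<close>
  moreover have "Tick # (replicate t1 Tick @ (replicate (vsize ?o) Tick @ [Out ?o]) @ replicate t2 Tick) @ tr
      = replicate (Suc (t1 + vsize ?o)) Tick @ Out ?o # (replicate t2 Tick @ tr)"
    by (simp add: replicate_add)
  moreover have "segmented D D (replicate t2 Tick @ tr) (map (\<lambda>st. ou (P v st)) sts)"
    using tr(2) by (rule segmented_Ticks) (use t2(2) pn D in linarith)
  then have "segmented D ?F (replicate (Suc (t1 + vsize ?o)) Tick @ Out ?o # (replicate t2 Tick @ tr))
      (map (\<lambda>st. ou (P v st)) (st # sts))"
    unfolding list.map
    by (rule segmented.emit[rotated]) (use t1(2) po computes_size[OF co, of "P v st"] in linarith)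
  ultimately show ?case by (metis list.map(2))
qed

text \<open>The bound \<open>B\<close> on all states is an assumption of its own, because iterating
  a polynomial-time function may blow up its argument.\<close>

lemma enum_program:
  assumes "ptime start" "ptime nx" "ptime ou"
  obtains c :: com and q :: "nat poly" where
    "\<And>v sts B. state_chain nx (start v) sts \<Longrightarrow> \<forall>x\<in>set sts. vsize x \<le> B \<Longrightarrow>
      \<exists>tr. runs c v tr \<and>
        segmented (poly q (vsize v + B)) (poly q (vsize v + B)) tr (map (\<lambda>st. ou (P v st)) sts)"
proof -
  obtain cs ps where cs: "computes cs start ps" using assms(1) unfolding ptime_def by blast
  obtain cn pn where cn: "computes cn nx pn" using assms(2) unfolding ptime_def by blast
  obtain co po where co: "computes co ou po" using assms(3) unfolding ptime_def by blast
  let ?c = "Seq (Call 1 cs (Var 0)) (While (IsPair (Var 1)) (enum_body cn co))"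
  let ?q = "5 + ps + 2 * (po \<circ>\<^sub>p [:1, 1:]) + pn"
  show thesis
  proof (rule that[of ?c ?q])
    fix v sts B assume ch: "state_chain nx (start v) sts" and B: "\<forall>x\<in>set sts. vsize x \<le> B"
    define D where "D = poly ?q (vsize v + B)"
    have D: "D = 5 + poly ps (vsize v + B) + 2 * poly po (vsize v + B + 1) + poly pn (vsize v + B)"
      by (simp add: D_def poly_pcompose)
    let ?s = "(init v)(1 := start v)"
    obtain t where t: "steps (Call 1 cs (Var 0)) (init v) t ?s" "t \<le> Suc (poly ps (vsize v))"
      using computes_Call[OF cs, of 1 "Var 0" "init v"] by (auto simp: init_def)
    have "poly pn B \<le> poly pn (vsize v + B)" "poly ps (vsize v) \<le> poly ps (vsize v + B)"
      by (auto intro: poly_nat_mono)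
    then obtain tr s' where tr: "exec (While (IsPair (Var 1)) (enum_body cn co)) ?s tr s'"
      "segmented D (3 + 2 * poly po (vsize v + B + 1)) tr (map (\<lambda>st. ou (P v st)) sts)"
      using enum_loop[OF cn co, of v B D ?s sts] ch B D by (auto simp: init_def)
    have "segmented D D (replicate t Tick @ tr) (map (\<lambda>st. ou (P v st)) sts)"
      using tr(2) by (rule segmented_Ticks)
        (use t(2) D \<open>poly ps (vsize v) \<le> poly ps (vsize v + B)\<close> in linarith)
    moreover have "runs ?c v (replicate t Tick @ tr)"
      unfolding runs_def using exec.Seq[OF t(1)[unfolded steps_def] tr(1)] by blast
    ultimately show "\<exists>tr. runs ?c v tr \<and> segmented (poly ?q (vsize v + B))
        (poly ?q (vsize v + B)) tr (map (\<lambda>st. ou (P v st)) sts)"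
      unfolding D_def[symmetric] by blast
  qed
qed

section \<open>Enumerating a product of lists\<close>

text \<open>The first coordinate varies fastest, as does the first wheel of the odometer
  below.\<close>

fun choices :: "'a list list \<Rightarrow> 'a list list" where
  "choices [] = [[]]"
| "choices (l # ls) = concat (map (\<lambda>t. map (\<lambda>x. x # t) l) (choices ls))"

lemma distinct_choices: "\<forall>l\<in>set ls. distinct l \<Longrightarrow> distinct (choices ls)"
proof (induction ls)
  case (Cons l ls)
  have "distinct ts \<Longrightarrow> distinct (concat (map (\<lambda>t. map (\<lambda>x. x # t) l) ts))" for ts
    using Cons.prems by (induction ts) (auto simp: distinct_map inj_on_def)
  then show ?case using Cons by simp
qed simp

lemma length_choices: "length (choices ls) = prod_list (map length ls)"
  by (induction ls) (auto simp: length_concat comp_def sum_list_const_mult sum_list_triv)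

text \<open>A state of the odometer is a list of wheels; a wheel is a list together with a nonempty suffix
  whose head is the current choice.\<close>

fun odo_next :: "('a list \<times> 'a list) list \<Rightarrow> ('a list \<times> 'a list) list option" where
  "odo_next [] = None"
| "odo_next ((l, r) # t) = (if tl r \<noteq> [] then Some ((l, tl r) # t)
     else map_option (Cons (l, l)) (odo_next t))"

fun suffs :: "'a list \<Rightarrow> 'a list list" where
  "suffs [] = []"
| "suffs (x # xs) = (x # xs) # suffs xs"

fun odo_states :: "'a list list \<Rightarrow> ('a list \<times> 'a list) list list" where
  "odo_states [] = [[]]"
| "odo_states (l # ls) = concat (map (\<lambda>t. map (\<lambda>r. (l, r) # t) (suffs l)) (odo_states ls))"

fun opt_chain :: "('s \<Rightarrow> 's option) \<Rightarrow> 's list \<Rightarrow> bool" where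
  "opt_chain f [] \<longleftrightarrow> False"
| "opt_chain f [x] \<longleftrightarrow> f x = None"
| "opt_chain f (x # y # zs) \<longleftrightarrow> f x = Some y \<and> opt_chain f (y # zs)"

lemma map_hd_suffs: "map hd (suffs l) = l"
  by (induction l) auto

lemma map_heads_odo_states: "map (map (hd \<circ> snd)) (odo_states ls) = choices ls"
proof (induction ls)
  case (Cons l ls)
  have "map (map (hd \<circ> snd)) (map (\<lambda>r. (l, r) # t) (suffs l))
      = map (\<lambda>x. x # map (hd \<circ> snd) t) (map hd (suffs l))" for t
    by (simp add: comp_def)
  then show ?case
    using Cons by (simp add: map_concat comp_def map_hd_suffs flip: Cons)
qed simp

text \<open>Inside a block the tail \<open>t\<close> is fixed and only the first wheel advances.
  Once its suffix has a single element left, the carry leads to \<open>rest\<close>, the block of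
  the next tail, which starts with this wheel reset to \<open>(l, l)\<close>.\<close>

lemma opt_chain_wheel:
  assumes "r \<noteq> []"
    and "rest = [] \<Longrightarrow> odo_next t = None"
    and "rest \<noteq> [] \<Longrightarrow> opt_chain odo_next rest \<and> (\<exists>t'. odo_next t = Some t' \<and> hd rest = (l, l) # t')"
  shows "opt_chain odo_next (map (\<lambda>r. (l, r) # t) (suffs r) @ rest)"
  using assms(1)
proof (induction r)
  case (Cons x xs)
  show ?case
  proof (cases xs)
    case Nil
    then show ?thesis using assms(2,3) by (cases rest) auto
  next
    case (Cons y ys)
    then show ?thesis using Cons.IH by auto
  qed
qed simp

lemma odo_states_Cons:
  assumes "l \<noteq> []" "opt_chain odo_next ts"
  shows "opt_chain odo_next (concat (map (\<lambda>t. map (\<lambda>r. (l, r) # t) (suffs l)) ts)) \<and>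
    hd (concat (map (\<lambda>t. map (\<lambda>r. (l, r) # t) (suffs l)) ts)) = (l, l) # hd ts"
  using assms(2)
proof (induction ts rule: induct_list012)
  case (2 t)
  then show ?case
    using opt_chain_wheel[OF assms(1), of "[]" t l] assms(1) by (cases l) auto
next
  case (3 t t' ts)
  let ?c = "\<lambda>ts. concat (map (\<lambda>t. map (\<lambda>r. (l, r) # t) (suffs l)) ts)"
  have "?c (t' # ts) \<noteq> []" using assms(1) by (cases l) auto
  then have "opt_chain odo_next (map (\<lambda>r. (l, r) # t) (suffs l) @ ?c (t' # ts))"
    using opt_chain_wheel[OF assms(1), of "?c (t' # ts)" t l] 3 by auto
  then show ?case using assms(1) by (cases l) auto
qed simp

lemma opt_chain_odo_states:
  "\<forall>l\<in>set ls. l \<noteq> [] \<Longrightarrow>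
    opt_chain odo_next (odo_states ls) \<and> hd (odo_states ls) = map (\<lambda>l. (l, l)) ls"
  by (induction ls) (use odo_states_Cons in auto)

lemma Nil_notin_suffs [simp]: "[] \<notin> set (suffs l)"
  by (induction l) auto

lemma odo_states_nonempty: "t \<in> set (odo_states ls) \<Longrightarrow> (l, r) \<in> set t \<Longrightarrow> r \<noteq> []"
  by (induction ls arbitrary: t) auto

definition enc_wheel :: "val list \<times> val list \<Rightarrow> val" where
  "enc_wheel w = P (enc_list (fst w)) (enc_list (snd w))"

text \<open>The outer pair makes every state a pair, even one without wheels. The latter occurs for
  the empty kernel cut, which has exactly one choice and must produce one output before the loop
  ends.\<close>

definition enc_odo :: "(val list \<times> val list) list \<Rightarrow> val" where
  "enc_odo t = P (enc_list (map enc_wheel t)) (N 0)"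

lemma vsize_suffs: "r \<in> set (suffs l) \<Longrightarrow> vsize (enc_list r) \<le> vsize (enc_list l)"
  by (induction l) auto

text \<open>A wheel stores its list and a suffix of it, so the initial state, where all suffixes are
  full, is the largest. This yields the uniform bound on states that \<open>enum_program\<close>
  asks for.\<close>

lemma vsize_odo_states:
  "t \<in> set (odo_states ls) \<Longrightarrow> vsize (enc_odo t) \<le> vsize (enc_odo (map (\<lambda>l. (l, l)) ls))"
proof -
  have "t \<in> set (odo_states ls) \<Longrightarrow>
    vsize (enc_list (map enc_wheel t)) \<le> vsize (enc_list (map (enc_wheel \<circ> (\<lambda>l. (l, l))) ls))"
  proof (induction ls arbitrary: t)
    case (Cons l ls)
    then obtain t' r where "t = (l, r) # t'" "r \<in> set (suffs l)" "t' \<in> set (odo_states ls)" by auto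
    then show ?case using Cons.IH[of t'] vsize_suffs[of r l] by (simp add: enc_wheel_def)
  qed simp
  then show "t \<in> set (odo_states ls) \<Longrightarrow> ?thesis" by (simp add: enc_odo_def)
qed

text \<open>One turn of the odometer as a left fold; the first component of the accumulator is the carry,
  the second one the list of processed wheels in reverse order.\<close>

definition turn_wheel :: "val \<Rightarrow> val \<Rightarrow> val" where
  "turn_wheel a acc =
     (if vnat (vfst acc) = 0 then P (N 0) (P a (vsnd acc))
      else if is_P (vsnd (vsnd a)) then P (N 0) (P (P (vfst a) (vsnd (vsnd a))) (vsnd acc))
      else P (N 1) (P (P (vfst a) (vfst a)) (vsnd acc)))"

definition turn :: "val \<Rightarrow> val" where
  "turn st = (let r = fold turn_wheel (vlist (vfst st)) (P (N 1) (N 0))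
     in if vnat (vfst r) = 0 then P (enc_list (rev (vlist (vsnd r)))) (N 0) else N 0)"

lemma ptime_turn: "ptime turn"
proof -
  have fold: "ptime (\<lambda>st. fold turn_wheel (vlist (vfst st)) (P (N 1) (N 0)))"
  proof (rule ptime_fold[where q = "[:6, 2:]"])
    show "ptime (\<lambda>p. turn_wheel (vfst (vsnd p)) (vsnd (vsnd p)))"
      unfolding turn_wheel_def by (intro ptime_intros)
    fix v a b
    show "vsize (turn_wheel a b) \<le> vsize b + poly [:6, 2:] (vsize v + vsize a)"
      using vsize_sel[of a] vsize_sel[of b] vsize_sel[of "vsnd a"] by (auto simp: turn_wheel_def)
  qed (intro ptime_intros)+
  have "ptime (\<lambda>r. if vnat (vfst r) = 0 then P (enc_list (rev (vlist (vsnd r)))) (N 0) else N 0)"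
    by (intro ptime_intros)
  from ptime_compose[OF this fold] show ?thesis
    by (rule ptime_cong) (simp add: turn_def Let_def)
qed

lemma turn_wheel_no_carry:
  "fold turn_wheel as (P (N 0) (enc_list bs)) = P (N 0) (enc_list (rev as @ bs))"
proof (induction as arbitrary: bs)
  case (Cons a as)
  have "turn_wheel a (P (N 0) (enc_list bs)) = P (N 0) (enc_list (a # bs))"
    by (simp add: turn_wheel_def)
  then show ?case using Cons[of "a # bs"] by simp
qed simp

lemma is_P_enc_list: "is_P (enc_list l) \<longleftrightarrow> l \<noteq> []"
  by (cases l) auto

text \<open>As long as the carry is 1, exhausted wheels are reset; the first wheel with a further
  choice is advanced and clears the carry. A carry that survives all wheels means that the
  enumeration is complete.\<close>

lemma turn_wheel_carry:
  "\<forall>(l, r)\<in>set t. r \<noteq> [] \<Longrightarrow>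
    fold turn_wheel (map enc_wheel t) (P (N 1) (enc_list bs)) =
     (case odo_next t of
       None \<Rightarrow> P (N 1) (enc_list (rev (map (\<lambda>(l, r). enc_wheel (l, l)) t) @ bs))
     | Some t' \<Rightarrow> P (N 0) (enc_list (rev (map enc_wheel t') @ bs)))"
proof (induction t arbitrary: bs)
  case (Cons w t)
  obtain l r where w: "w = (l, r)" by (cases w)
  with Cons.prems obtain x xs where r: "r = x # xs" by (cases r) auto
  show ?case
  proof (cases "xs = []")
    case True
    then have "turn_wheel (enc_wheel w) (P (N 1) (enc_list bs))
        = P (N 1) (enc_list (enc_wheel (l, l) # bs))"
      by (simp add: w r turn_wheel_def enc_wheel_def)
    then show ?thesis using True Cons.IH[of "enc_wheel (l, l) # bs"] Cons.prems
      by (simp add: w r split: option.splits)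
  next
    case False
    then have "turn_wheel (enc_wheel w) (P (N 1) (enc_list bs))
        = P (N 0) (enc_list (enc_wheel (l, xs) # bs))"
      by (simp add: w r turn_wheel_def enc_wheel_def is_P_enc_list)
    then show ?thesis using False by (simp add: w r turn_wheel_no_carry del: enc_list_simps)
  qed
qed simp

lemma turn_enc_odo:
  assumes "\<forall>(l, r)\<in>set t. r \<noteq> []"
  shows "turn (enc_odo t) = (case odo_next t of None \<Rightarrow> N 0 | Some t' \<Rightarrow> enc_odo t')"
  using turn_wheel_carry[OF assms, of "[]"]
  by (simp add: turn_def enc_odo_def Let_def split: option.splits)

lemma state_chain_odo:
  assumes "opt_chain odo_next ts" "\<forall>t\<in>set ts. \<forall>(l, r)\<in>set t. r \<noteq> []"
  shows "state_chain turn (enc_odo (hd ts)) (map enc_odo ts)"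
  using assms
proof (induction ts rule: induct_list012)
  case (2 t)
  then show ?case by (simp add: turn_enc_odo) (simp add: enc_odo_def)
next
  case (3 t t' ts)
  then show ?case by (simp add: turn_enc_odo) (simp add: enc_odo_def)
qed simp

text \<open>Only the lists are computed in advance, not their product, which may be exponentially
  long. Nonempty lists give the odometer a valid first state, in which every wheel shows its
  head.\<close>

lemma product_enumeration:
  assumes ls: "ptime (\<lambda>v. enc_list (map enc_list (ls v)))"
    and ou: "ptime (\<lambda>p. ou (vfst p) (vsnd p))"
  obtains c :: com and q :: "nat poly" where
    "\<And>v. \<forall>l\<in>set (ls v). l \<noteq> [] \<Longrightarrow>
      \<exists>tr. runs c v tr \<and> segmented (poly q (vsize v)) (poly q (vsize v)) tr
        (map (\<lambda>h. ou v (enc_list h)) (choices (ls v)))"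
proof -
  let ?start = "\<lambda>v. enc_odo (map (\<lambda>l. (l, l)) (ls v))"
  have "ptime (\<lambda>v. P (enc_list (map (\<lambda>a. P a a) (vlist (enc_list (map enc_list (ls v)))))) (N 0))"
    by (intro ptime_intros ls)
  then have start: "ptime ?start"
    by (rule ptime_cong) (simp add: enc_odo_def enc_wheel_def comp_def)
  let ?heads = "\<lambda>p. enc_list (map (\<lambda>w. vfst (vsnd w)) (vlist (vfst (vsnd p))))"
  have "ptime (\<lambda>p. P (vfst p) (?heads p))"
    by (intro ptime_intros)
  from ptime_compose[OF ou this] have ou': "ptime (\<lambda>p. ou (vfst p) (?heads p))" by simp
  obtain p where p: "\<And>v. vsize (?start v) \<le> poly p (vsize v)"
    using ptime_size[OF start] by blast
  obtain c q where c: "\<And>v sts B. state_chain turn (?start v) sts \<Longrightarrow> \<forall>x\<in>set sts. vsize x \<le> B \<Longrightarrow>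
      \<exists>tr. runs c v tr \<and> segmented (poly q (vsize v + B)) (poly q (vsize v + B)) tr
        (map (\<lambda>st. ou (vfst (P v st)) (?heads (P v st))) sts)"
    using enum_program[OF start ptime_turn ou'] by blast
  show thesis
  proof (rule that[of c "q \<circ>\<^sub>p ([:0, 1:] + p)"])
    fix v assume ne: "\<forall>l\<in>set (ls v). l \<noteq> []"
    let ?ts = "odo_states (ls v)"
    have ne': "\<forall>t\<in>set ?ts. \<forall>(l, r)\<in>set t. r \<noteq> []" using odo_states_nonempty by blast
    have "state_chain turn (?start v) (map enc_odo ?ts)"
      using state_chain_odo[OF _ ne'] opt_chain_odo_states[OF ne] by simp
    moreover have "\<forall>x\<in>set (map enc_odo ?ts). vsize x \<le> poly p (vsize v)"
      using le_trans[OF vsize_odo_states p] by simp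
    moreover have "map (\<lambda>st. ou (vfst (P v st)) (?heads (P v st))) (map enc_odo ?ts)
        = map (\<lambda>h. ou v (enc_list h)) (choices (ls v))"
    proof -
      have "vfst (enc_list r) = hd r" if "r \<noteq> []" for r using that by (cases r) auto
      then have "?heads (P v (enc_odo t)) = enc_list (map (hd \<circ> snd) t)" if "t \<in> set ?ts" for t
        using ne' that by (fastforce simp: enc_odo_def enc_wheel_def intro!: arg_cong[where f = enc_list])
      then show ?thesis unfolding map_heads_odo_states[symmetric] map_map
        by (intro map_cong) simp_all
    qed
    ultimately show "\<exists>tr. runs c v tr \<and> segmented (poly (q \<circ>\<^sub>p ([:0, 1:] + p)) (vsize v))
        (poly (q \<circ>\<^sub>p ([:0, 1:] + p)) (vsize v)) tr (map (\<lambda>h. ou v (enc_list h)) (choices (ls v)))"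
      using c[of v "map enc_odo ?ts" "poly p (vsize v)"] by (simp add: poly_pcompose)
  qed
qed

section \<open>The kernel graph\<close>

text \<open>Adjacency is passed as a function, so that these notions apply both to an edge set in
  proofs and to an adjacency test on codes in programs. For the latter, all quantifiers and counts
  range below a bound.\<close>

definition deg :: "nat \<Rightarrow> (nat \<Rightarrow> nat \<Rightarrow> bool) \<Rightarrow> nat \<Rightarrow> nat" where
  "deg n adj v = card {w. w < n \<and> adj v w}"

definition high :: "nat \<Rightarrow> nat \<Rightarrow> (nat \<Rightarrow> nat \<Rightarrow> bool) \<Rightarrow> nat \<Rightarrow> bool" where
  "high n k adj v \<longleftrightarrow> k < deg n adj v"

definition low :: "nat \<Rightarrow> nat \<Rightarrow> (nat \<Rightarrow> nat \<Rightarrow> bool) \<Rightarrow> nat \<Rightarrow> bool" where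
  "low n k adj v \<longleftrightarrow> \<not> high n k adj v \<and> (\<forall>w<n. adj v w \<longrightarrow> high n k adj w)"

definition twins :: "nat \<Rightarrow> (nat \<Rightarrow> nat \<Rightarrow> bool) \<Rightarrow> nat \<Rightarrow> nat \<Rightarrow> bool" where
  "twins n adj u v \<longleftrightarrow> (\<forall>w<n. adj u w \<longleftrightarrow> adj v w)"

text \<open>The threshold \<open>3\<close> forces two common neighbours to lie on the same side of every matching cut of
  the kernel; the threshold \<open>k + 1\<close> keeps the degree of the vertices of high degree above \<open>k\<close>, so
  that they still belong to every vertex cover of size at most \<open>k\<close>. As the thresholds count all
  smaller vertices, removed or not, removability needs no recursion.\<close>

definition removed :: "nat \<Rightarrow> nat \<Rightarrow> (nat \<Rightarrow> nat \<Rightarrow> bool) \<Rightarrow> nat \<Rightarrow> bool" where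
  "removed n k adj v \<longleftrightarrow> low n k adj v \<and>
     (deg n adj v \<le> 1 \<longrightarrow> 2 \<le> card {u. u < v \<and> twins n adj u v}) \<and>
     (\<forall>x<n. \<forall>y<n. adj v x \<and> adj v y \<longrightarrow>
        (if x = y then k + 1 else 3) \<le> card {u. u < v \<and> adj u x \<and> adj u y})"

text \<open>The rank among the vertices that are not removed. Renumbering by rank is monotone, so
  sorted edge lists remain sorted.\<close>

definition index :: "nat \<Rightarrow> nat \<Rightarrow> (nat \<Rightarrow> nat \<Rightarrow> bool) \<Rightarrow> nat \<Rightarrow> nat" where
  "index n k adj v = card {u. u < v \<and> \<not> removed n k adj u}"

text \<open>A removed vertex of degree one is represented by its least twin; the cardinality below is a
  least element, written in this form because bounded counting is available to programs.\<close>

definition rep :: "nat \<Rightarrow> nat \<Rightarrow> (nat \<Rightarrow> nat \<Rightarrow> bool) \<Rightarrow> nat \<Rightarrow> nat" where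
  "rep n k adj v = (if removed n k adj v \<and> deg n adj v = 1
     then card {u. u < n \<and> (\<forall>u'<Suc u. \<not> twins n adj u' v)} else v)"

section \<open>Ranks in finite sets, cuts given by two-colourings, and transversals\<close>

lemma rank_bij:
  fixes S :: "nat set"
  assumes "finite S"
  shows "bij_betw (\<lambda>s. card {w \<in> S. w < s}) S {..<card S}"
proof -
  have less: "card {w \<in> S. w < s} < card {w \<in> S. w < t}" if "s \<in> S" "s < t" for s t
    using that assms by (intro psubset_card_mono) auto
  have inj: "inj_on (\<lambda>s. card {w \<in> S. w < s}) S"
  proof (rule inj_onI)
    fix s t assume "s \<in> S" "t \<in> S" "card {w \<in> S. w < s} = card {w \<in> S. w < t}"
    then show "s = t" using less[of s t] less[of t s] by (cases s t rule: linorder_cases) auto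
  qed
  have "card {w \<in> S. w < s} < card S" if "s \<in> S" for s
    using that assms by (intro psubset_card_mono) auto
  then have "(\<lambda>s. card {w \<in> S. w < s}) ` S \<subseteq> {..<card S}" by auto
  moreover have "card ((\<lambda>s. card {w \<in> S. w < s}) ` S) = card S" using inj by (rule card_image)
  ultimately show ?thesis using inj card_subset_eq[of "{..<card S}"] by (auto simp: bij_betw_def)
qed

text \<open>The elements of rank below \<open>m\<close> are the \<open>m\<close> smallest ones. This
  serves both to show that enough vertices survive and that few do.\<close>

lemma card_first:
  fixes S :: "nat set"
  assumes "finite S"
  shows "card {s \<in> S. card {w \<in> S. w < s} < m} = min m (card S)"
proof -
  have "bij_betw (\<lambda>s. card {w \<in> S. w < s}) {s \<in> S. card {w \<in> S. w < s} < m} {..<min m (card S)}"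
  proof -
    have "inj_on (\<lambda>s. card {w \<in> S. w < s}) {s \<in> S. card {w \<in> S. w < s} < m}"
      using rank_bij[OF assms] by (auto simp: bij_betw_def inj_on_def)
    moreover have "(\<lambda>s. card {w \<in> S. w < s}) ` {s \<in> S. card {w \<in> S. w < s} < m} =
        (\<lambda>s. card {w \<in> S. w < s}) ` S \<inter> {..<m}" by auto
    moreover have "(\<lambda>s. card {w \<in> S. w < s}) ` S = {..<card S}"
      using rank_bij[OF assms] by (simp add: bij_betw_def)
    ultimately show ?thesis by (auto simp: bij_betw_def)
  qed
  then show ?thesis by (simp add: bij_betw_same_card)
qed

text \<open>A colouring \<open>\<sigma>\<close> replaces the partition: it can be changed vertex by
  vertex and composed with a renumbering. Only the requirement of two nonempty sides has to be
  stated separately.\<close>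

definition cut :: "'a set set \<Rightarrow> ('a \<Rightarrow> bool) \<Rightarrow> 'a set set" where
  "cut E \<sigma> = {e \<in> E. \<exists>a b. e = {a, b} \<and> \<sigma> a \<noteq> \<sigma> b}"

lemma cut_edge: "{a, b} \<in> cut E \<sigma> \<longleftrightarrow> {a, b} \<in> E \<and> \<sigma> a \<noteq> \<sigma> b"
  unfolding cut_def by (auto simp: doubleton_eq_iff)

lemma cut_cong: "(\<And>a b. {a, b} \<in> E \<Longrightarrow> \<sigma> a \<noteq> \<sigma> b \<longleftrightarrow> \<tau> a \<noteq> \<tau> b) \<Longrightarrow> cut E \<sigma> = cut E \<tau>"
  unfolding cut_def by blast

lemma matching_cut_iff:
  assumes E: "\<And>e. e \<in> E \<Longrightarrow> e \<subseteq> V"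
  shows "matching_cut V E M \<longleftrightarrow>
    disjoint M \<and> (\<exists>\<sigma>. M = cut E \<sigma> \<and> (\<exists>a\<in>V. \<exists>b\<in>V. \<sigma> a \<noteq> \<sigma> b))"
proof -
  have "(\<exists>A B. A \<noteq> B \<and> partition_on V {A, B} \<and> M = edges_between E A B) \<longleftrightarrow>
      (\<exists>\<sigma>. M = cut E \<sigma> \<and> (\<exists>a\<in>V. \<exists>b\<in>V. \<sigma> a \<noteq> \<sigma> b))" (is "?l \<longleftrightarrow> ?r")
  proof
    assume ?l
    then obtain A B where AB: "A \<noteq> B" "partition_on V {A, B}" "M = edges_between E A B" by blast
    then have V: "V = A \<union> B" "A \<inter> B = {}" "A \<noteq> {}" "B \<noteq> {}"
      by (auto simp: partition_on_def disjoint_def)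
    have "M = cut E (\<lambda>v. v \<in> A)"
      unfolding AB(3) edges_between_def cut_def using E V
      by (auto simp: doubleton_eq_iff) blast+
    moreover obtain a b where "a \<in> A" "b \<in> B" using V by auto
    ultimately show ?r using V by (intro exI[of _ "\<lambda>v. v \<in> A"]) auto
  next
    assume ?r
    then obtain \<sigma> where s: "M = cut E \<sigma>" "\<exists>a\<in>V. \<exists>b\<in>V. \<sigma> a \<noteq> \<sigma> b" by blast
    let ?A = "{v \<in> V. \<sigma> v}" and ?B = "{v \<in> V. \<not> \<sigma> v}"
    have ne: "?A \<noteq> {}" "?B \<noteq> {}" using s(2) by blast+
    then have "?A \<noteq> ?B" by blast
    moreover have "partition_on V {?A, ?B}"
      using ne by (auto simp: partition_on_def disjoint_def)
    moreover have "M = edges_between E ?A ?B"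
    proof (intro set_eqI iffI)
      fix e assume "e \<in> M"
      then obtain a b where e: "e \<in> E" "e = {a, b}" "\<sigma> a \<noteq> \<sigma> b" using s(1) by (auto simp: cut_def)
      then have "a \<in> V" "b \<in> V" using E by auto
      show "e \<in> edges_between E ?A ?B"
      proof (cases "\<sigma> a")
        case True
        then show ?thesis using e \<open>a \<in> V\<close> \<open>b \<in> V\<close> unfolding edges_between_def by blast
      next
        case False
        moreover have "e = {b, a}" using e by auto
        ultimately show ?thesis using e \<open>a \<in> V\<close> \<open>b \<in> V\<close> unfolding edges_between_def by blast
      qed
    next
      fix e assume "e \<in> edges_between E ?A ?B"
      then obtain a b where "e \<in> E" "e = {a, b}" "\<sigma> a" "\<not> \<sigma> b"
        unfolding edges_between_def by blast
      then show "e \<in> M" by (auto simp: s(1) cut_edge)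
    qed
    ultimately show ?l by (intro exI conjI)
  qed
  then show ?thesis unfolding matching_cut_def by simp
qed

lemma matching_cut_subset: "matching_cut V E M \<Longrightarrow> M \<subseteq> E"
  unfolding matching_cut_def edges_between_def by blast

lemma cut_image:
  assumes "inj_on \<phi> V" "\<And>e. e \<in> E \<Longrightarrow> e \<subseteq> V"
  shows "cut ((`) \<phi> ` E) \<tau> = (`) \<phi> ` cut E (\<tau> \<circ> \<phi>)"
proof -
  have "\<phi> ` e \<in> cut ((`) \<phi> ` E) \<tau> \<longleftrightarrow> e \<in> cut E (\<tau> \<circ> \<phi>)" if e: "e \<in> E" for e
  proof
    assume "\<phi> ` e \<in> cut ((`) \<phi> ` E) \<tau>"
    then obtain a b where ab: "\<phi> ` e = {a, b}" "\<tau> a \<noteq> \<tau> b" by (auto simp: cut_def)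
    then obtain c d where cd: "c \<in> e" "\<phi> c = a" "d \<in> e" "\<phi> d = b" by (metis insert_iff imageE)
    then have "\<phi> ` e = \<phi> ` {c, d}" using ab by simp
    then have "e = {c, d}"
      using inj_on_image_eq_iff[OF assms(1), of e "{c, d}"] assms(2)[OF e] cd by auto
    then show "e \<in> cut E (\<tau> \<circ> \<phi>)" using e ab cd by (auto simp: cut_edge)
  next
    assume "e \<in> cut E (\<tau> \<circ> \<phi>)"
    then obtain a b where "e = {a, b}" "\<tau> (\<phi> a) \<noteq> \<tau> (\<phi> b)" by (auto simp: cut_def)
    moreover from this e have "{\<phi> a, \<phi> b} \<in> (`) \<phi> ` E" by (metis image_eqI image_insert image_empty)
    ultimately show "\<phi> ` e \<in> cut ((`) \<phi> ` E) \<tau>" by (simp add: cut_edge)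
  qed
  moreover have "cut E (\<tau> \<circ> \<phi>) \<subseteq> E" "cut ((`) \<phi> ` E) \<tau> \<subseteq> (`) \<phi> ` E" by (auto simp: cut_def)
  ultimately show ?thesis by blast
qed

lemma disjoint_image_iff:
  assumes "inj_on \<phi> V" "\<And>e. e \<in> M \<Longrightarrow> e \<subseteq> V"
  shows "disjoint ((`) \<phi> ` M) \<longleftrightarrow> disjoint M"
proof -
  have "\<phi> ` e \<inter> \<phi> ` e' = {} \<longleftrightarrow> e \<inter> e' = {}" "\<phi> ` e = \<phi> ` e' \<longleftrightarrow> e = e'"
    if "e \<in> M" "e' \<in> M" for e e'
    using inj_on_image_Int[OF assms(1), of e e'] inj_on_image_eq_iff[OF assms(1), of e e'] assms(2) that
    by auto
  then show ?thesis by (simp add: disjoint_def)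
qed

lemma matching_cut_image:
  assumes inj: "inj_on \<phi> V" and E: "\<And>e. e \<in> E \<Longrightarrow> e \<subseteq> V" and M: "M \<subseteq> E"
  shows "matching_cut (\<phi> ` V) ((`) \<phi> ` E) ((`) \<phi> ` M) \<longleftrightarrow> matching_cut V E M"
proof -
  have E': "\<And>e. e \<in> (`) \<phi> ` E \<Longrightarrow> e \<subseteq> \<phi> ` V" using E by blast
  have inj_E: "inj_on ((`) \<phi>) E"
    using inj E by (intro inj_onI) (metis inj_on_image_eq_iff)
  have cut: "(`) \<phi> ` M = cut ((`) \<phi> ` E) \<tau> \<longleftrightarrow> M = cut E (\<tau> \<circ> \<phi>)" for \<tau>
  proof -
    have "cut E (\<tau> \<circ> \<phi>) \<subseteq> E" by (auto simp: cut_def)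
    then show ?thesis using inj_on_image_eq_iff[OF inj_E M] by (simp only: cut_image[OF inj E])
  qed
  have "(\<exists>\<tau>. M = cut E (\<tau> \<circ> \<phi>) \<and> (\<exists>a\<in>V. \<exists>b\<in>V. \<tau> (\<phi> a) \<noteq> \<tau> (\<phi> b))) \<longleftrightarrow>
      (\<exists>\<sigma>. M = cut E \<sigma> \<and> (\<exists>a\<in>V. \<exists>b\<in>V. \<sigma> a \<noteq> \<sigma> b))" (is "?l \<longleftrightarrow> ?r")
  proof
    assume ?r
    then obtain \<sigma> where s: "M = cut E \<sigma>" "\<exists>a\<in>V. \<exists>b\<in>V. \<sigma> a \<noteq> \<sigma> b" by blast
    define \<tau> where "\<tau> = \<sigma> \<circ> inv_into V \<phi>"
    have t: "\<tau> (\<phi> a) = \<sigma> a" if "a \<in> V" for a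
      using that inj by (simp add: \<tau>_def)
    have "cut E (\<tau> \<circ> \<phi>) = cut E \<sigma>"
      by (rule cut_cong) (use E t in auto)
    then show ?l using s t by (intro exI[of _ \<tau>]) auto
  qed (auto simp: comp_def)
  moreover have "disjoint ((`) \<phi> ` M) \<longleftrightarrow> disjoint M"
    using disjoint_image_iff[OF inj] E M by blast
  ultimately show ?thesis
    by (simp add: matching_cut_iff[OF E] matching_cut_iff[OF E'] cut)
qed

text \<open>Taking images under \<open>\<rho>\<close> preserves inclusion, and inclusions also lift:
  a smaller \<open>s\<close> with \<open>q s\<close> is the image of a part of \<open>M\<close>, and
  a larger one is reached by adding to \<open>M\<close> one preimage for every new element. Hence
  extremal sets correspond to extremal images.\<close>

lemma transversal_extremal:
  assumes p: "\<And>M. p M \<longleftrightarrow> M \<subseteq> G \<and> inj_on \<rho> M \<and> q (\<rho> ` M)" and q: "\<And>s. q s \<Longrightarrow> s \<subseteq> \<rho> ` G"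
  shows "p M \<and> (\<forall>M'. p M' \<and> M' \<subseteq> M \<longrightarrow> M' = M) \<longleftrightarrow>
      M \<subseteq> G \<and> inj_on \<rho> M \<and> q (\<rho> ` M) \<and> (\<forall>s. q s \<and> s \<subseteq> \<rho> ` M \<longrightarrow> s = \<rho> ` M)"
    and "p M \<and> (\<forall>M'. p M' \<and> M \<subseteq> M' \<longrightarrow> M' = M) \<longleftrightarrow>
      M \<subseteq> G \<and> inj_on \<rho> M \<and> q (\<rho> ` M) \<and> (\<forall>s. q s \<and> \<rho> ` M \<subseteq> s \<longrightarrow> s = \<rho> ` M)"
proof -
  have min: "s = \<rho> ` M" if "p M" "\<forall>M'. p M' \<and> M' \<subseteq> M \<longrightarrow> M' = M" "q s" "s \<subseteq> \<rho> ` M" for s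
  proof -
    let ?M = "{e \<in> M. \<rho> e \<in> s}"
    have "\<rho> ` ?M = s" using that(4) by auto
    moreover have "?M \<subseteq> G" "inj_on \<rho> ?M" using that(1) by (auto simp: p inj_on_def)
    ultimately have "p ?M" using that(3) p by metis
    then have "?M = M" using that(2) by blast
    then show ?thesis using \<open>\<rho> ` ?M = s\<close> by simp
  qed
  have max: "s = \<rho> ` M" if M: "p M" "\<forall>M'. p M' \<and> M \<subseteq> M' \<longrightarrow> M' = M" "q s" "\<rho> ` M \<subseteq> s" for s
  proof -
    let ?g = "inv_into G \<rho>"
    let ?M = "M \<union> ?g ` (s - \<rho> ` M)"
    have sG: "s \<subseteq> \<rho> ` G" using q M(3) by blast
    have g: "\<rho> (?g f) = f" "?g f \<in> G" if "f \<in> s" for f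
      using sG that by (auto simp: f_inv_into_f inv_into_into)
    have "(\<lambda>f. \<rho> (?g f)) ` (s - \<rho> ` M) = s - \<rho> ` M" using g(1) by force
    then have "\<rho> ` ?M = s" using M(4) by (auto simp: image_Un image_image)
    moreover have "?M \<subseteq> G" using M(1) g(2) by (auto simp: p)
    moreover have "inj_on \<rho> ?M"
      using M(1) g(1) unfolding inj_on_def p by (auto simp: image_iff)
    ultimately have "p ?M" using M(3) p by metis
    then have "?M = M" using M(2) by blast
    then show ?thesis using \<open>\<rho> ` ?M = s\<close> by simp
  qed
  have eq: "M' = M" if "\<rho> ` M' = \<rho> ` M" "inj_on \<rho> (M \<union> M')" for M M'
    using inj_on_image_eq_iff[OF that(2), of M' M] that(1) by simp
  show "p M \<and> (\<forall>M'. p M' \<and> M' \<subseteq> M \<longrightarrow> M' = M) \<longleftrightarrow>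
      M \<subseteq> G \<and> inj_on \<rho> M \<and> q (\<rho> ` M) \<and> (\<forall>s. q s \<and> s \<subseteq> \<rho> ` M \<longrightarrow> s = \<rho> ` M)" (is "?l \<longleftrightarrow> ?r")
  proof
    assume l: ?l then show ?r using min[of s for s] p[of M] by auto
  next
    assume r: ?r
    have "M' = M" if "p M'" "M' \<subseteq> M" for M'
    proof -
      have "q (\<rho> ` M')" "\<rho> ` M' \<subseteq> \<rho> ` M" using that p[of M'] by auto
      then have "\<rho> ` M' = \<rho> ` M" using r by blast
      moreover have "M \<union> M' = M" using that by auto
      ultimately show ?thesis using eq[of M' M] r by simp
    qed
    moreover have "p M" using r p[of M] by simp
    ultimately show ?l by blast
  qed
  show "p M \<and> (\<forall>M'. p M' \<and> M \<subseteq> M' \<longrightarrow> M' = M) \<longleftrightarrow>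
      M \<subseteq> G \<and> inj_on \<rho> M \<and> q (\<rho> ` M) \<and> (\<forall>s. q s \<and> \<rho> ` M \<subseteq> s \<longrightarrow> s = \<rho> ` M)" (is "?l \<longleftrightarrow> ?r")
  proof
    assume l: ?l then show ?r using max[of s for s] p[of M] by auto
  next
    assume r: ?r
    have "M' = M" if "p M'" "M \<subseteq> M'" for M'
    proof -
      have "q (\<rho> ` M')" "\<rho> ` M \<subseteq> \<rho> ` M'" "inj_on \<rho> M'" using that p[of M'] by auto
      then have "\<rho> ` M' = \<rho> ` M" using r by blast
      moreover have "M \<union> M' = M'" using that by auto
      ultimately show ?thesis using eq[of M' M] \<open>inj_on \<rho> M'\<close> by simp
    qed
    moreover have "p M" using r p[of M] by simp
    ultimately show ?l by blast
  qed
qed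

lemma inj_on_cong_eq:
  "(\<And>x y. x \<in> A \<Longrightarrow> y \<in> A \<Longrightarrow> f x = f y \<longleftrightarrow> g x = g y) \<Longrightarrow> inj_on f A \<longleftrightarrow> inj_on g A"
  by (simp add: inj_on_def)

text \<open>Among three common neighbours two have the same colour. If \<open>x\<close> and
  \<open>y\<close> differed, one of them would have the opposite colour, and its edges to these two
  would be cut edges sharing a vertex.\<close>

lemma common_nbrs_same_side:
  assumes d: "disjoint (cut F \<sigma>)" and S: "3 \<le> card S"
    and F: "\<And>u. u \<in> S \<Longrightarrow> {u, x} \<in> F \<and> {u, y} \<in> F \<and> u \<noteq> x \<and> u \<noteq> y"
  shows "\<sigma> x = \<sigma> y"
proof (rule ccontr)
  assume ne: "\<sigma> x \<noteq> \<sigma> y"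
  obtain T where "T \<subseteq> S" "card T = 3" using S by (metis obtain_subset_with_card_n)
  then obtain p q r where pqr: "p \<in> S" "q \<in> S" "r \<in> S" "p \<noteq> q" "p \<noteq> r" "q \<noteq> r"
    by (auto simp: card_3_iff)
  have no: False if "u \<in> S" "w \<in> S" "u \<noteq> w" "\<sigma> u = \<sigma> w" for u w
  proof -
    obtain z where z: "z = x \<or> z = y" "\<sigma> u \<noteq> \<sigma> z" using ne by (metis (full_types))
    then have "{u, z} \<in> cut F \<sigma>" "{w, z} \<in> cut F \<sigma>"
      using F that by (auto simp: cut_edge)
    moreover have "{u, z} \<noteq> {w, z}" using that(3) by (auto simp: doubleton_eq_iff)
    ultimately show False using disjointD[OF d] by blast
  qed
  show False using no[of p q] no[of p r] no[of q r] pqr by (metis (full_types))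
qed

lemma finite_smaller [simp]: "finite {u. u < v \<and> p u}" for v :: nat
  by (rule finite_subset[of _ "{..<v}"]) auto

section \<open>Leaves, representatives and removed vertices\<close>

locale vc_instance =
  fixes n :: nat and E :: "nat set set" and k :: nat
  assumes simple: "simple_graph {..<n} E" and k: "k = vertex_cover_number {..<n} E"
begin

abbreviation adj :: "nat \<Rightarrow> nat \<Rightarrow> bool" where "adj a b \<equiv> {a, b} \<in> E"
abbreviation "dg \<equiv> deg n adj"
abbreviation "hi \<equiv> high n k adj"
abbreviation "lo \<equiv> low n k adj"
abbreviation "tw \<equiv> twins n adj"
abbreviation "rem \<equiv> removed n k adj"
abbreviation "idx \<equiv> index n k adj"
abbreviation "rp \<equiv> rep n k adj"

definition Kept :: "nat set" where "Kept = {v. v < n \<and> \<not> rem v}"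
definition EK :: "nat set set" where "EK = {e \<in> E. e \<subseteq> Kept}"
text \<open>\<open>rp\<close> moves no vertex \<open>v < n\<close> outside this set. Members may be
  kept or removed; being low, each has a high neighbour, which is kept and is not a member
  itself.\<close>

definition Leaf :: "nat set" where "Leaf = {v. v < n \<and> lo v \<and> dg v = 1}"

lemma adj_lt: "adj a b \<Longrightarrow> a < n \<and> b < n \<and> a \<noteq> b"
  using simple unfolding simple_graph_def by fastforce

lemma adj_sym: "adj a b \<Longrightarrow> adj b a"
  by (simp add: insert_commute)

lemma edgeE:
  assumes "e \<in> E" obtains a b where "e = {a, b}" "adj a b" "a < n" "b < n" "a \<noteq> b"
  using assms simple unfolding simple_graph_def by (metis adj_lt card_2_iff)

lemma E_subset: "e \<in> E \<Longrightarrow> e \<subseteq> {..<n}"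
  using simple unfolding simple_graph_def by blast

lemma EK_subset: "e \<in> EK \<Longrightarrow> e \<subseteq> Kept"
  by (auto simp: EK_def)

lemma removed_nbr: "rem v \<Longrightarrow> adj v x \<Longrightarrow> hi x"
  using adj_lt by (auto simp: removed_def low_def)

lemma hi_Kept: "hi x \<Longrightarrow> x < n \<Longrightarrow> x \<in> Kept \<and> x \<notin> Leaf"
  by (auto simp: Kept_def Leaf_def removed_def low_def)

lemma Leaf_nbr:
  assumes "v \<in> Leaf"
  obtains x where "adj v x" "hi x" "x \<in> Kept" "x \<notin> Leaf" "\<forall>w. adj v w \<longleftrightarrow> w = x"
proof -
  obtain x where "{w. w < n \<and> adj v w} = {x}"
    using assms by (auto simp: Leaf_def deg_def card_1_singleton_iff)
  then have x: "\<forall>w. adj v w \<longleftrightarrow> w = x" using adj_lt by blast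
  then have "adj v x" by simp
  moreover have "hi x" using assms \<open>adj v x\<close> adj_lt by (auto simp: Leaf_def low_def)
  moreover have "x \<in> Kept" "x \<notin> Leaf" using hi_Kept \<open>hi x\<close> \<open>adj v x\<close> adj_lt by blast+
  ultimately show thesis using x that by blast
qed

lemma twins_adj: "tw u v \<Longrightarrow> adj u w \<longleftrightarrow> adj v w"
  using adj_lt unfolding twins_def by blast

lemma rep_Least:
  assumes "v < n" "rem v" "dg v = 1" shows "rp v = (LEAST u. tw u v)"
proof -
  let ?l = "LEAST u. tw u v"
  have l: "tw ?l v" by (rule LeastI[of _ v]) (simp add: twins_def)
  have "?l \<le> v" by (rule Least_le) (simp add: twins_def)
  have "{u. u < n \<and> (\<forall>u'<Suc u. \<not> tw u' v)} = {..<?l}"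
  proof (intro set_eqI iffI)
    fix u assume "u \<in> {u. u < n \<and> (\<forall>u'<Suc u. \<not> tw u' v)}"
    then show "u \<in> {..<?l}" using l by (cases "u < ?l") auto
  next
    fix u assume "u \<in> {..<?l}"
    then have "u < ?l" by simp
    moreover have "\<not> tw u' v" if "u' < Suc u" for u'
      by (rule not_less_Least) (use that \<open>u < ?l\<close> in simp)
    ultimately show "u \<in> {u. u < n \<and> (\<forall>u'<Suc u. \<not> tw u' v)}"
      using \<open>?l \<le> v\<close> assms(1) by auto
  qed
  then show ?thesis using assms by (simp add: rep_def)
qed

lemma rep_not_Leaf: "v < n \<Longrightarrow> v \<notin> Leaf \<Longrightarrow> rp v = v"
  by (auto simp: rep_def removed_def Leaf_def)

lemma rep_Kept: "v \<in> Kept \<Longrightarrow> rp v = v"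
  by (auto simp: rep_def Kept_def)

lemma rep_Leaf:
  assumes "v \<in> Leaf" shows "rp v \<in> Leaf" "rp v \<in> Kept" "adj (rp v) w \<longleftrightarrow> adj v w"
proof -
  have "rp v \<in> Leaf \<and> rp v \<in> Kept \<and> (\<forall>w. adj (rp v) w \<longleftrightarrow> adj v w)"
  proof (cases "rem v")
    case False
    then show ?thesis using assms by (auto simp: rep_def Kept_def Leaf_def)
  next
    case True
    have v: "v < n" "dg v = 1" "lo v" using assms by (auto simp: Leaf_def)
    let ?l = "LEAST u. tw u v"
    have l: "tw ?l v" by (rule LeastI[of _ v]) (simp add: twins_def)
    have "?l \<le> v" by (rule Least_le) (simp add: twins_def)
    have a: "adj ?l w \<longleftrightarrow> adj v w" for w using twins_adj[OF l] .
    have dl: "dg ?l = 1" using v a by (simp add: deg_def)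
    have "lo ?l" using v a dl by (simp add: low_def high_def)
    \<comment> \<open>The least twin has no smaller twin, whereas removing a vertex of degree at
      most one takes two of them; hence the representative is kept.\<close>
    have none: "{u. u < ?l \<and> tw u ?l} = {}"
    proof -
      have "\<not> tw u ?l" if "u < ?l" for u
        using not_less_Least[OF that] l by (auto simp: twins_def)
      then show ?thesis by blast
    qed
    have "\<not> rem ?l" unfolding removed_def none using dl by simp
    then show ?thesis
      using rep_Least[OF v(1) True v(2)] a dl \<open>lo ?l\<close> \<open>?l \<le> v\<close> v(1)
      by (auto simp: Leaf_def Kept_def)
  qed
  then show "rp v \<in> Leaf" "rp v \<in> Kept" "adj (rp v) w \<longleftrightarrow> adj v w" by auto
qed

text \<open>An edge of \<open>E\<close> fails to be good exactly when it has a removed endpoint of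
  degree at least two. By \<open>cut_Good\<close> such edges occur in no matching cut.\<close>

definition Good :: "nat set set" where "Good = {e \<in> E. rp ` e \<subseteq> Kept}"

text \<open>The neighbour of a leaf is high and therefore no leaf, so an edge contains at most one
  leaf.\<close>

lemma edge_cases:
  assumes "e \<in> E"
  obtains (inner) a b where "e = {a, b}" "a \<notin> Leaf" "b \<notin> Leaf" "rp ` e = e" "a < n" "b < n" "a \<noteq> b"
  | (leaf) x v where "e = {x, v}" "v \<in> Leaf" "x \<notin> Leaf" "x \<in> Kept" "hi x" "\<forall>w. adj v w \<longleftrightarrow> w = x"
      "rp ` e = {x, rp v}"
proof -
  obtain a b where e: "e = {a, b}" "adj a b" "a < n" "b < n" "a \<noteq> b" using assms by (rule edgeE)
  have *: thesis if v: "v \<in> Leaf" "adj v w" "e = {w, v}" for v w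
  proof -
    obtain x where x: "adj v x" "hi x" "x \<in> Kept" "x \<notin> Leaf" "\<forall>w. adj v w \<longleftrightarrow> w = x"
      using v(1) by (rule Leaf_nbr) blast
    then show thesis using leaf[of w v] v rep_Kept by auto
  qed
  show thesis
  proof (cases "a \<in> Leaf \<or> b \<in> Leaf")
    case True
    then show thesis using *[of a b] *[of b a] e adj_sym by (auto simp: insert_commute)
  next
    case False
    then show thesis using inner[of a b] e rep_not_Leaf by auto
  qed
qed

lemma EK_Good: "e \<in> EK \<Longrightarrow> e \<in> Good \<and> rp ` e = e"
  using rep_Kept by (force simp: EK_def Good_def)

lemma Good_image:
  assumes "e \<in> Good" shows "rp ` e \<in> EK"
proof -
  have "e \<in> E" using assms by (simp add: Good_def)
  then have "rp ` e \<in> E"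
  proof (cases rule: edge_cases)
    case (leaf x v)
    then have "adj (rp v) x" using rep_Leaf(3)[of v x] by simp
    then show ?thesis using leaf adj_sym by simp
  qed (use \<open>e \<in> E\<close> in simp)
  then show ?thesis using assms by (auto simp: Good_def EK_def)
qed

lemma leaf_Good:
  assumes "v \<in> Leaf" "adj x v" shows "{x, v} \<in> Good"
proof -
  obtain y where y: "y \<in> Kept" "\<forall>w. adj v w \<longleftrightarrow> w = y" using assms(1) by (rule Leaf_nbr) blast
  then have "x \<in> Kept" using adj_sym[OF assms(2)] by simp
  then show ?thesis using assms rep_Leaf(2)[OF assms(1)] rep_Kept[of x] by (simp add: Good_def)
qed

text \<open>Edges with the same representative are pendant at a common vertex. They meet there, so
  no matching contains both; this is why matching cuts are transversals.\<close>

lemma rep_collision: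
  assumes "e \<in> E" "e' \<in> E" "e \<noteq> e'" "rp ` e = rp ` e'"
  obtains x v v' where "e = {x, v}" "e' = {x, v'}" "v \<in> Leaf" "v' \<in> Leaf" "\<forall>w. adj v w \<longleftrightarrow> w = x"
  using assms(1)
proof (cases rule: edge_cases)
  case i: (inner a b)
  from assms(2) show thesis
  proof (cases rule: edge_cases)
    case (inner a' b')
    then show thesis using i assms by simp
  next
    case (leaf x' v')
    then show thesis using i assms rep_Leaf(1) by (auto simp: doubleton_eq_iff)
  qed
next
  case l: (leaf x v)
  from assms(2) show thesis
  proof (cases rule: edge_cases)
    case (inner a b)
    then show thesis using l assms rep_Leaf(1) by (auto simp: doubleton_eq_iff)
  next
    case (leaf x' v')
    then have "x = x'" using l assms(4) rep_Leaf(1) by (auto simp: doubleton_eq_iff)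
    then show thesis using l leaf that by blast
  qed
qed

lemma removed_common:
  assumes "rem v" "adj v x" "adj v y"
  shows "(if x = y then k + 1 else 3) \<le> card {u. u < v \<and> adj u x \<and> adj u y}"
  using assms adj_lt unfolding removed_def by (metis (no_types, lifting))

text \<open>A second neighbour \<open>y\<close> of \<open>v\<close> has three common neighbours with
  \<open>x\<close>, hence the colour of \<open>x\<close>. If \<open>v\<close> had the other colour,
  the cut edges to \<open>x\<close> and \<open>y\<close> would meet in \<open>v\<close>.\<close>

lemma removed_side_G:
  assumes d: "disjoint (cut E \<sigma>)" and v: "rem v" "2 \<le> dg v" and x: "adj v x"
  shows "\<sigma> v = \<sigma> x"
proof (rule ccontr)
  assume ne: "\<sigma> v \<noteq> \<sigma> x"
  have "\<not> {w. w < n \<and> adj v w} \<subseteq> {x}"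
  proof
    assume "{w. w < n \<and> adj v w} \<subseteq> {x}"
    from card_mono[OF _ this] show False using v(2) by (simp add: deg_def)
  qed
  then obtain y where y: "adj v y" "y \<noteq> x" by blast
  have "3 \<le> card {u. u < v \<and> adj u x \<and> adj u y}"
    using removed_common[OF v(1) x y(1)] y(2) by simp
  then have "\<sigma> x = \<sigma> y"
    by (rule common_nbrs_same_side[OF d]) (use adj_lt in auto)
  then have "{v, x} \<in> cut E \<sigma>" "{v, y} \<in> cut E \<sigma>" using ne x y by (auto simp: cut_edge)
  moreover have "{v, x} \<noteq> {v, y}" using y by (auto simp: doubleton_eq_iff)
  ultimately show False using disjointD[OF d] by blast
qed

text \<open>The counts in \<open>removed\<close> include smaller vertices that are removed
  themselves. Still the first \<open>?m\<close> common neighbours of \<open>x\<close> and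
  \<open>y\<close> survive, since each has fewer than \<open>?m\<close> smaller ones and so violates
  the removal condition for this pair.\<close>

lemma first_Kept:
  assumes "rem v" "adj v x" "adj v y"
  shows "(if x = y then k + 1 else 3) \<le> card {u \<in> Kept. u < v \<and> adj u x \<and> adj u y}"
proof -
  let ?m = "if x = y then k + 1 else 3"
  let ?S = "{u. u < v \<and> adj u x \<and> adj u y}"
  have "?m \<le> card ?S" using assms by (rule removed_common)
  then have "?m = card {s \<in> ?S. card {w \<in> ?S. w < s} < ?m}"
    using card_first[of ?S ?m] by simp
  also have "\<dots> \<le> card {u \<in> Kept. u < v \<and> adj u x \<and> adj u y}"
  proof (rule card_mono)
    show "finite {u \<in> Kept. u < v \<and> adj u x \<and> adj u y}"
      by (rule finite_subset[of _ "{..<v}"]) auto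
    show "{s \<in> ?S. card {w \<in> ?S. w < s} < ?m} \<subseteq> {u \<in> Kept. u < v \<and> adj u x \<and> adj u y}"
    proof
      fix s assume s: "s \<in> {s \<in> ?S. card {w \<in> ?S. w < s} < ?m}"
      then have "{w \<in> ?S. w < s} = {u. u < s \<and> adj u x \<and> adj u y}" by auto
      with s have "card {u. u < s \<and> adj u x \<and> adj u y} < ?m" "adj s x" "adj s y" "s < v" by auto
      moreover have "x < n" "y < n" "s < n" using adj_lt assms \<open>adj s x\<close> by blast+
      ultimately have "\<not> rem s" unfolding removed_def by (meson not_le)
      then show "s \<in> {u \<in> Kept. u < v \<and> adj u x \<and> adj u y}"
        using s \<open>s < n\<close> by (auto simp: Kept_def)
    qed
  qed
  finally show ?thesis .
qed

text \<open>In a kernel cut all neighbours of a removed vertex have one colour, so the vertex can be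
  put back with that colour without creating cut edges. The three witnesses are common neighbours
  that are kept.\<close>

lemma removed_side_H:
  assumes d: "disjoint (cut EK \<sigma>)" and v: "rem v" and x: "adj v x" "adj v y"
  shows "\<sigma> x = \<sigma> y"
proof (cases "x = y")
  case False
  have xy: "x \<in> Kept" "y \<in> Kept" using removed_nbr[OF v] x adj_lt hi_Kept by blast+
  have "3 \<le> card {u \<in> Kept. u < v \<and> adj u x \<and> adj u y}"
    using first_Kept[OF v x] False by simp
  then show ?thesis
    by (rule common_nbrs_same_side[OF d]) (use adj_lt xy in \<open>auto simp: EK_def\<close>)
qed simp

end

section \<open>Matching cuts of the graph and matching cuts of the kernel\<close>

context vc_instance begin

lemma matching_cut_E:
  "matching_cut {..<n} E M \<longleftrightarrow>
    disjoint M \<and> (\<exists>\<sigma>. M = cut E \<sigma> \<and> (\<exists>a\<in>{..<n}. \<exists>b\<in>{..<n}. \<sigma> a \<noteq> \<sigma> b))"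
  by (rule matching_cut_iff) (rule E_subset)

lemma matching_cut_EK:
  "matching_cut Kept EK M \<longleftrightarrow>
    disjoint M \<and> (\<exists>\<sigma>. M = cut EK \<sigma> \<and> (\<exists>a\<in>Kept. \<exists>b\<in>Kept. \<sigma> a \<noteq> \<sigma> b))"
  by (rule matching_cut_iff) (rule EK_subset)

definition R :: "nat set \<Rightarrow> nat set" where "R e = rp ` e"

definition nb :: "nat \<Rightarrow> nat" where "nb v = (THE x. adj v x)"

lemma nb:
  assumes "v \<in> Leaf"
  shows "adj v w \<longleftrightarrow> w = nb v" "hi (nb v)" "nb v \<in> Kept" "nb v \<notin> Leaf" "nb v < n" "{nb v, v} \<in> E"
    "{nb v, v} \<in> Good"
proof -
  obtain x where x: "adj v x" "hi x" "x \<in> Kept" "x \<notin> Leaf" "\<forall>w. adj v w \<longleftrightarrow> w = x"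
    using assms by (rule Leaf_nbr) blast
  then have nb: "nb v = x" unfolding nb_def by auto
  then show "adj v w \<longleftrightarrow> w = nb v" "hi (nb v)" "nb v \<in> Kept" "nb v \<notin> Leaf" "nb v < n" "{nb v, v} \<in> E"
    using x adj_lt[OF x(1)] adj_sym[OF x(1)] by auto
  then show "{nb v, v} \<in> Good" using leaf_Good assms by simp
qed

lemma edge_split:
  assumes "e \<in> E"
  obtains (inner) a b where "e = {a, b}" "a \<notin> Leaf" "b \<notin> Leaf" "R e = e" "a < n" "b < n" "a \<noteq> b"
  | (leaf) v where "e = {nb v, v}" "v \<in> Leaf" "R e = {nb v, rp v}"
  using assms
proof (cases rule: edge_cases)
  case (leaf x v)
  then show ?thesis using that(2)[of v] nb(1)[of v x] by (auto simp: R_def)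
qed (auto simp: R_def intro: that)

lemma R_EK: "e \<in> EK \<Longrightarrow> R e = e"
  using EK_Good by (simp add: R_def)

lemma R_Good: "e \<in> Good \<Longrightarrow> R e \<in> EK"
  using Good_image by (simp add: R_def)

lemma nb_rep: "v \<in> Leaf \<Longrightarrow> nb (rp v) = nb v"
  using nb(1)[of v] nb(1)[of "rp v"] rep_Leaf[of v] by metis

lemma inner_preimage:
  assumes "e \<in> E" "a \<notin> Leaf" "b \<notin> Leaf" "R e = {a, b}"
  shows "e = {a, b}"
  using assms(1)
proof (cases rule: edge_split)
  case (leaf v)
  then show ?thesis using assms rep_Leaf(1)[of v] by (auto simp: doubleton_eq_iff)
qed (use assms in auto)

lemma Good_cases:
  assumes "e \<in> E" "e \<notin> Good"
  obtains (bad) v x where "e = {v, x}" "adj v x" "rem v" "2 \<le> dg v" "v \<notin> Leaf" "v < n" "x \<in> Kept" "x \<notin> Leaf"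
  using assms(1)
proof (cases rule: edge_split)
  case (inner a b)
  have *: thesis if v: "rem v" "e = {v, x}" "v \<notin> Leaf" "x \<notin> Leaf" "v < n" for v x
  proof -
    have vx: "adj v x" using v assms by simp
    have "x \<in> Kept" using removed_nbr[OF v(1) vx] adj_lt[OF vx] hi_Kept by blast
    moreover have "dg v \<noteq> 0" using vx adj_lt[OF vx] by (auto simp: deg_def)
    moreover have "dg v \<noteq> 1" using v by (auto simp: Leaf_def removed_def)
    ultimately show thesis using bad[of v x] v vx by simp
  qed
  have "\<not> e \<subseteq> Kept" using assms EK_Good by (auto simp: EK_def)
  then show thesis
    using inner *[of a b] *[of b a] by (auto simp: Kept_def insert_commute)
next
  case (leaf v)
  then show thesis using nb[of v] assms by auto
qed

lemma R_collision:
  assumes "e \<in> E" "e' \<in> E" "e \<noteq> e'" "R e = R e'"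
  obtains v v' where "e = {nb v, v}" "e' = {nb v, v'}" "v \<in> Leaf" "v' \<in> Leaf"
proof -
  obtain x v v' where "e = {x, v}" "e' = {x, v'}" "v \<in> Leaf" "v' \<in> Leaf" "\<forall>w. adj v w \<longleftrightarrow> w = x"
    using assms(1-3) assms(4)[unfolded R_def] by (rule rep_collision) blast
  then show thesis using that nb(1)[of v x] by auto
qed

lemma inj_on_R:
  assumes "disjoint M" "M \<subseteq> E" shows "inj_on R M"
proof (rule inj_onI, rule ccontr)
  fix e e' assume e: "e \<in> M" "e' \<in> M" "R e = R e'" "e \<noteq> e'"
  then have "e \<in> E" "e' \<in> E" using assms(2) by auto
  then obtain v v' where "e = {nb v, v}" "e' = {nb v, v'}"
    using e(4,3) by (rule R_collision) blast
  then show False using disjointD[OF assms(1) e(1,2) e(4)] by blast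
qed

lemma cut_Good:
  assumes "disjoint (cut E \<sigma>)" shows "cut E \<sigma> \<subseteq> Good"
proof
  fix e assume e: "e \<in> cut E \<sigma>"
  then have "e \<in> E" by (simp add: cut_def)
  show "e \<in> Good"
  proof (rule ccontr)
    assume "e \<notin> Good"
    with \<open>e \<in> E\<close> obtain v x where "e = {v, x}" "adj v x" "rem v" "2 \<le> dg v" by (rule Good_cases) blast
    then show False using e removed_side_G[OF assms] by (auto simp: cut_edge)
  qed
qed

text \<open>Let two images share a vertex \<open>w\<close>. If \<open>w\<close> is no leaf, it was
  not moved and lies in both original edges; if it is a leaf, both images are its only edge and thus
  equal.\<close>

lemma disjoint_R:
  assumes d: "disjoint M" and M: "M \<subseteq> Good" shows "disjoint (R ` M)"
proof (rule disjointI, rule ccontr)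
  fix f f' assume f: "f \<in> R ` M" "f' \<in> R ` M" "f \<noteq> f'" "f \<inter> f' \<noteq> {}"
  then obtain e e' where e: "e \<in> M" "f = R e" "e' \<in> M" "f' = R e'" by auto
  then have "e \<inter> e' = {}" using disjointD[OF d, of e e'] f(3) by auto
  obtain w where w: "w \<in> R e" "w \<in> R e'" using f e by auto
  have E: "e \<in> E" "e' \<in> E" using e M by (auto simp: Good_def)
  have *: "w \<in> g" if "g \<in> E" "w \<in> R g" "w \<notin> Leaf" for g
    using that(1)
  proof (cases rule: edge_split)
    case (leaf v)
    then show ?thesis using that rep_Leaf(1)[of v] by auto
  qed (use that in auto)
  show False
  proof (cases "w \<in> Leaf")
    case True
    have "R g = {nb w, w}" if "g \<in> E" "w \<in> R g" for g
      using that(1)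
    proof (cases rule: edge_split)
      case (leaf v)
      then have "w = rp v" using that(2) True nb(4)[of v] by auto
      then show ?thesis using leaf nb_rep by simp
    qed (use that True in auto)
    then show False using E w f e by metis
  next
    case False
    then show False using *[OF E(1) w(1)] *[OF E(2) w(2)] \<open>e \<inter> e' = {}\<close> by blast
  qed
qed

text \<open>The colouring \<open>\<tau>\<close> copies \<open>\<sigma>\<close> except at leaves,
  which are coloured so that their edge is cut exactly when it represents a cut edge: a
  representative may have to take over the cut edge of a removed twin. For a nonempty cut both
  colours then occur on kept vertices; the empty cut is treated separately.\<close>

lemma kernel_cut_of_cut:
  assumes d: "disjoint (cut E \<sigma>)" and nc: "a < n" "b < n" "\<sigma> a \<noteq> \<sigma> b"
  shows "matching_cut Kept EK (R ` cut E \<sigma>)"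
proof -
  let ?M = "cut E \<sigma>"
  have good: "?M \<subseteq> Good" using d by (rule cut_Good)
  define \<tau> where "\<tau> v = (if v \<in> Leaf then \<sigma> (nb v) \<noteq> ({nb v, v} \<in> R ` ?M) else \<sigma> v)" for v
  have EK_E: "f \<in> EK \<Longrightarrow> f \<in> E" for f by (simp add: EK_def)
  have cut_eq: "cut EK \<tau> = R ` ?M"
  proof (intro set_eqI)
    fix f
    have "f \<in> cut EK \<tau> \<longleftrightarrow> f \<in> R ` ?M" if f: "f \<in> EK"
      using EK_E[OF f]
    proof (cases rule: edge_split)
      case (inner a b)
      have "f \<in> R ` ?M \<longleftrightarrow> f \<in> ?M"
      proof
        assume "f \<in> R ` ?M"
        then obtain e where "e \<in> ?M" "R e = f" by auto
        moreover from this have "e \<in> E" by (simp add: cut_def)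
        ultimately show "f \<in> ?M" using inner_preimage[OF _ inner(2,3), of e] inner(1) by metis
      next
        assume "f \<in> ?M"
        then have "R f \<in> R ` ?M" by (rule imageI)
        then show "f \<in> R ` ?M" using inner by simp
      qed
      also have "\<dots> \<longleftrightarrow> \<sigma> a \<noteq> \<sigma> b" using inner EK_E[OF f] by (auto simp: cut_edge)
      also have "\<dots> \<longleftrightarrow> f \<in> cut EK \<tau>" using inner f by (auto simp: cut_edge \<tau>_def)
      finally show ?thesis by simp
    next
      case (leaf v)
      have "f \<in> cut EK \<tau> \<longleftrightarrow> \<tau> (nb v) \<noteq> \<tau> v" using leaf f by (auto simp: cut_edge)
      also have "\<dots> \<longleftrightarrow> {nb v, v} \<in> R ` ?M" using leaf nb(4)[of v] by (auto simp: \<tau>_def)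
      finally show ?thesis using leaf by simp
    qed
    moreover have "R ` ?M \<subseteq> EK" using R_Good good by blast
    moreover have "cut EK \<tau> \<subseteq> EK" by (auto simp: cut_def)
    ultimately show "f \<in> cut EK \<tau> \<longleftrightarrow> f \<in> R ` ?M" by blast
  qed
  have "\<exists>\<tau>'. R ` ?M = cut EK \<tau>' \<and> (\<exists>a\<in>Kept. \<exists>b\<in>Kept. \<tau>' a \<noteq> \<tau>' b)"
  proof (cases "?M = {}")
    case False
    then obtain f where f: "f \<in> cut EK \<tau>" using cut_eq by blast
    then obtain a b where "f = {a, b}" "\<tau> a \<noteq> \<tau> b" "f \<in> EK" by (auto simp: cut_def)
    moreover have "a \<in> Kept" "b \<in> Kept" using \<open>f \<in> EK\<close> \<open>f = {a, b}\<close> by (auto simp: EK_def)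
    ultimately show ?thesis using cut_eq by blast
  next
    case True
    have same: "\<sigma> x = \<sigma> y" if "adj x y" for x y
      using True that by (auto simp: cut_edge dest: equalityD1[THEN subsetD, of _ _ "{x, y}"])
    have "\<tau> v = \<sigma> v" for v
      using True same[of v "nb v"] nb(1)[of v "nb v"] by (auto simp: \<tau>_def)
    then have \<tau>: "\<tau> = \<sigma>" by auto
    show ?thesis
    proof (cases "\<exists>a\<in>Kept. \<exists>b\<in>Kept. \<sigma> a \<noteq> \<sigma> b")
      case True
      then show ?thesis using cut_eq \<tau> by metis
    next
      case const: False
      \<comment> \<open>When no edge is cut, a removed vertex with a neighbour shares the colour of
        that kept neighbour. As the kept vertices show one colour only, the other one must sit on a
        removed isolated vertex.\<close>
      have "\<exists>v<n. rem v \<and> dg v = 0"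
      proof (rule ccontr)
        assume none: "\<not> ?thesis"
        have nbr: "\<exists>w\<in>Kept. \<sigma> v = \<sigma> w" if "v < n" for v
        proof (cases "rem v")
          case True
          then have "dg v \<noteq> 0" using none that by metis
          then have "{w. w < n \<and> adj v w} \<noteq> {}" unfolding deg_def by (intro notI) simp
          then obtain w where w: "w < n" "adj v w" by auto
          then have "w \<in> Kept" using hi_Kept[OF removed_nbr[OF True w(2)] w(1)] by simp
          then show ?thesis using same[OF w(2)] by metis
        qed (use that in \<open>auto simp: Kept_def\<close>)
        show False using nbr[OF nc(1)] nbr[OF nc(2)] nc(3) const by metis
      qed
      then obtain v where v: "v < n" "rem v" "dg v = 0" by blast
      let ?S = "{u. u < v \<and> tw u v}"
      have S: "2 \<le> card ?S" using v by (auto simp: removed_def)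
      have iso: "\<not> adj u w" if "u = v \<or> u \<in> ?S" for u w
      proof -
        have "{w. w < n \<and> adj v w} = {}" using v(3) by (simp add: deg_def)
        then have "\<not> adj v w" for w using adj_lt by blast
        then show ?thesis using that twins_adj[of u v w] by auto
      qed
      \<comment> \<open>The two least twins of \<open>v\<close> are isolated and kept, having fewer
        than two smaller twins. Separating one of them from all other vertices yields the empty cut
        with the second one on the other side.\<close>
      have "card {s \<in> ?S. card {w \<in> ?S. w < s} < 2} = 2"
        using card_first[of ?S 2] S by simp
      then obtain p q where pq: "{s \<in> ?S. card {w \<in> ?S. w < s} < 2} = {p, q}" "p \<noteq> q"
        by (auto simp: card_2_iff)
      have kept: "s \<in> Kept" if s: "s \<in> ?S" "card {w \<in> ?S. w < s} < 2" for s
      proof -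
        have tw: "tw s v" using s by simp
        have "{w \<in> ?S. w < s} = {u. u < s \<and> tw u s}"
          using s(1) tw by (auto simp: twins_def)
        then have "\<not> 2 \<le> card {u. u < s \<and> tw u s}" using s(2) by simp
        moreover have "dg s = 0" using iso[of s] s(1) by (simp add: deg_def)
        ultimately have "\<not> rem s" by (simp add: removed_def)
        then show ?thesis using s(1) v(1) by (auto simp: Kept_def)
      qed
      have "p \<in> ?S" "p \<in> Kept" "q \<in> Kept" using pq(1) kept by blast+
      have "cut EK (\<lambda>u. u = p) = {}"
      proof -
        have "p \<noteq> a \<and> p \<noteq> b" if "adj a b" for a b
          using iso[of p b] iso[of p a] \<open>p \<in> ?S\<close> that adj_sym[OF that] by auto
        then show ?thesis using EK_E unfolding cut_def by blast
      qed
      then show ?thesis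
        using True \<open>p \<in> Kept\<close> \<open>q \<in> Kept\<close> pq(2) by (intro exI[of _ "\<lambda>u. u = p"]) auto
    qed
  qed
  then show ?thesis
    using disjoint_R[OF d good] by (simp add: matching_cut_EK)
qed

text \<open>The colouring \<open>\<tau>\<close> of the kernel is extended to the removed vertices
  and adjusted at the leaves, so that among the edges with the same representative exactly the one
  chosen in \<open>M\<close>, if any, is cut.\<close>

lemma cut_of_kernel_cut:
  assumes M: "M \<subseteq> Good" "inj_on R M" and mc: "matching_cut Kept EK (R ` M)"
  shows "matching_cut {..<n} E M"
proof -
  obtain \<tau> where t: "R ` M = cut EK \<tau>" "disjoint (R ` M)" "\<exists>a\<in>Kept. \<exists>b\<in>Kept. \<tau> a \<noteq> \<tau> b"
    using mc unfolding matching_cut_EK by blast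
  have ME: "M \<subseteq> E" using M(1) by (auto simp: Good_def)
  have disj: "disjoint M"
  proof (rule disjointI, rule ccontr)
    fix e e' assume e: "e \<in> M" "e' \<in> M" "e \<noteq> e'" "e \<inter> e' \<noteq> {}"
    then have "R e \<noteq> R e'" using M(2) by (auto simp: inj_on_def)
    then have "R e \<inter> R e' = {}" using disjointD[OF t(2)] e by blast
    then show False using e(4) by (auto simp: R_def)
  qed
  \<comment> \<open>For a removed vertex that is no leaf any neighbour may be consulted, by
    \<open>removed_side_H\<close>. For an isolated vertex the value of \<open>SOME\<close> is
    arbitrary and affects no edge.\<close>
  define \<sigma> where "\<sigma> v = (if v \<in> Leaf then \<tau> (nb v) \<noteq> ({nb v, v} \<in> M)
    else if rem v then \<tau> (SOME x. adj v x) else \<tau> v)" for v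
  have cut_iff: "e \<in> cut E \<sigma> \<longleftrightarrow> e \<in> M" if e: "e \<in> E" for e
  proof (cases "e \<in> Good")
    case False
    obtain v x where v: "e = {v, x}" "adj v x" "rem v" "v \<notin> Leaf" "x \<in> Kept" "x \<notin> Leaf"
      using e False by (rule Good_cases) blast
    have "adj v (SOME x. adj v x)" using v(2) by (rule someI)
    then have "\<tau> (SOME x. adj v x) = \<tau> x"
      by (rule removed_side_H[OF t(2)[unfolded t(1)] v(3) _ v(2)])
    then have "\<sigma> v = \<sigma> x" using v by (auto simp: \<sigma>_def Kept_def)
    then show ?thesis using v False M(1) by (auto simp: cut_edge)
  next
    case good: True
    show ?thesis using e
    proof (cases rule: edge_split)
      case (inner a b)
      have "e \<in> EK" using R_Good[OF good] inner(4) by simp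
      then have "\<sigma> a = \<tau> a" "\<sigma> b = \<tau> b" using inner by (auto simp: \<sigma>_def EK_def Kept_def)
      then have "e \<in> cut E \<sigma> \<longleftrightarrow> e \<in> cut EK \<tau>" using inner e \<open>e \<in> EK\<close> by (auto simp: cut_edge)
      also have "\<dots> \<longleftrightarrow> e \<in> M"
      proof
        assume "e \<in> cut EK \<tau>"
        then have "e \<in> R ` M" using t(1) by simp
        then obtain e' where e': "e' \<in> M" "R e' = e" by (metis imageE)
        moreover from this ME have "e' \<in> E" by blast
        ultimately have "e' = e" using inner_preimage[OF _ inner(2,3), of e'] inner(1) by metis
        then show "e \<in> M" using e'(1) by simp
      next
        assume "e \<in> M"
        then have "R e \<in> R ` M" by (rule imageI)
        then have "R e \<in> cut EK \<tau>" using t(1) by simp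
        then show "e \<in> cut EK \<tau>" using inner by simp
      qed
      finally show ?thesis .
    next
      case (leaf v)
      have "\<sigma> (nb v) = \<tau> (nb v)" using nb(3,4)[of v] leaf by (auto simp: \<sigma>_def Kept_def)
      moreover have "\<sigma> v = (\<tau> (nb v) \<noteq> ({nb v, v} \<in> M))" using leaf by (simp add: \<sigma>_def)
      ultimately show ?thesis using leaf e by (auto simp: cut_edge)
    qed
  qed
  then have cut: "M = cut E \<sigma>" using ME by (auto simp: cut_def)
  have "\<exists>a\<in>{..<n}. \<exists>b\<in>{..<n}. \<sigma> a \<noteq> \<sigma> b"
  proof (cases "M = {}")
    case False
    then obtain e where "e \<in> cut E \<sigma>" using cut by blast
    then obtain a b where "{a, b} \<in> E" "\<sigma> a \<noteq> \<sigma> b" by (auto simp: cut_def)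
    then show ?thesis using adj_lt by blast
  next
    case True
    have "\<sigma> v = \<tau> v" if "v \<in> Kept" for v
    proof (cases "v \<in> Leaf")
      case leaf: True
      then have "{nb v, v} \<in> EK" using nb(3,6)[OF leaf] that by (simp add: EK_def)
      then have "\<tau> (nb v) = \<tau> v" using t(1) True cut_edge[of "nb v" v EK \<tau>] by simp
      then show ?thesis using leaf True by (simp add: \<sigma>_def)
    qed (use that in \<open>auto simp: \<sigma>_def Kept_def\<close>)
    then obtain a b where "a \<in> Kept" "b \<in> Kept" "\<sigma> a \<noteq> \<sigma> b" using t(3) by auto
    then show ?thesis unfolding Kept_def by blast
  qed
  then show ?thesis using disj cut matching_cut_E by blast
qed

lemma matching_cut_iff_Kept:
  "matching_cut {..<n} E M \<longleftrightarrow> M \<subseteq> Good \<and> inj_on R M \<and> matching_cut Kept EK (R ` M)"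
proof
  assume "matching_cut {..<n} E M"
  then obtain \<sigma> a b where s: "disjoint M" "M = cut E \<sigma>" "a < n" "b < n" "\<sigma> a \<noteq> \<sigma> b"
    unfolding matching_cut_E by auto
  then show "M \<subseteq> Good \<and> inj_on R M \<and> matching_cut Kept EK (R ` M)"
    using cut_Good kernel_cut_of_cut inj_on_R[of M] by (auto simp: cut_def)
qed (use cut_of_kernel_cut in blast)

definition nH :: nat where "nH = card Kept"
definition EH :: "nat set set" where "EH = (`) idx ` EK"
definition \<rho> :: "nat set \<Rightarrow> nat set" where "\<rho> e = idx ` rp ` e"

lemma finite_Kept [simp]: "finite Kept"
  by (simp add: Kept_def)

lemma idx_bij: "bij_betw idx Kept {..<nH}"
proof -
  have "idx v = card {w \<in> Kept. w < v}" if "v \<in> Kept" for v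
  proof -
    have "{u. u < v \<and> \<not> rem u} = {w \<in> Kept. w < v}" using that by (auto simp: Kept_def)
    then show ?thesis by (simp add: index_def)
  qed
  then show ?thesis
    using rank_bij[OF finite_Kept] bij_betw_cong[of Kept idx "\<lambda>v. card {w \<in> Kept. w < v}"]
    by (simp add: nH_def)
qed

lemma idx_inj: "inj_on idx Kept" and idx_image: "idx ` Kept = {..<nH}"
  using idx_bij by (auto simp: bij_betw_def)

lemma idx_edge_inj: "inj_on ((`) idx) EK"
  using idx_inj EK_subset by (intro inj_onI) (metis inj_on_image_eq_iff)

lemma \<rho>_image: "\<rho> ` M = (`) idx ` R ` M"
  by (auto simp: \<rho>_def R_def)

lemma \<rho>_Good: "\<rho> ` Good = EH"
proof -
  have "R ` Good = EK"
    using R_Good EK_Good R_EK by (metis (no_types, lifting) image_iff image_subsetI subsetI subset_antisym)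
  then show ?thesis by (simp add: \<rho>_image EH_def)
qed

lemma \<rho>_eq_iff: "e \<in> Good \<Longrightarrow> e' \<in> Good \<Longrightarrow> \<rho> e = \<rho> e' \<longleftrightarrow> R e = R e'"
  using inj_on_eq_iff[OF idx_edge_inj R_Good R_Good] by (simp add: \<rho>_def R_def)

lemma matching_cut_iff_kernel:
  "matching_cut {..<n} E M \<longleftrightarrow> M \<subseteq> Good \<and> inj_on \<rho> M \<and> matching_cut {..<nH} EH (\<rho> ` M)"
proof -
  have "inj_on \<rho> M \<longleftrightarrow> inj_on R M" if "M \<subseteq> Good"
    using that by (intro inj_on_cong_eq) (meson \<rho>_eq_iff subsetD)
  moreover have "matching_cut {..<nH} EH (\<rho> ` M) \<longleftrightarrow> matching_cut Kept EK (R ` M)" if "M \<subseteq> Good"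
  proof -
    have "R ` M \<subseteq> EK" using that R_Good by blast
    from matching_cut_image[OF idx_inj EK_subset this] show ?thesis
      by (simp add: \<rho>_image EH_def idx_image)
  qed
  ultimately show ?thesis using matching_cut_iff_Kept by blast
qed

lemma minimal_matching_cut_iff_kernel:
  "minimal_matching_cut {..<n} E M \<longleftrightarrow>
     M \<subseteq> Good \<and> inj_on \<rho> M \<and> minimal_matching_cut {..<nH} EH (\<rho> ` M)"
  unfolding minimal_matching_cut_def
  by (rule transversal_extremal(1)[OF matching_cut_iff_kernel])
    (simp add: \<rho>_Good matching_cut_subset)

lemma maximal_matching_cut_iff_kernel:
  "maximal_matching_cut {..<n} E M \<longleftrightarrow>
     M \<subseteq> Good \<and> inj_on \<rho> M \<and> maximal_matching_cut {..<nH} EH (\<rho> ` M)"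
  unfolding maximal_matching_cut_def
  by (rule transversal_extremal(2)[OF matching_cut_iff_kernel])
    (simp add: \<rho>_Good matching_cut_subset)

text \<open>Two edges over \<open>f\<close> are pendant at leaves. Separating such a leaf
  \<open>v\<close> from everything else is a matching cut consisting of its edge \<open>e\<close>
  alone; its image \<open>{f}\<close> is a kernel cut inside \<open>s\<close>, so minimality
  applies.\<close>

lemma minimal_cut_with_two_lifts:
  assumes s: "minimal_matching_cut {..<nH} EH s" "f \<in> s"
    and e: "e \<in> Good" "e' \<in> Good" "e \<noteq> e'" "\<rho> e = f" "\<rho> e' = f"
  shows "s = {f}"
proof -
  have E: "e \<in> E" "e' \<in> E" using e by (auto simp: Good_def)
  have "R e = R e'" using \<rho>_eq_iff[OF e(1,2)] e(4,5) by simp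
  with E e(3) obtain v v' where v: "e = {nb v, v}" "v \<in> Leaf" by (rule R_collision) blast
  have "cut E (\<lambda>u. u = v) = {e}"
  proof -
    have "{a, b} \<in> E \<and> (a = v) \<noteq> (b = v) \<longleftrightarrow> {a, b} = e" for a b
    proof
      assume ab: "{a, b} \<in> E \<and> (a = v) \<noteq> (b = v)"
      then show "{a, b} = e" using nb(1)[OF v(2), of a] nb(1)[OF v(2), of b] v(1)
        by (auto simp: insert_commute)
    next
      assume "{a, b} = e"
      then show "{a, b} \<in> E \<and> (a = v) \<noteq> (b = v)"
        using v E(1) adj_lt[of "nb v" v] by (auto simp: doubleton_eq_iff insert_commute)
    qed
    moreover have "\<exists>a b. e = {a, b}" using v by blast
    ultimately show ?thesis unfolding cut_def by blast
  qed
  moreover have "nb v \<noteq> v" "v < n" "nb v < n" using nb[OF v(2)] v(2) by (auto simp: Leaf_def)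
  ultimately have "matching_cut {..<n} E {e}"
    unfolding matching_cut_E by (intro conjI exI[of _ "\<lambda>u. u = v"]) auto
  then have "matching_cut {..<nH} EH {f}" using matching_cut_iff_kernel[of "{e}"] e by simp
  then show ?thesis using s unfolding minimal_matching_cut_def by blast
qed

end

section \<open>Vertex cover number and size of the kernel\<close>

lemma vertex_cover_number_le: "vertex_cover V E X \<Longrightarrow> vertex_cover_number V E \<le> card X"
  unfolding vertex_cover_number_def by (rule Least_le) blast

lemma vertex_cover_number_attained:
  assumes "simple_graph V E"
  obtains X where "vertex_cover V E X" "card X = vertex_cover_number V E"
proof -
  have "vertex_cover V E V"
    using assms unfolding vertex_cover_def simple_graph_def by (auto simp: card_2_iff)
  then show thesis
    using LeastI[of "\<lambda>k. \<exists>X. vertex_cover V E X \<and> card X = k" "card V"] that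
    unfolding vertex_cover_number_def by blast
qed

lemma card_UN_le_mult:
  assumes "finite I" "card I \<le> m" "\<And>i. i \<in> I \<Longrightarrow> card (F i) \<le> b"
  shows "card (\<Union>i\<in>I. F i) \<le> m * b"
proof -
  have "card (\<Union>i\<in>I. F i) \<le> (\<Sum>i\<in>I. card (F i))" using assms(1) by (rule card_UN_le)
  also have "\<dots> \<le> card I * b" using assms(3) sum_bounded_above[of I "\<lambda>i. card (F i)" b] by simp
  also have "\<dots> \<le> m * b" using assms(2) by simp
  finally show ?thesis .
qed

context vc_instance begin

lemma simple_graph_kernel: "simple_graph {..<nH} EH"
  unfolding simple_graph_def
proof (intro conjI ballI)
  fix f assume "f \<in> EH"
  then obtain e where e: "e \<in> EK" "f = idx ` e" by (auto simp: EH_def)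
  have "e \<subseteq> Kept" using e(1) by (rule EK_subset)
  then show "f \<subseteq> {..<nH}" using idx_image e(2) by blast
  have "card e = 2" using e(1) simple by (auto simp: EK_def simple_graph_def)
  then show "card f = 2"
    using e(2) card_image[OF inj_on_subset[OF idx_inj \<open>e \<subseteq> Kept\<close>]] by simp
qed simp

text \<open>A cover of the graph restricts to the kernel. Conversely, pull a minimum cover of the
  kernel back to \<open>Z\<close>; the first half gives \<open>card Z \<le> k\<close>. A neighbour
  \<open>x\<close> of a removed vertex lies in \<open>Z\<close>, as otherwise its
  \<open>k + 1\<close> kept neighbours would all have to. Hence \<open>Z\<close> also covers the
  deleted edges.\<close>

lemma vertex_cover_number_kernel: "vertex_cover_number {..<nH} EH = k"
proof (rule antisym)
  obtain X where X: "vertex_cover {..<n} E X" "card X = k"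
    using vertex_cover_number_attained[OF simple] k by metis
  have fin: "finite X" using X(1) by (auto simp: vertex_cover_def intro: finite_subset)
  have "vertex_cover {..<nH} EH (idx ` (X \<inter> Kept))"
    unfolding vertex_cover_def
  proof (intro conjI ballI)
    show "idx ` (X \<inter> Kept) \<subseteq> {..<nH}" using idx_image by blast
    fix f assume "f \<in> EH"
    then obtain e where e: "e \<in> EK" "f = idx ` e" by (auto simp: EH_def)
    then have "e \<inter> X \<noteq> {}" using X(1) by (simp add: vertex_cover_def EK_def)
    then obtain w where "w \<in> e" "w \<in> X" by blast
    moreover from this e have "w \<in> Kept" by (auto simp: EK_def)
    ultimately show "f \<inter> idx ` (X \<inter> Kept) \<noteq> {}" using e(2) by blast
  qed
  then have "vertex_cover_number {..<nH} EH \<le> card (idx ` (X \<inter> Kept))"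
    by (rule vertex_cover_number_le)
  also have "\<dots> \<le> card X" using fin by (meson card_image_le card_mono finite_Int inf_le1 order_trans)
  finally show le: "vertex_cover_number {..<nH} EH \<le> k" using X(2) by simp
  obtain Y where Y: "vertex_cover {..<nH} EH Y" "card Y = vertex_cover_number {..<nH} EH"
    by (rule vertex_cover_number_attained[OF simple_graph_kernel])
  define Z where "Z = {z \<in> Kept. idx z \<in> Y}"
  have "idx ` Z = Y"
    using Y(1) idx_image by (auto simp: Z_def vertex_cover_def)
  moreover have "inj_on idx Z" using idx_inj by (rule inj_on_subset) (auto simp: Z_def)
  ultimately have cZ: "card Z = vertex_cover_number {..<nH} EH" using Y(2) card_image by metis
  have finZ: "finite Z" by (auto simp: Z_def)
  have cover: "e \<inter> Z \<noteq> {}" if "e \<in> EK" for e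
  proof -
    have "idx ` e \<inter> Y \<noteq> {}" using Y(1) that by (auto simp: vertex_cover_def EH_def)
    then obtain w where "w \<in> e" "idx w \<in> Y" by blast
    then show ?thesis using EK_subset[OF that] by (auto simp: Z_def)
  qed
  have *: "x \<in> Z" if v: "rem v" "adj v x" for v x
  proof (rule ccontr)
    assume "x \<notin> Z"
    have "hi x" using v by (rule removed_nbr)
    then have "x \<in> Kept" using hi_Kept adj_lt[OF v(2)] by blast
    let ?S = "{u \<in> Kept. u < v \<and> adj u x}"
    have "?S \<subseteq> Z"
    proof
      fix u assume "u \<in> ?S"
      then have "{u, x} \<in> EK" using \<open>x \<in> Kept\<close> by (simp add: EK_def)
      then show "u \<in> Z" using cover[of "{u, x}"] \<open>x \<notin> Z\<close> by simp
    qed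
    then have "card ?S \<le> card Z" using finZ by (rule card_mono[rotated])
    moreover have "k + 1 \<le> card ?S" using first_Kept[OF v v(2)] by simp
    ultimately show False using cZ le by simp
  qed
  have "vertex_cover {..<n} E Z"
    unfolding vertex_cover_def
  proof (intro conjI ballI)
    show "Z \<subseteq> {..<n}" by (auto simp: Z_def Kept_def)
    fix e assume e: "e \<in> E"
    show "e \<inter> Z \<noteq> {}"
    proof (cases "e \<in> EK")
      case False
      obtain a b where ab: "e = {a, b}" "adj a b" "a < n" "b < n" using e by (rule edgeE)
      then have "rem a \<or> rem b" using False e by (auto simp: EK_def Kept_def)
      then show ?thesis using ab *[of a b] *[of b a] adj_sym[OF ab(2)] by auto
    qed (rule cover)
  qed
  then show "k \<le> vertex_cover_number {..<nH} EH"
    using vertex_cover_number_le cZ k by metis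
qed

lemma few_first_twins:
  assumes "\<And>u v. u \<in> S \<Longrightarrow> v \<in> S \<Longrightarrow> tw u v" "finite S"
  shows "card {v \<in> S. card {u. u < v \<and> tw u v} < 2} \<le> 2"
proof -
  have "{v \<in> S. card {u. u < v \<and> tw u v} < 2} \<subseteq> {s \<in> S. card {w \<in> S. w < s} < 2}"
  proof
    fix v assume v: "v \<in> {v \<in> S. card {u. u < v \<and> tw u v} < 2}"
    have "card {w \<in> S. w < v} \<le> card {u. u < v \<and> tw u v}"
      using v assms by (intro card_mono) auto
    then show "v \<in> {s \<in> S. card {w \<in> S. w < s} < 2}" using v by auto
  qed
  from card_mono[OF _ this] show ?thesis using card_first[OF assms(2), of 2] assms(2) by simp
qed

text \<open>Fix a minimum vertex cover \<open>X\<close>. A kept vertex lies in \<open>X\<close>, or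
  is adjacent to a non-high member of \<open>X\<close> (at most \<open>k * k\<close>), or is low and
  violates a removal condition: it is one of the first two isolated vertices (2), one of the first
  two leaves at a vertex of \<open>X\<close> (\<open>2 * k\<close>), one of the first
  \<open>k + 1\<close> neighbours of a vertex of \<open>X\<close> (\<open>k * (k + 1)\<close>), or
  one of the first three common neighbours of a pair from \<open>X\<close>
  (\<open>3 * k * k\<close>).\<close>

lemma kernel_size: "nH \<le> 5 * k * k + 4 * k + 2"
proof -
  obtain X where X: "vertex_cover {..<n} E X" "card X = k"
    using vertex_cover_number_attained[OF simple] k by metis
  have fin: "finite X" using X(1) by (auto simp: vertex_cover_def intro: finite_subset)
  have cover: "a \<in> X \<or> b \<in> X" if "adj a b" for a b
    using X(1) that by (auto simp: vertex_cover_def)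
  have hiX: "x \<in> X" if "hi x" for x
  proof (rule ccontr)
    assume "x \<notin> X"
    then have "{w. w < n \<and> adj x w} \<subseteq> X" using cover by blast
    from card_mono[OF fin this] show False using that X(2) by (simp add: high_def deg_def)
  qed
  let ?A = "\<Union>x\<in>{x \<in> X. \<not> hi x}. {w. w < n \<and> adj x w}"
  let ?F = "\<lambda>S. {v \<in> S. card {u. u < v \<and> tw u v} < 2}"
  let ?B0 = "?F {v. v < n \<and> dg v = 0}"
  let ?B1 = "\<Union>x\<in>X. ?F {v \<in> Leaf. nb v = x}"
  let ?S = "\<lambda>x y. {u. u < n \<and> adj u x \<and> adj u y}"
  let ?C = "\<lambda>x y m. {u \<in> ?S x y. card {w \<in> ?S x y. w < u} < m}"
  let ?C1 = "\<Union>x\<in>X. ?C x x (k + 1)"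
  let ?C2 = "\<Union>(x, y)\<in>X \<times> X. ?C x y 3"
  have "Kept \<subseteq> X \<union> (?A \<union> (?B0 \<union> (?B1 \<union> (?C1 \<union> ?C2))))"
  proof
    fix v assume "v \<in> Kept"
    then have v: "v < n" "\<not> rem v" by (auto simp: Kept_def)
    have small: "v \<in> ?C x y m" if "\<not> m \<le> card {u. u < v \<and> adj u x \<and> adj u y}" "adj v x" "adj v y" for x y m
    proof -
      have "{w \<in> ?S x y. w < v} = {u. u < v \<and> adj u x \<and> adj u y}" using v(1) by auto
      then show ?thesis using that v(1) by simp
    qed
    show "v \<in> X \<union> (?A \<union> (?B0 \<union> (?B1 \<union> (?C1 \<union> ?C2))))"
    proof (cases "lo v")
      case False
      then show ?thesis
      proof (cases "hi v")
        case True
        then show ?thesis using hiX by simp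
      next
        case nhi: False
        then obtain w where w: "w < n" "adj v w" "\<not> hi w" using False by (auto simp: low_def)
        then have "v \<in> X \<or> w \<in> X" using cover by simp
        then show ?thesis using w v(1) adj_sym[OF w(2)] by auto
      qed
    next
      case True
      then consider "dg v \<le> 1" "card {u. u < v \<and> tw u v} < 2"
        | x y where "adj v x" "adj v y" "\<not> (if x = y then k + 1 else 3) \<le> card {u. u < v \<and> adj u x \<and> adj u y}"
        using v(2) unfolding removed_def by (meson not_le)
      then show ?thesis
      proof cases
        case 1
        show ?thesis
        proof (cases "dg v = 0")
          case True
          then show ?thesis using 1 v(1) by simp
        next
          case False
          then have "v \<in> Leaf" using 1(1) \<open>lo v\<close> v(1) by (simp add: Leaf_def)
          then show ?thesis using 1(2) hiX[OF nb(2)] by blast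
        qed
      next
        case (2 x y)
        have "hi x" "hi y" using \<open>lo v\<close> 2 adj_lt by (auto simp: low_def)
        then have "x \<in> X" "y \<in> X" using hiX by auto
        then show ?thesis using small[OF 2(3,1,2)] by (cases "x = y") auto
      qed
    qed
  qed
  moreover have "finite (X \<union> (?A \<union> (?B0 \<union> (?B1 \<union> (?C1 \<union> ?C2)))))"
    using fin by (rule_tac finite_subset[of _ "X \<union> {..<n}"]) (auto simp: Leaf_def)
  ultimately have "card Kept \<le> card (X \<union> (?A \<union> (?B0 \<union> (?B1 \<union> (?C1 \<union> ?C2)))))"
    by (rule card_mono[rotated])
  also have "\<dots> \<le> card X + (card ?A + (card ?B0 + (card ?B1 + (card ?C1 + card ?C2))))"
    by (intro order_trans[OF card_Un_le] add_mono order_refl)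
  also have "\<dots> \<le> k + (k * k + (2 + (k * 2 + (k * (k + 1) + k * k * 3))))"
  proof (intro add_mono)
    show "card ?A \<le> k * k"
      using fin X(2) by (intro card_UN_le_mult) (auto simp: high_def deg_def intro: card_mono)
    show "card ?B0 \<le> 2"
    proof (rule few_first_twins)
      have "\<not> adj u w" if "dg u = 0" for u w
      proof
        assume "adj u w"
        then have "w \<in> {w. w < n \<and> adj u w}" using adj_lt by blast
        then show False using that by (auto simp: deg_def)
      qed
      then show "tw u v" if "u \<in> {v. v < n \<and> dg v = 0}" "v \<in> {v. v < n \<and> dg v = 0}" for u v
        using that unfolding twins_def by blast
    qed simp
    show "card ?B1 \<le> k * 2"
    proof (intro card_UN_le_mult few_first_twins)
      show "tw u v" if "u \<in> {v \<in> Leaf. nb v = x}" "v \<in> {v \<in> Leaf. nb v = x}" for u v x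
        using that nb(1) by (simp add: twins_def)
      show "finite {v \<in> Leaf. nb v = x}" for x
        by (rule finite_subset[of _ "{..<n}"]) (auto simp: Leaf_def)
    qed (use fin X in auto)
    show "card ?C1 \<le> k * (k + 1)"
      using fin X(2) card_first[of "?S x x" "k + 1" for x] by (intro card_UN_le_mult) auto
    have "card (?C x y 3) \<le> 3" for x y using card_first[of "?S x y" 3] by simp
    then show "card ?C2 \<le> k * k * 3"
      using fin X(2) by (intro card_UN_le_mult) auto
  qed (use X in auto)
  finally show ?thesis by (simp add: nH_def algebra_simps)
qed

end

section \<open>The programs\<close>

definition g_n :: "val \<Rightarrow> nat" where "g_n G = vnat (vfst G)"
definition g_edges :: "val \<Rightarrow> val" where "g_edges G = vfst (vsnd G)"
definition g_k :: "val \<Rightarrow> nat" where "g_k G = vnat (vsnd (vsnd G))"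

definition g_adj :: "val \<Rightarrow> nat \<Rightarrow> nat \<Rightarrow> bool" where
  "g_adj G u w \<longleftrightarrow> (\<exists>e\<in>set (vlist (g_edges G)).
     (vnat (vfst e) = u \<and> vnat (vsnd e) = w) \<or> (vnat (vfst e) = w \<and> vnat (vsnd e) = u))"

lemma ptime_g_n: "ptime g \<Longrightarrow> ptime_nat (\<lambda>v. g_n (g v))"
  and ptime_g_k: "ptime g \<Longrightarrow> ptime_nat (\<lambda>v. g_k (g v))"
  and ptime_g_edges: "ptime g \<Longrightarrow> ptime (\<lambda>v. g_edges (g v))"
  unfolding g_n_def g_k_def g_edges_def by (intro ptime_intros; assumption)+

lemma ptime_g_adj:
  assumes g: "ptime g" and u: "ptime_nat u" and w: "ptime_nat w"
  shows "ptime_bool (\<lambda>v. g_adj (g v) (u v) (w v))"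
  unfolding g_adj_def
  by (intro ptime_intros ptime_g_edges ptime_compose[OF g] ptime_nat_comp[OF u] ptime_nat_comp[OF w] g)

lemma ptime_deg:
  assumes g: "ptime g" and u: "ptime_nat u"
  shows "ptime_nat (\<lambda>v. deg (g_n (g v)) (g_adj (g v)) (u v))"
  unfolding deg_def
  by (intro ptime_intros ptime_g_n ptime_g_adj ptime_compose[OF g] ptime_nat_comp[OF u] g)

lemma ptime_high: "ptime g \<Longrightarrow> ptime_nat u \<Longrightarrow>
    ptime_bool (\<lambda>v. high (g_n (g v)) (g_k (g v)) (g_adj (g v)) (u v))"
  unfolding high_def by (intro ptime_intros ptime_g_k ptime_deg)

lemma ptime_low:
  assumes g: "ptime g" and u: "ptime_nat u"
  shows "ptime_bool (\<lambda>v. low (g_n (g v)) (g_k (g v)) (g_adj (g v)) (u v))"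
  unfolding low_def
  by (intro ptime_intros ptime_g_n ptime_high ptime_g_adj ptime_compose[OF g] ptime_nat_comp[OF u] g u)

lemma ptime_twins:
  assumes g: "ptime g" and u: "ptime_nat u" and w: "ptime_nat w"
  shows "ptime_bool (\<lambda>v. twins (g_n (g v)) (g_adj (g v)) (u v) (w v))"
  unfolding twins_def
  by (intro ptime_intros ptime_g_n ptime_g_adj ptime_compose[OF g] ptime_nat_comp[OF u] ptime_nat_comp[OF w] g)

lemma ptime_removed:
  assumes g: "ptime g" and u: "ptime_nat u"
  shows "ptime_bool (\<lambda>v. removed (g_n (g v)) (g_k (g v)) (g_adj (g v)) (u v))"
  unfolding removed_def
  by (intro ptime_intros ptime_g_n ptime_g_k ptime_low ptime_deg ptime_twins ptime_g_adj
      ptime_compose[OF g] ptime_nat_comp[OF u] g u)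

lemma ptime_index:
  assumes g: "ptime g" and u: "ptime_nat u"
  shows "ptime_nat (\<lambda>v. index (g_n (g v)) (g_k (g v)) (g_adj (g v)) (u v))"
  unfolding index_def by (intro ptime_intros ptime_removed ptime_compose[OF g] ptime_nat_comp[OF u] g u)

lemma ptime_nat_Suc: "ptime_nat f \<Longrightarrow> ptime_nat (\<lambda>v. Suc (f v))"
  using ptime_nat_add[OF _ ptime_nat_const[of 1]] by simp

lemma ptime_rep:
  assumes g: "ptime g" and u: "ptime_nat u"
  shows "ptime_nat (\<lambda>v. rep (g_n (g v)) (g_k (g v)) (g_adj (g v)) (u v))"
  unfolding rep_def
  by (intro ptime_intros ptime_removed ptime_deg ptime_g_n ptime_twins ptime_nat_Suc
      ptime_compose[OF g] ptime_nat_comp[OF u] g u)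

definition kernel_code :: "val \<Rightarrow> val" where
  "kernel_code G = (let r = removed (g_n G) (g_k G) (g_adj G); i = index (g_n G) (g_k G) (g_adj G) in
     P (N (card {v. v < g_n G \<and> \<not> r v}))
       (P (enc_list (map (\<lambda>e. P (N (i (vnat (vfst e)))) (N (i (vnat (vsnd e)))))
            (filter (\<lambda>e. \<not> r (vnat (vfst e)) \<and> \<not> r (vnat (vsnd e))) (vlist (g_edges G)))))
          (N (g_k G))))"

lemma ptime_kernel_code: "ptime kernel_code"
proof -
  have "ptime (\<lambda>G. kernel_code G)"
    unfolding kernel_code_def Let_def
    by (intro ptime_intros ptime_g_n ptime_g_k ptime_g_edges ptime_removed ptime_index)
  then show ?thesis by simp
qed

text \<open>Decides on codes whether \<open>e\<close> is in \<open>Good\<close> and lies over the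
  kernel edge \<open>f\<close>. Both orientations are compared, because moving an endpoint to its
  least twin may reverse the order of the endpoints.\<close>

definition option_code :: "val \<Rightarrow> val \<Rightarrow> val \<Rightarrow> bool" where
  "option_code G f e =
     (let r = removed (g_n G) (g_k G) (g_adj G); i = index (g_n G) (g_k G) (g_adj G);
        rp = rep (g_n G) (g_k G) (g_adj G); a = rp (vnat (vfst e)); b = rp (vnat (vsnd e))
      in \<not> r a \<and> \<not> r b \<and> ((i a = vnat (vfst f) \<and> i b = vnat (vsnd f)) \<or>
        (i a = vnat (vsnd f) \<and> i b = vnat (vfst f))))"

lemma ptime_option_code:
  assumes g: "ptime g" and f: "ptime f" and e: "ptime e"
  shows "ptime_bool (\<lambda>v. option_code (g v) (f v) (e v))"
  unfolding option_code_def Let_def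
  by (intro ptime_intros ptime_removed ptime_index ptime_rep assms)

definition options_code :: "val \<Rightarrow> val list list" where
  "options_code v = map (\<lambda>f. filter (option_code (vfst v) f) (vlist (g_edges (vfst v))))
     (vlist (vsnd (vsnd v)))"

lemma ptime_options_code: "ptime (\<lambda>v. enc_list (map enc_list (options_code v)))"
  unfolding options_code_def map_map comp_def
  by (intro ptime_intros ptime_option_code ptime_g_edges)

text \<open>A choice lists its edges in the order of the kernel cut, not in their own order.
  Filtering the sorted edge list of the graph by membership yields the canonical code.\<close>

definition choice_code :: "val \<Rightarrow> val \<Rightarrow> val" where
  "choice_code v h = enc_list (filter (\<lambda>e. \<exists>c\<in>set (vlist h).
     vnat (vfst c) = vnat (vfst e) \<and> vnat (vsnd c) = vnat (vsnd e)) (vlist (g_edges (vfst v))))"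

lemma ptime_choice_code: "ptime (\<lambda>p. choice_code (vfst p) (vsnd p))"
  unfolding choice_code_def by (intro ptime_intros ptime_g_edges)

lemma runs_function:
  assumes "ptime f"
  obtains c :: com and p :: "nat poly" where
    "\<And>v. \<exists>tr. runs c v tr \<and> outputs tr = [f v] \<and> length tr \<le> poly p (vsize v)"
proof -
  obtain d p where d: "computes d f p" using assms unfolding ptime_def by blast
  let ?c = "Seq (Call 0 d (Var 0)) (Output (Var 0))"
  show thesis
  proof (rule that[of ?c "[:2:] + p + p"])
    fix v
    let ?s = "(init v)(0 := f v)"
    obtain t where t: "steps (Call 0 d (Var 0)) (init v) t ?s" "t \<le> Suc (poly p (vsize v))"
      using computes_Call[OF d, of 0 "Var 0" "init v"] by (auto simp: init_def)
    have "exec ?c (init v) (replicate t Tick @ (replicate (vsize (f v)) Tick @ [Out (f v)])) ?s"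
      using exec.Seq[OF t(1)[unfolded steps_def] exec.Output[of "Var 0" ?s]] by simp
    then show "\<exists>tr. runs ?c v tr \<and> outputs tr = [f v] \<and> length tr \<le> poly ([:2:] + p + p) (vsize v)"
      unfolding runs_def using t(2) computes_size[OF d, of v] by fastforce
  qed
qed

lemma computable_poly: "computable_nat_fun (poly p)"
proof -
  have "ptime (\<lambda>v. N (poly p (vnat v)))"
    by (intro ptime_nat_N ptime_nat_poly ptime_nat_vnat ptime_id)
  then obtain c :: com and q :: "nat poly" where
    c: "\<And>v. \<exists>tr. runs c v tr \<and> outputs tr = [N (poly p (vnat v))] \<and> length tr \<le> poly q (vsize v)"
    by (rule runs_function) blast
  then have "\<exists>tr. runs c (N n) tr \<and> outputs tr = [N (poly p n)]" for n
    using c[of "N n"] by auto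
  then show ?thesis unfolding computable_nat_fun_def by blast
qed

section \<open>Correctness of the programs\<close>

lemma mem_choices_filter:
  "c \<in> set (choices (map (\<lambda>f. filter (\<lambda>q. g q \<and> \<tau> q = f) L) fs)) \<longleftrightarrow>
     set c \<subseteq> {q \<in> set L. g q} \<and> map \<tau> c = fs"
proof (induction fs arbitrary: c)
  case (Cons f fs)
  show ?case by (cases c) (use Cons in \<open>auto simp: image_iff\<close>)
qed auto

text \<open>A choice has exactly one entry over each member of \<open>fs\<close>, so its entries
  form a transversal. As \<open>fs\<close> is distinct, \<open>\<tau>\<close> is injective on them,
  and the fixed order of \<open>fs\<close> recovers the list from its set.\<close>

lemma choices_filter:
  fixes g :: "'a \<Rightarrow> bool" and \<tau> :: "'a \<Rightarrow> 'b" and L fs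
  assumes fs: "distinct fs"
  defines "C \<equiv> set (choices (map (\<lambda>f. filter (\<lambda>q. g q \<and> \<tau> q = f) L) fs))"
  shows "set ` C = {Q. Q \<subseteq> {q \<in> set L. g q} \<and> inj_on \<tau> Q \<and> \<tau> ` Q = set fs}" and "inj_on set C"
proof -
  have C: "c \<in> C \<longleftrightarrow> set c \<subseteq> {q \<in> set L. g q} \<and> map \<tau> c = fs" for c
    unfolding C_def by (rule mem_choices_filter)
  have inj: "inj_on \<tau> (set c)" if "c \<in> C" for c
    using fs that by (auto simp: C distinct_map)
  show "inj_on set C"
  proof (rule inj_onI)
    fix c d assume "c \<in> C" "d \<in> C" "set c = set d"
    then show "c = d" using inj[of c] map_inj_on[of \<tau> c d] by (simp add: C)
  qed
  show "set ` C = {Q. Q \<subseteq> {q \<in> set L. g q} \<and> inj_on \<tau> Q \<and> \<tau> ` Q = set fs}"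
  proof (intro set_eqI iffI)
    fix Q assume "Q \<in> set ` C"
    then show "Q \<in> {Q. Q \<subseteq> {q \<in> set L. g q} \<and> inj_on \<tau> Q \<and> \<tau> ` Q = set fs}"
      using inj by (auto simp: C)
  next
    fix Q assume Q: "Q \<in> {Q. Q \<subseteq> {q \<in> set L. g q} \<and> inj_on \<tau> Q \<and> \<tau> ` Q = set fs}"
    let ?c = "map (inv_into Q \<tau>) fs"
    have "set ?c = Q" using Q inv_into_image_cancel[of \<tau> Q Q] by auto
    moreover have "map \<tau> ?c = fs"
      unfolding map_map by (rule map_idI) (use Q in \<open>auto simp: f_inv_into_f\<close>)
    ultimately show "Q \<in> set ` C" using Q C[of ?c] by (intro image_eqI[of _ _ ?c]) auto
  qed
qed

section \<open>Codes of edge sets and of graphs\<close>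

definition pair_code :: "nat \<times> nat \<Rightarrow> val" where "pair_code p = P (N (fst p)) (N (snd p))"
definition edge_list :: "nat set set \<Rightarrow> (nat \<times> nat) list" where
  "edge_list M = sorted_list_of_set {(u, v). u < v \<and> {u, v} \<in> M}"
definition und :: "nat \<times> nat \<Rightarrow> nat set" where "und p = {fst p, snd p}"

lemma enc_edges_eq: "enc_edges M = enc_list (map pair_code (edge_list M))"
proof -
  have "pair_code = (\<lambda>(u, v). P (N u) (N v))" by (auto simp: pair_code_def)
  then show ?thesis by (simp add: enc_edges_def edge_list_def)
qed

lemma pair_code_simps [simp]:
  "vnat (vfst (pair_code p)) = fst p" "vnat (vsnd (pair_code p)) = snd p"
  by (simp_all add: pair_code_def)

lemma finite_edge_pairs:
  assumes "\<And>e. e \<in> M \<Longrightarrow> e \<subseteq> {..<m::nat}"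
  shows "finite {(u, v). u < v \<and> {u, v} \<in> M}"
  by (rule finite_subset[of _ "{..<m} \<times> {..<m}"]) (use assms in auto)

lemma set_edge_list:
  assumes "\<And>e. e \<in> M \<Longrightarrow> e \<subseteq> {..<m::nat}"
  shows "set (edge_list M) = {(u, v). u < v \<and> {u, v} \<in> M}"
  using finite_edge_pairs[of M m] assms by (simp add: edge_list_def)

lemma sorted_edge_list: "sorted_wrt (<) (edge_list M)"
  unfolding edge_list_def by (rule strict_sorted_list_of_set)

lemma edge_list_eqI:
  assumes "\<And>e. e \<in> M \<Longrightarrow> e \<subseteq> {..<m::nat}" "sorted_wrt (<) xs"
    "set xs = {(u, v). u < v \<and> {u, v} \<in> M}"
  shows "edge_list M = xs"
  using strict_sorted_equal[OF assms(2) sorted_edge_list] set_edge_list[of M m] assms by simp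

lemma distinct_edge_list: "distinct (edge_list M)"
  by (simp add: edge_list_def)

lemma und_image_edge_list:
  assumes "simple_graph {..<m} F" "M \<subseteq> F"
  shows "und ` set (edge_list M) = M"
proof -
  have M: "\<And>e. e \<in> M \<Longrightarrow> e \<subseteq> {..<m}" using assms by (auto simp: simple_graph_def)
  show ?thesis
  proof (intro set_eqI iffI)
    fix e assume e: "e \<in> M"
    then obtain a b where ab: "e = {a, b}" "a \<noteq> b"
      using assms by (metis simple_graph_def card_2_iff subsetD)
    show "e \<in> und ` set (edge_list M)"
    proof (cases "a < b")
      case True
      then show ?thesis using e ab set_edge_list[OF M]
        by (intro image_eqI[of _ _ "(a, b)"]) (auto simp: und_def)
    next
      case False
      then show ?thesis using e ab set_edge_list[OF M]
        by (intro image_eqI[of _ _ "(b, a)"]) (auto simp: und_def insert_commute)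
    qed
  qed (use set_edge_list[OF M] in \<open>auto simp: und_def\<close>)
qed

lemma inj_on_und: "inj_on und {p. fst p < snd p}"
  by (rule inj_onI) (auto simp: und_def doubleton_eq_iff prod_eq_iff)

lemma edge_list_ordered: "p \<in> set (edge_list M) \<Longrightarrow> fst p < snd p"
  by (cases "finite {(u, v). u < v \<and> {u, v} \<in> M}") (auto simp: edge_list_def)

lemma inj_on_und_edge_list: "inj_on und (set (edge_list M))"
  using inj_on_und by (rule inj_on_subset) (use edge_list_ordered in blast)

lemma length_le_vsize: "length xs \<le> vsize (enc_list xs)"
  by (induction xs) auto

lemma vsize_enc_list_le: "(\<And>x. x \<in> set xs \<Longrightarrow> vsize x \<le> b) \<Longrightarrow> vsize (enc_list xs) \<le> 1 + length xs * (b + 1)"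
proof (induction xs)
  case (Cons x xs)
  then have "vsize x \<le> b" "vsize (enc_list xs) \<le> 1 + length xs * (b + 1)" by auto
  then show ?case by simp
qed simp

definition graph_code :: "vc_graph \<Rightarrow> val" where
  "graph_code x = (case x of (n, E, k) \<Rightarrow> P (N n) (P (enc_edges E) (N k)))"

context vc_instance begin

lemma code_sel [simp]: "g_n (graph_code (n, E, k)) = n" "g_k (graph_code (n, E, k)) = k"
  "vlist (g_edges (graph_code (n, E, k))) = map pair_code (edge_list E)"
  by (simp_all add: graph_code_def g_n_def g_k_def g_edges_def enc_edges_eq)

lemma set_edge_list_E: "set (edge_list E) = {(u, v). u < v \<and> {u, v} \<in> E}"
  by (rule set_edge_list) (rule E_subset)

lemma code_adj [simp]: "g_adj (graph_code (n, E, k)) = adj"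
proof (intro ext)
  fix a b
  have "g_adj (graph_code (n, E, k)) a b \<longleftrightarrow> (a, b) \<in> set (edge_list E) \<or> (b, a) \<in> set (edge_list E)"
    unfolding g_adj_def by (auto simp: prod_eq_iff intro: bexI[rotated])
  also have "\<dots> \<longleftrightarrow> adj a b"
    unfolding set_edge_list_E using adj_lt[of a b] by (auto simp: insert_commute)
  finally show "g_adj (graph_code (n, E, k)) a b \<longleftrightarrow> adj a b" .
qed

lemma edge_list_subset:
  assumes "M \<subseteq> E" shows "edge_list M = filter (\<lambda>p. und p \<in> M) (edge_list E)"
proof (rule edge_list_eqI[of M n])
  show "sorted_wrt (<) (filter (\<lambda>p. und p \<in> M) (edge_list E))"
    by (intro sorted_wrt_filter sorted_edge_list)
qed (use assms E_subset in \<open>auto simp: set_edge_list_E und_def\<close>)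

lemma idx_less: "u \<in> Kept \<Longrightarrow> u < v \<Longrightarrow> idx u < idx v"
  unfolding index_def by (intro psubset_card_mono) (auto simp: Kept_def)

text \<open>On kept vertices \<open>idx\<close> is strictly increasing, so it preserves the
  orientation of pairs and their lexicographic order: renumbering the filtered list gives a list
  that is already sorted.\<close>

lemma edge_list_EH:
  "edge_list EH = map (\<lambda>p. (idx (fst p), idx (snd p)))
     (filter (\<lambda>p. \<not> rem (fst p) \<and> \<not> rem (snd p)) (edge_list E))"
proof (rule edge_list_eqI[of EH nH])
  let ?L = "filter (\<lambda>p. \<not> rem (fst p) \<and> \<not> rem (snd p)) (edge_list E)"
  let ?i = "\<lambda>p. (idx (fst p), idx (snd p))"
  have kept: "fst p \<in> Kept \<and> snd p \<in> Kept" if "p \<in> set ?L" for p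
    using that adj_lt by (auto simp: Kept_def set_edge_list_E)
  have "sorted_wrt (<) ?L" by (intro sorted_wrt_filter sorted_edge_list)
  then have "sorted_wrt (\<lambda>p q. ?i p < ?i q) ?L"
  proof (rule sorted_wrt_mono_rel[rotated])
    fix p q assume pq: "p \<in> set ?L" "q \<in> set ?L" "p < q"
    have "fst p < fst q \<or> fst p = fst q \<and> snd p < snd q"
      using pq(3) by (cases p; cases q) auto
    then show "?i p < ?i q"
      using idx_less kept[OF pq(1)] kept[OF pq(2)] by auto
  qed
  then show "sorted_wrt (<) (map ?i ?L)" by (simp add: sorted_wrt_map)
  show "set (map ?i ?L) = {(u, v). u < v \<and> {u, v} \<in> EH}"
  proof (intro set_eqI iffI)
    fix q assume "q \<in> set (map ?i ?L)"
    then obtain p where p: "p \<in> set ?L" "q = ?i p" by auto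
    have "{fst p, snd p} \<in> EK" "fst p < snd p"
      using p(1) kept[OF p(1)] by (auto simp: EK_def set_edge_list_E)
    then have "idx ` {fst p, snd p} \<in> EH" unfolding EH_def by blast
    then show "q \<in> {(u, v). u < v \<and> {u, v} \<in> EH}"
      using p idx_less kept[OF p(1)] \<open>fst p < snd p\<close> by simp
  next
    fix q assume "q \<in> {(u, v). u < v \<and> {u, v} \<in> EH}"
    then obtain u v where q: "q = (u, v)" "u < v" "{u, v} \<in> EH" by auto
    then obtain e where e: "e \<in> EK" "{u, v} = idx ` e" by (auto simp: EH_def)
    have "e \<in> und ` set (edge_list E)"
      using und_image_edge_list[OF simple order_refl] e(1) by (simp add: EK_def)
    then obtain p where p: "p \<in> set (edge_list E)" "e = {fst p, snd p}" by (auto simp: und_def)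
    have "fst p \<in> Kept" "snd p \<in> Kept" using EK_subset[OF e(1)] p(2) by auto
    then have pL: "p \<in> set ?L" using p(1) by (auto simp: Kept_def)
    have "q = ?i p"
    proof -
      have "{u, v} = {idx (fst p), idx (snd p)}" using e(2) p(2) by simp
      moreover have "idx (fst p) < idx (snd p)"
        using idx_less[OF \<open>fst p \<in> Kept\<close> edge_list_ordered[OF p(1)]] .
      ultimately show ?thesis using q(1,2) unfolding doubleton_eq_iff by auto
    qed
    then show "q \<in> set (map ?i ?L)" unfolding set_map using pL by (rule image_eqI)
  qed
qed (use simple_graph_kernel in \<open>auto simp: simple_graph_def\<close>)

lemma kernel_code: "kernel_code (graph_code (n, E, k)) = graph_code (nH, EH, k)"
proof -
  have "nH = card {v. v < n \<and> \<not> rem v}" by (simp add: nH_def Kept_def)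
  moreover have "graph_code (nH, EH, k) = P (N nH) (P (enc_edges EH) (N k))"
    by (simp add: graph_code_def)
  ultimately show ?thesis
    unfolding kernel_code_def
    by (simp add: Let_def enc_edges_eq edge_list_EH filter_map comp_def pair_code_def)
qed

definition options_list :: "nat set set \<Rightarrow> (nat \<times> nat) list list" where
  "options_list s = map (\<lambda>f. filter (\<lambda>p. und p \<in> Good \<and> \<rho> (und p) = f) (edge_list E))
     (map und (edge_list s))"

lemma options_code:
  "options_code (P (graph_code (n, E, k)) (P y (enc_edges s))) = map (map pair_code) (options_list s)"
proof -
  have "option_code (graph_code (n, E, k)) (pair_code f) (pair_code p) \<longleftrightarrow>
      und p \<in> Good \<and> \<rho> (und p) = und f" if "p \<in> set (edge_list E)" for f p
  proof -
    have p: "und p \<in> E" using that by (auto simp: set_edge_list_E und_def)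
    have "{i, j} = {a, b} \<longleftrightarrow> (i = a \<and> j = b) \<or> (i = b \<and> j = a)" for i j a b :: nat
      by (auto simp: doubleton_eq_iff)
    moreover have "rp ` und p \<subseteq> Kept \<longleftrightarrow> \<not> rem (rp (fst p)) \<and> \<not> rem (rp (snd p))"
    proof -
      have "rp v < n" if "v < n" for v
        using that rep_not_Leaf[of v] rep_Leaf(2)[of v] by (cases "v \<in> Leaf") (auto simp: Kept_def)
      then show ?thesis using E_subset[OF p] by (auto simp: und_def Kept_def)
    qed
    ultimately show ?thesis
      using p by (simp add: option_code_def Let_def Good_def \<rho>_def und_def)
  qed
  then show ?thesis
    unfolding options_code_def options_list_def
    by (simp add: enc_edges_eq filter_map comp_def cong: filter_cong)
qed

lemma choice_code:
  assumes "set c \<subseteq> set (edge_list E)"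
  shows "choice_code (P (graph_code (n, E, k)) y) (enc_list (map pair_code c)) = enc_edges (und ` set c)"
proof -
  have "(\<exists>q\<in>set c. fst q = fst p \<and> snd q = snd p) \<longleftrightarrow> und p \<in> und ` set c"
    if "p \<in> set (edge_list E)" for p
    using inj_on_image_mem_iff[OF inj_on_und_edge_list that assms] by (auto simp: prod_eq_iff)
  moreover have "und ` set c \<subseteq> E" using assms by (auto simp: set_edge_list_E und_def)
  ultimately show ?thesis
    unfolding choice_code_def
    by (simp add: enc_edges_eq edge_list_subset[OF \<open>und ` set c \<subseteq> E\<close>] filter_map comp_def cong: filter_cong)
qed

lemma enc_edges_inj:
  assumes "M \<subseteq> E" "M' \<subseteq> E" "enc_edges M = enc_edges M'" shows "M = M'"
proof -
  have "map pair_code (edge_list M) = map pair_code (edge_list M')"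
    using arg_cong[OF assms(3), of vlist] by (simp add: enc_edges_eq)
  moreover have "inj pair_code" by (auto simp: inj_def pair_code_def prod_eq_iff)
  ultimately have "edge_list M = edge_list M'" by (simp add: inj_map_eq_map)
  then show ?thesis using und_image_edge_list[OF simple] assms(1,2) by metis
qed

text \<open>No output is repeated, since a code determines the edge set, this determines the set of
  ordered pairs, and this determines the choice. No list of options is empty, since
  \<open>EH\<close> is the image of \<open>Good\<close> under \<open>\<rho>\<close>.\<close>

lemma enumerated:
  assumes "s \<subseteq> EH"
  defines "out \<equiv> map (\<lambda>c. enc_edges (und ` set c)) (choices (options_list s))"
  shows "distinct out" and "set out = enc_edges ` {M. M \<subseteq> Good \<and> inj_on \<rho> M \<and> \<rho> ` M = s}"
    and "\<forall>l\<in>set (options_list s). l \<noteq> []"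
    and "\<And>c. c \<in> set (choices (options_list s)) \<Longrightarrow> set c \<subseteq> set (edge_list E)"
proof -
  let ?L = "edge_list E" and ?fs = "map und (edge_list s)"
  have fs: "distinct ?fs" "set ?fs = s"
    using inj_on_und_edge_list distinct_edge_list und_image_edge_list[OF simple_graph_kernel assms(1)]
    by (auto simp: distinct_map)
  have opt: "options_list s = map (\<lambda>f. filter (\<lambda>p. und p \<in> Good \<and> (\<rho> \<circ> und) p = f) ?L) ?fs"
    by (simp add: options_list_def)
  note ch = choices_filter[OF fs(1), of "\<lambda>p. und p \<in> Good" "\<rho> \<circ> und" ?L, folded opt, unfolded fs(2)]
  have sub: "set c \<subseteq> {p \<in> set ?L. und p \<in> Good}" if "c \<in> set (choices (options_list s))" for c
    using that unfolding opt mem_choices_filter by simp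
  then show "\<And>c. c \<in> set (choices (options_list s)) \<Longrightarrow> set c \<subseteq> set (edge_list E)" by blast
  have und_E: "und ` set ?L = E" using und_image_edge_list[OF simple] by blast
  show "distinct out"
  proof -
    have "distinct (choices (options_list s))"
      by (rule distinct_choices) (auto simp: options_list_def distinct_edge_list)
    moreover have "inj_on (\<lambda>c. enc_edges (und ` set c)) (set (choices (options_list s)))"
    proof (rule inj_onI)
      fix c d assume c: "c \<in> set (choices (options_list s))" and d: "d \<in> set (choices (options_list s))"
        and eq: "enc_edges (und ` set c) = enc_edges (und ` set d)"
      have cd: "set c \<subseteq> set ?L" "set d \<subseteq> set ?L" using sub c d by blast+
      have "und ` set c \<subseteq> E" "und ` set d \<subseteq> E"
        using image_mono[OF cd(1), of und] image_mono[OF cd(2), of und] by (simp_all only: und_E)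
      then have "und ` set c = und ` set d" using eq by (rule enc_edges_inj)
      then have "set c = set d" using inj_on_image_eq_iff[OF inj_on_und_edge_list cd] by simp
      then show "c = d" using inj_onD[OF ch(2) _ c d] by simp
    qed
    ultimately show ?thesis by (simp add: out_def distinct_map)
  qed
  show "set out = enc_edges ` {M. M \<subseteq> Good \<and> inj_on \<rho> M \<and> \<rho> ` M = s}"
  proof -
    have "(\<lambda>Q. und ` Q) ` {Q. Q \<subseteq> {p \<in> set ?L. und p \<in> Good} \<and> inj_on (\<rho> \<circ> und) Q \<and> (\<rho> \<circ> und) ` Q = s}
        = {M. M \<subseteq> Good \<and> inj_on \<rho> M \<and> \<rho> ` M = s}" (is "?l = ?r")
    proof (intro set_eqI iffI)
      fix M assume "M \<in> ?l"
      then show "M \<in> ?r" by (auto simp: image_comp dest: inj_on_imageI)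
    next
      fix M assume M: "M \<in> ?r"
      let ?Q = "{p \<in> set ?L. und p \<in> M}"
      have "M \<subseteq> E" using M by (auto simp: Good_def)
      have "M \<subseteq> und ` ?Q"
      proof
        fix e assume "e \<in> M"
        then have "e \<in> und ` set ?L" using \<open>M \<subseteq> E\<close> und_E by auto
        then show "e \<in> und ` ?Q" using \<open>e \<in> M\<close> by auto
      qed
      then have "und ` ?Q = M" by auto
      moreover have "inj_on und ?Q" using inj_on_und_edge_list by (rule inj_on_subset) auto
      ultimately show "M \<in> ?l"
        using M comp_inj_on[of und ?Q \<rho>] image_comp[of \<rho> und ?Q]
        by (intro image_eqI[of _ _ ?Q]) auto
    qed
    then have "(\<lambda>Q. und ` Q) ` set ` set (choices (options_list s)) = ?r"
      by (simp only: ch(1))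
    then have "(\<lambda>c. und ` set c) ` set (choices (options_list s)) = ?r"
      unfolding image_image .
    moreover have "set out = enc_edges ` (\<lambda>c. und ` set c) ` set (choices (options_list s))"
      by (simp add: out_def image_image)
    ultimately show ?thesis by (simp only:)
  qed
  show "\<forall>l\<in>set (options_list s). l \<noteq> []"
  proof
    fix l assume "l \<in> set (options_list s)"
    then obtain f where f: "f \<in> s" "l = filter (\<lambda>p. und p \<in> Good \<and> \<rho> (und p) = f) ?L"
      using fs(2) unfolding options_list_def by auto
    then have "f \<in> \<rho> ` Good" using assms(1) \<rho>_Good by auto
    then obtain e where e: "e \<in> Good" "\<rho> e = f" by (metis imageE)
    then have "e \<in> E" by (simp add: Good_def)
    then have "e \<in> und ` set ?L" by (simp only: und_E)
    then obtain p where "p \<in> set ?L" "e = und p" by (metis imageE)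
    then show "l \<noteq> []" using f e by (auto simp: filter_empty_conv)
  qed
qed

text \<open>If every edge of \<open>s\<close> has at most one option, there is at most one choice.
  Otherwise \<open>s\<close> is a single edge by \<open>minimal_cut_with_two_lifts\<close>, and its
  options form a sublist of the edge list.\<close>

lemma length_choices_minimal:
  assumes "minimal_matching_cut {..<nH} EH s"
  shows "length (choices (options_list s)) \<le> 1 + length (edge_list E)"
proof -
  have s: "s \<subseteq> EH"
    using assms matching_cut_subset unfolding minimal_matching_cut_def by blast
  have und_s: "und ` set (edge_list s) = s" by (rule und_image_edge_list[OF simple_graph_kernel s])
  show ?thesis
  proof (cases "\<forall>l\<in>set (options_list s). length l \<le> 1")
    case True
    have *: "prod_list (map length ls) \<le> 1" if "\<forall>l\<in>set ls. length l \<le> 1" for ls :: "(nat \<times> nat) list list"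
      using that
    proof (induction ls)
      case (Cons l ls)
      then have "length l * prod_list (map length ls) \<le> 1 * 1" by (intro mult_le_mono) auto
      then show ?case by simp
    qed simp
    show ?thesis using *[OF True] unfolding length_choices by linarith
  next
    case False
    then obtain l where l: "l \<in> set (options_list s)" "1 < length l" by auto
    then obtain f where f: "f \<in> s" "l = filter (\<lambda>p. und p \<in> Good \<and> \<rho> (und p) = f) (edge_list E)"
      using und_s unfolding options_list_def by auto
    have "distinct l" using f(2) distinct_edge_list by simp
    then have "l ! 0 \<noteq> l ! 1" using nth_eq_iff_index_eq[of l 0 1] l(2) by linarith
    have in_l: "l ! 0 \<in> set l" "l ! 1 \<in> set l" using l(2) by (auto intro: nth_mem)
    then have L: "l ! 0 \<in> set (edge_list E)" "l ! 1 \<in> set (edge_list E)" and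
      G: "und (l ! 0) \<in> Good" "und (l ! 1) \<in> Good" "\<rho> (und (l ! 0)) = f" "\<rho> (und (l ! 1)) = f"
      using f(2) by auto
    have "und (l ! 0) \<noteq> und (l ! 1)"
      using inj_onD[OF inj_on_und_edge_list _ L] \<open>l ! 0 \<noteq> l ! 1\<close> by blast
    then have sf: "s = {f}" using minimal_cut_with_two_lifts[OF assms f(1) G(1,2) _ G(3,4)] by blast
    have "length (edge_list s) = card s"
      using und_s card_image[OF inj_on_und_edge_list[of s]] distinct_card[OF distinct_edge_list[of s]]
      by simp
    then have "length (options_list s) = 1" using sf by (simp add: options_list_def)
    then obtain l' where "options_list s = [l']" by (auto simp: length_Suc_conv)
    then have "options_list s = [l]" using l(1) by simp
    then show ?thesis using f(2) by (simp add: length_choices le_SucI)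
  qed
qed

lemma enc_size_kernel:
  "vsize (graph_code (nH, EH, k)) \<le> 5 + nH + k + nH * nH * (2 * nH + 4)"
proof -
  have sub: "set (edge_list EH) \<subseteq> {..<nH} \<times> {..<nH}"
    using set_edge_list[of EH nH] simple_graph_kernel by (auto simp: simple_graph_def)
  have "length (edge_list EH) = card (set (edge_list EH))"
    using distinct_edge_list by (simp add: distinct_card)
  also have "\<dots> \<le> nH * nH" using card_mono[OF _ sub] by simp
  finally have len: "length (edge_list EH) \<le> nH * nH" .
  \<comment> \<open>A pair of numbers below \<open>nH\<close> has size at most
    \<open>2 * nH + 3\<close>, and each list cell adds one.\<close>
  have "vsize (enc_edges EH) \<le> 1 + length (map pair_code (edge_list EH)) * ((2 * nH + 3) + 1)"
    unfolding enc_edges_eq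
    by (rule vsize_enc_list_le) (use sub in \<open>force simp: pair_code_def\<close>)
  also have "\<dots> \<le> 1 + nH * nH * ((2 * nH + 3) + 1)"
    by (intro add_left_mono mult_le_mono1) (use len in simp)
  also have "(2 * nH + 3) + 1 = 2 * nH + 4" by simp
  finally show ?thesis by (simp add: graph_code_def)
qed

text \<open>The time bounds in \<open>enum_kernel\<close> do not mention the size of the kernel
  solution, although it is part of the input of \<open>A'\<close>. Its code has to be bounded
  through that of the kernel.\<close>

lemma vsize_enc_edges_kernel: "s \<subseteq> EH \<Longrightarrow> vsize (enc_edges s) \<le> vsize (enc_edges EH)"
proof -
  \<comment> \<open>The kernel is itself an instance, so the description of codes of edge subsets is
    available for \<open>EH\<close>.\<close>
  interpret H: vc_instance nH EH "vertex_cover_number {..<nH} EH"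
    by unfold_locales (simp_all add: simple_graph_kernel)
  assume "s \<subseteq> EH"
  have *: "vsize (enc_list (map h (filter c xs))) \<le> vsize (enc_list (map h xs))" for h c and xs :: "(nat \<times> nat) list"
    by (induction xs) auto
  show ?thesis
    unfolding enc_edges_eq H.edge_list_subset[OF \<open>s \<subseteq> EH\<close>] by (rule *)
qed

end

lemma map_choices: "choices (map (map f) ls) = map (map f) (choices ls)"
  by (induction ls) (auto simp: map_concat comp_def)

section \<open>The kernels\<close>

definition kernel_graph :: "vc_graph \<Rightarrow> vc_graph" where
  "kernel_graph x = (case x of (n, E, k) \<Rightarrow> (vc_instance.nH n E k, vc_instance.EH n E k, k))"

definition compressed :: "vc_graph \<Rightarrow> nat set set \<Rightarrow> nat set set" where
  "compressed x M = (case x of (n, E, k) \<Rightarrow> vc_instance.\<rho> n E k ` M)"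

lemma cut_enum_problem_simps [simp]:
  "x \<in> instances (cut_enum_problem is_sol) \<longleftrightarrow> (case x of (n, E, k) \<Rightarrow> vc_instance n E k)"
  "solutions (cut_enum_problem is_sol) (n, E, k) = {M. is_sol {..<n} E M}"
  "param (cut_enum_problem is_sol) (n, E, k) = k"
  "enc_inst (cut_enum_problem is_sol) = graph_code"
  "enc_sol (cut_enum_problem is_sol) = enc_edges"
  "inst_size (cut_enum_problem is_sol) x = vsize (graph_code x)"
  by (auto simp: cut_enum_problem_def vc_instance_def graph_code_def[abs_def] inst_size_def
      split: prod.splits)

lemma quadratic_kernel:
  "quadratic_vertices (cut_enum_problem is_sol) kernel_graph"
  unfolding quadratic_vertices_def
proof (intro exI conjI ballI)
  show "(\<lambda>k::nat. real (5 * k * k + 4 * k + 2)) \<in> O(\<lambda>k. real k ^ 2)"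
  \<comment> \<open>For \<open>k \<ge> 1\<close> both \<open>k\<close> and 1 are at most
    \<open>k * k\<close>, and 5 + 4 + 2 = 11.\<close>
  proof (rule bigoI[where c = 11])
    have "5 * k * k + 4 * k + 2 \<le> 11 * k\<^sup>2" if "1 \<le> k" for k :: nat
    proof -
      have "k * 1 \<le> k * k" "1 * 1 \<le> k * k" using that by (intro mult_le_mono; simp)+
      then show ?thesis unfolding power2_eq_square mult.assoc by linarith
    qed
    then have "real (5 * k * k + 4 * k + 2) \<le> real (11 * k\<^sup>2)" if "1 \<le> k" for k :: nat
      using that of_nat_mono by blast
    then show "\<forall>\<^sub>F k::nat in at_top. norm (real (5 * k * k + 4 * k + 2)) \<le> 11 * norm (real k ^ 2)"
      by (intro eventually_at_top_linorderI[of 1]) simp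
  qed
  fix x assume "x \<in> instances (cut_enum_problem is_sol)"
  then obtain n E k where x: "x = (n, E, k)" "vc_instance n E k" by (cases x) auto
  show "real (num_vertices (kernel_graph x))
      \<le> real (5 * param (cut_enum_problem is_sol) x * param (cut_enum_problem is_sol) x
        + 4 * param (cut_enum_problem is_sol) x + 2)"
    using vc_instance.kernel_size[OF x(2)] unfolding x(1) of_nat_le_iff by (simp add: kernel_graph_def)
qed

text \<open>The three problems differ only in \<open>is_sol\<close> and in the measure
  \<open>time_le\<close>, and the functions computed by \<open>A\<close> and \<open>A'\<close>
  mention neither. All that is asked of \<open>is_sol\<close> is the correspondence along
  \<open>\<rho>\<close> and that solutions are edge sets; \<open>time\<close> turns bounded
  stretches and the number of outputs into the required bound.\<close>

lemma enum_kernel_exists: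
  assumes sol: "\<And>n E k M. vc_instance n E k \<Longrightarrow> is_sol {..<n} E M \<longleftrightarrow>
      M \<subseteq> vc_instance.Good n E k \<and> inj_on (vc_instance.\<rho> n E k) M \<and>
      is_sol {..<vc_instance.nH n E k} (vc_instance.EH n E k) (vc_instance.\<rho> n E k ` M)"
    and sub: "\<And>V E M. is_sol V E M \<Longrightarrow> M \<subseteq> E"
    and time: "\<And>n E k s D tr vs. vc_instance n E k \<Longrightarrow>
      is_sol {..<vc_instance.nH n E k} (vc_instance.EH n E k) s \<Longrightarrow>
      length vs = length (choices (vc_instance.options_list n E k s)) \<Longrightarrow>
      segmented D D tr vs \<Longrightarrow> time_le (poly r (D + vsize (graph_code (n, E, k)))) tr"
    and time_mono: "\<And>d d' tr. d \<le> d' \<Longrightarrow> time_le d tr \<Longrightarrow> time_le d' tr"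
  shows "\<exists>A A'. enum_kernel time_le (cut_enum_problem is_sol) kernel_graph A A'"
proof -
  obtain A :: com and p :: "nat poly" where
    A: "\<And>v. \<exists>tr. runs A v tr \<and> outputs tr = [kernel_code v] \<and> length tr \<le> poly p (vsize v)"
    using ptime_kernel_code by (rule runs_function) blast
  obtain A' :: com and q :: "nat poly" where
    A': "\<And>v. \<forall>l\<in>set (options_code v). l \<noteq> [] \<Longrightarrow>
      \<exists>tr. runs A' v tr \<and> segmented (poly q (vsize v)) (poly q (vsize v)) tr
        (map (\<lambda>h. choice_code v (enc_list h)) (choices (options_code v)))"
    using ptime_options_code ptime_choice_code by (rule product_enumeration) blast
  let ?Q = "cut_enum_problem is_sol"
  \<comment> \<open>The classes are the fibres of \<open>compressed\<close> among the solutions, so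
    disjointness holds at once, and distinct kernel solutions get distinct classes as soon as the
    fibres are nonempty.\<close>
  define S where "S x s = {M \<in> solutions ?Q x. compressed x M = s}" for x s
  \<comment> \<open>The coefficients are those of the vertex bound in \<open>kernel_size\<close>,
    constant term first.\<close>
  define b :: "nat poly" where "b = [:2, 4, 5:]"
  define X :: "nat poly" where "X = [:0, 1:]"
  define size_poly where "size_poly = 5 + b + 2 * X + b * b * (2 * b + 4)"
  \<comment> \<open>The input of \<open>A'\<close> combines both instances with a cut whose code is
    no larger than that of the kernel, so its size is at most 2 plus twice the sum of the two
    sizes.\<close>
  define time_poly where "time_poly = r \<circ>\<^sub>p (q \<circ>\<^sub>p (2 + 2 * X) + X)"
  have "poly X m = m" for m by (simp add: X_def)
  then have time_poly: "poly time_poly m = poly r (poly q (2 + 2 * m) + m)" for m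
    by (simp add: time_poly_def poly_pcompose)
  have K: "kernel_graph x \<in> instances ?Q" and Kc: "kernel_code (graph_code x) = graph_code (kernel_graph x)"
    and Ks: "vsize (graph_code (kernel_graph x)) + param ?Q (kernel_graph x) \<le> poly size_poly (param ?Q x)"
    if "x \<in> instances ?Q" for x
  proof -
    obtain n E k where x: "x = (n, E, k)" "vc_instance n E k" using \<open>x \<in> instances ?Q\<close> by (cases x) auto
    interpret vc_instance n E k by (rule x(2))
    have Kx: "kernel_graph (n, E, k) = (nH, EH, k)" by (simp add: kernel_graph_def)
    have "vc_instance nH EH k"
      using simple_graph_kernel vertex_cover_number_kernel by unfold_locales auto
    then show "kernel_graph x \<in> instances ?Q" by (simp add: Kx x(1))
    show "kernel_code (graph_code x) = graph_code (kernel_graph x)"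
      using kernel_code by (simp add: Kx x(1))
    have "poly b k = 5 * k * k + 4 * k + 2" by (simp add: b_def algebra_simps)
    then have nH: "nH \<le> poly b k" using kernel_size by simp
    then have "nH * nH * (2 * nH + 4) \<le> poly b k * poly b k * (2 * poly b k + 4)"
      by (intro mult_le_mono) auto
    then show "vsize (graph_code (kernel_graph x)) + param ?Q (kernel_graph x) \<le> poly size_poly (param ?Q x)"
      using enc_size_kernel nH by (simp add: Kx x(1) size_poly_def X_def)
  qed
  have "enum_kernel time_le ?Q kernel_graph A A'"
    unfolding enum_kernel_def
  proof (intro conjI)
    show "\<exists>p :: nat poly. \<forall>x\<in>instances ?Q. kernel_graph x \<in> instances ?Q \<and>
        (\<exists>tr. runs A (enc_inst ?Q x) tr \<and> outputs tr = [enc_inst ?Q (kernel_graph x)] \<and>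
          total_time_le (poly p (inst_size ?Q x + param ?Q x)) tr)"
    proof (intro exI[of _ p] ballI conjI)
      fix x assume x: "x \<in> instances ?Q"
      then show "kernel_graph x \<in> instances ?Q" by (rule K)
      have "poly p (vsize (graph_code x)) \<le> poly p (vsize (graph_code x) + param ?Q x)"
        by (rule poly_nat_mono) simp
      then show "\<exists>tr. runs A (enc_inst ?Q x) tr \<and> outputs tr = [enc_inst ?Q (kernel_graph x)] \<and>
          total_time_le (poly p (inst_size ?Q x + param ?Q x)) tr"
        using A[of "graph_code x"] Kc[OF x] unfolding total_time_le_def by (auto intro: le_trans)
    qed
    show "\<exists>f. computable_nat_fun f \<and>
        (\<forall>x\<in>instances ?Q. inst_size ?Q (kernel_graph x) + param ?Q (kernel_graph x) \<le> f (param ?Q x))"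
    proof (intro exI conjI ballI)
      show "computable_nat_fun (poly size_poly)" by (rule computable_poly)
      fix x assume "x \<in> instances ?Q"
      then show "inst_size ?Q (kernel_graph x) + param ?Q (kernel_graph x) \<le> poly size_poly (param ?Q x)"
        using Ks[of x] by (simp only: cut_enum_problem_simps(6))
    qed
    show "\<exists>(q :: nat poly) S. \<forall>x\<in>instances ?Q.
        (\<forall>s\<in>solutions ?Q (kernel_graph x). \<exists>tr.
          runs A' (P (enc_inst ?Q x) (P (enc_inst ?Q (kernel_graph x)) (enc_sol ?Q s))) tr \<and>
          distinct (outputs tr) \<and> set (outputs tr) = enc_sol ?Q ` S x s \<and>
          time_le (poly q (inst_size ?Q x + inst_size ?Q (kernel_graph x) + param ?Q x
            + param ?Q (kernel_graph x))) tr) \<and>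
        inj_on (S x) (solutions ?Q (kernel_graph x)) \<and>
        partition_on (solutions ?Q x) (S x ` solutions ?Q (kernel_graph x))"
    proof (intro exI[of _ time_poly] exI[of _ S] ballI)
      fix x assume "x \<in> instances ?Q"
      then obtain n E k where x: "x = (n, E, k)" "vc_instance n E k" by (cases x) auto
      interpret vc_instance n E k by (rule x(2))
      have Kx: "kernel_graph (n, E, k) = (nH, EH, k)" by (simp add: kernel_graph_def)
      have S: "S x s = {M. M \<subseteq> Good \<and> inj_on \<rho> M \<and> \<rho> ` M = s}" if "is_sol {..<nH} EH s" for s
        using that sol[OF x(2)] by (auto simp: S_def compressed_def x(1))
      have ne: "S x s \<noteq> {}" if s: "is_sol {..<nH} EH s" for s
      proof -
        \<comment> \<open>Every subset of an image is the image of a set on which the map is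
          injective.\<close>
        have "s \<subseteq> \<rho> ` Good" using sub[OF s] \<rho>_Good by simp
        then show ?thesis unfolding S[OF s] by (auto simp: subset_image_inj)
      qed
      have comp: "compressed x M = s" if "M \<in> S x s" for M s using that by (simp add: S_def)
      have inj: "inj_on (S x) (solutions ?Q (kernel_graph x))"
      proof (rule inj_onI)
        fix s t assume s: "s \<in> solutions ?Q (kernel_graph x)" and eq: "S x s = S x t"
        have "S x s \<noteq> {}" by (rule ne) (use s in \<open>simp add: Kx x(1)\<close>)
        then obtain M where M: "M \<in> S x s" by blast
        then have "M \<in> S x t" unfolding eq .
        then show "s = t" using comp M by metis
      qed
      have part: "partition_on (solutions ?Q x) (S x ` solutions ?Q (kernel_graph x))"
      proof (rule partition_onI)
        show "\<Union> (S x ` solutions ?Q (kernel_graph x)) = solutions ?Q x"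
        proof (intro set_eqI iffI)
          fix M assume M: "M \<in> solutions ?Q x"
          then have "compressed x M \<in> solutions ?Q (kernel_graph x)"
            using sol[OF x(2)] by (simp add: Kx x(1) compressed_def)
          moreover have "M \<in> S x (compressed x M)" using M by (simp add: S_def)
          ultimately show "M \<in> \<Union> (S x ` solutions ?Q (kernel_graph x))" by blast
        qed (auto simp: S_def)
        show "disjnt A B" if "A \<in> S x ` solutions ?Q (kernel_graph x)"
          "B \<in> S x ` solutions ?Q (kernel_graph x)" "A \<noteq> B" for A B
        proof -
          obtain s t where st: "A = S x s" "B = S x t" using \<open>A \<in> _\<close> \<open>B \<in> _\<close> by (metis imageE)
          show ?thesis unfolding disjnt_iff
          proof (intro allI notI)
            fix M assume "M \<in> A \<and> M \<in> B"
            then have "s = t" unfolding st using comp by metis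
            then show False using \<open>A \<noteq> B\<close> st by simp
          qed
        qed
        show "{} \<notin> S x ` solutions ?Q (kernel_graph x)" using ne by (auto simp: Kx x(1))
      qed
      have run: "\<exists>tr. runs A' (P (graph_code x) (P (graph_code (kernel_graph x)) (enc_edges s))) tr \<and>
          distinct (outputs tr) \<and> set (outputs tr) = enc_edges ` S x s \<and>
          time_le (poly time_poly (vsize (graph_code x) + vsize (graph_code (kernel_graph x)) + k + k)) tr"
        if s: "is_sol {..<nH} EH s" for s
      proof -
        let ?y = "graph_code (nH, EH, k)" let ?v = "P (graph_code (n, E, k)) (P ?y (enc_edges s))"
        let ?D = "poly q (vsize ?v)"
        note enum = enumerated[OF sub[OF s]]
        have "\<forall>l\<in>set (options_code ?v). l \<noteq> []" using enum(3) by (simp add: options_code)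
        from A'[OF this] obtain tr where tr: "runs A' ?v tr"
          "segmented ?D ?D tr (map (\<lambda>h. choice_code ?v (enc_list h)) (choices (options_code ?v)))"
          by blast
        let ?out = "map (\<lambda>c. enc_edges (und ` set c)) (choices (options_list s))"
        have out: "map (\<lambda>h. choice_code ?v (enc_list h)) (choices (options_code ?v)) = ?out"
          using enum(4) by (simp add: options_code map_choices choice_code)
        have outs: "outputs tr = ?out" using segmented_outputs[OF tr(2)] out by simp
        have "time_le (poly r (?D + vsize (graph_code (n, E, k)))) tr"
          by (rule time[OF x(2) s _ tr(2)]) (simp only: out length_map)
        moreover have "poly r (?D + vsize (graph_code (n, E, k)))
            \<le> poly time_poly (vsize (graph_code (n, E, k)) + vsize ?y + k + k)" (is "_ \<le> poly _ ?m")
        proof -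
          have "vsize (enc_edges s) \<le> vsize ?y"
            using vsize_enc_edges_kernel[OF sub[OF s]] by (simp add: graph_code_def)
          then have "vsize ?v \<le> 2 + 2 * ?m" by simp
          then have "?D \<le> poly q (2 + 2 * ?m)" by (rule poly_nat_mono)
          then have "?D + vsize (graph_code (n, E, k)) \<le> poly q (2 + 2 * ?m) + ?m" by simp
          then have "poly r (?D + vsize (graph_code (n, E, k))) \<le> poly r (poly q (2 + 2 * ?m) + ?m)"
            by (rule poly_nat_mono)
          also have "poly r (poly q (2 + 2 * ?m) + ?m) = poly time_poly ?m" by (simp only: time_poly)
          finally show ?thesis .
        qed
        ultimately have "time_le (poly time_poly (vsize (graph_code (n, E, k)) + vsize ?y + k + k)) tr"
          by (rule time_mono[rotated])
        moreover have "distinct (outputs tr)" unfolding outs by (rule enum(1))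
        moreover have "set (outputs tr) = enc_edges ` S x s" unfolding outs enum(2) S[OF s] ..
        ultimately show ?thesis
          using tr(1) unfolding x(1) Kx by (intro exI[of _ tr] conjI)
      qed
      show "(\<forall>s\<in>solutions ?Q (kernel_graph x). \<exists>tr.
          runs A' (P (enc_inst ?Q x) (P (enc_inst ?Q (kernel_graph x)) (enc_sol ?Q s))) tr \<and>
          distinct (outputs tr) \<and> set (outputs tr) = enc_sol ?Q ` S x s \<and>
          time_le (poly time_poly (inst_size ?Q x + inst_size ?Q (kernel_graph x) + param ?Q x
            + param ?Q (kernel_graph x))) tr) \<and>
        inj_on (S x) (solutions ?Q (kernel_graph x)) \<and>
        partition_on (solutions ?Q x) (S x ` solutions ?Q (kernel_graph x))"
        using run inj part by (simp add: Kx x(1))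
    qed
  qed
  then show ?thesis by blast
qed

lemma delay_le_mono: "d \<le> d' \<Longrightarrow> delay_le d tr \<Longrightarrow> delay_le d' tr"
  unfolding delay_le_def using le_trans by blast

lemma delay_segmented:
  "segmented D D tr vs \<Longrightarrow> delay_le (poly [:0, 1:] (D + m)) tr"
  using delay_le_mono[OF _ segmented_delay[OF _ order_refl], of D "D + m"] by simp

theorem theorem15:
  shows "(\<exists>K A A'. fully_polynomial_enum_kernel enum_minimal_MC K A A' \<and>
            quadratic_vertices enum_minimal_MC K) \<and>
         (\<exists>K A A'. polynomial_delay_enum_kernel enum_MC K A A' \<and>
            quadratic_vertices enum_MC K) \<and>
         (\<exists>K A A'. polynomial_delay_enum_kernel enum_maximal_MC K A A' \<and>
            quadratic_vertices enum_maximal_MC K)"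
proof (intro conjI)
  have "\<exists>A A'. enum_kernel total_time_le (cut_enum_problem minimal_matching_cut) kernel_graph A A'"
  \<comment> \<open>The first factor bounds the number of stretches, one more than the number of
    outputs, and the second the length of a stretch with its output.\<close>
  proof (rule enum_kernel_exists[OF vc_instance.minimal_matching_cut_iff_kernel,
        where r = "([:2, 1:] :: nat poly) * [:1, 1:]"])
    fix n E k s D tr and vs :: "val list"
    assume "vc_instance n E k" and s: "minimal_matching_cut {..<vc_instance.nH n E k} (vc_instance.EH n E k) s"
      and len: "length vs = length (choices (vc_instance.options_list n E k s))" and tr: "segmented D D tr vs"
    interpret vc_instance n E k by fact
    let ?m = "D + vsize (graph_code (n, E, k))"
    have "length (edge_list E) \<le> vsize (graph_code (n, E, k))"
      using length_le_vsize[of "map pair_code (edge_list E)"]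
      by (simp add: graph_code_def enc_edges_eq)
    then have "Suc (length vs) \<le> 2 + ?m" using length_choices_minimal[OF s] len by simp
    then have "Suc (length vs) * Suc D \<le> (2 + ?m) * (1 + ?m)" by (intro mult_le_mono) auto
    with segmented_length[OF tr order_refl]
    show "total_time_le (poly ([:2, 1:] * [:1, 1:]) ?m) tr"
      unfolding total_time_le_def poly_mult by simp
  next
    show "M \<subseteq> E" if "minimal_matching_cut V E M" for V E and M :: "nat set set"
      using that matching_cut_subset unfolding minimal_matching_cut_def by blast
  qed (auto simp: total_time_le_def)
  then show "\<exists>K A A'. fully_polynomial_enum_kernel enum_minimal_MC K A A' \<and>
      quadratic_vertices enum_minimal_MC K"
    unfolding fully_polynomial_enum_kernel_def enum_minimal_MC_def using quadratic_kernel by blast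
  \<comment> \<open>For delays the number of outputs is irrelevant: the bound \<open>D\<close> on
    all stretches is itself the delay, so the identity polynomial suffices.\<close>
  have "\<exists>A A'. enum_kernel delay_le (cut_enum_problem matching_cut) kernel_graph A A'"
    by (rule enum_kernel_exists[where is_sol = matching_cut and time_le = delay_le and r = "[:0, 1:]",
          OF vc_instance.matching_cut_iff_kernel matching_cut_subset
          delay_segmented delay_le_mono])
  then show "\<exists>K A A'. polynomial_delay_enum_kernel enum_MC K A A' \<and> quadratic_vertices enum_MC K"
    unfolding polynomial_delay_enum_kernel_def enum_MC_def using quadratic_kernel by blast
  have sub: "maximal_matching_cut V E M \<Longrightarrow> M \<subseteq> E" for V E and M :: "nat set set"
    using matching_cut_subset unfolding maximal_matching_cut_def by blast
  have "\<exists>A A'. enum_kernel delay_le (cut_enum_problem maximal_matching_cut) kernel_graph A A'"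
    by (rule enum_kernel_exists[where is_sol = maximal_matching_cut and time_le = delay_le and r = "[:0, 1:]",
          OF vc_instance.maximal_matching_cut_iff_kernel sub
          delay_segmented delay_le_mono])
  then show "\<exists>K A A'. polynomial_delay_enum_kernel enum_maximal_MC K A A' \<and>
      quadratic_vertices enum_maximal_MC K"
    unfolding polynomial_delay_enum_kernel_def enum_maximal_MC_def using quadratic_kernel by blast
qed

end
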